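(* (i) Let $(\Omega,\mathcal H)$ be an elliptic strong biharmonic space satisfying the standing assumptions listed in the context, and let $K\subset\Omega$ be compact. If $(\lambda,0)$ is a pure binormal pair for $K$, then the measure $\lambda$ is $1$-normal for $K$. (ii) The converse does not hold in general, even if the two associated harmonic spaces coincide: there exist an elliptic strong biharmonic space $(\Omega,\mathcal H)$ satisfying the standing assumptions with $\mathcal H_1=\mathcal H_2$, a compact set $K\subset\Omega$, and a measure $\lambda$ that is $1$-normal for $K$ such that $(\lambda,0)$ is not a pure binormal pair for $K$.
   Context: Biharmonic spaces. $\Omega$ is a locally compact, connected space with countable basis; $\mathcal H$ associates to each nonempty open $U\subset\Omega$ a linear subspace $\mathcal H(U)\subset C(U)\times C(U)$ of compatible pairs $(u_1,u_2)$ (if $u_1=0$ on an open set then $u_2=0$ there), called biharmonic on $U$. A nonempty relatively compact open set $\omega$ with $\partial\omega\ne\varnothing$ is regular if for every $f=(f_1,f_2)\in C(\partial\omega)^2$ the Riquier boundary value problem (find a pair biharmonic in $\omega$ whose components have boundary values $f_1,f_2$) has a unique solution $(H_1^{\omega,f},H_2^{\omega,f})$, with $f_1,f_2\ge0\Rightarrow H_1^{\omega,f}\ge 0$ and $f_2\ge 0\Rightarrow H_2^{\omega,f}\ge0$; hence for $x\in\omega$ there are unique nonnegative Radon measures $\lambda_x^\omega,\mu_x^\omega,\nu_x^\omega$ on $\partial\omega$ with $H_1^{\omega,f}(x)=\int f_1d\mu_x^\omega+\int f_2d\nu_x^\omega$, $H_2^{\omega,f}(x)=\int f_2d\lambda_x^\omega$.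 A pair $(v_1,v_2)$ of lower semicontinuous functions $U\to(-\infty,+\infty]$ is hyperharmonic if $v_1(x)\ge\int v_1d\mu_x^\omega+\int v_2d\nu_x^\omega$ and $v_2(x)\ge\int v_2d\lambda_x^\omega$ for every regular $\omega\subset\overline\omega\subset U$ and $x\in\omega$; superharmonic if moreover $v_1$ is finite on a dense set. A potential pair is a nonnegative superharmonic pair $(p_1,p_2)$ such that $(0,0)$ is the only biharmonic pair $(h_1,h_2)$ with $0\le h_j\le p_j$, $j=1,2$. $(\Omega,\mathcal H)$ is a biharmonic space if it satisfies axioms I–IV of E. P. Smyrnelis' axiomatic theory of biharmonic functions (sheaf property; the regular sets form a basis of the topology; monotone convergence property; separation property). It is elliptic if $\operatorname{supp}\lambda_x^\omega=\operatorname{supp}\mu_x^\omega=\operatorname{supp}\nu_x^\omega=\partial\omega$ for all regular $\omega$ and $x\in\omega$, and strong if a strictly positive potential pair exists on $\Omega$. The associated harmonic spaces are $(\Omega,\mathcal H_1)$, with $\mathcal H_1(U)=\{u:(u,0)\in\mathcal H(U)\}$ (harmonic measures $\mu_x^\omega$), and $(\Omega,\mathcal H_2)$, whose functions are those that are locally second components of biharmonic pairs (harmonic measures $\lambda_x^\omega$); the prefixes $1$-, $2$- refer to them. Standing assumptions. $(\Omega,\mathcal H)$ is an elliptic strong biharmonic connected space; for $i=1,2$, the $i$-Green's potentials ($i$-potentials with one-point $i$-harmonic support) with the same support are proportional, likewise for the adjoint $i$-Green's potentials; and for $i=1,2$ there is a basis of completely determining domains (relatively compact domains $\omega$ such that every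 $i$-potential on $\Omega$ that is $i$-harmonic in $\omega$ equals its swept function on $\complement\omega$). Sweeping. For a nonnegative hyperharmonic pair $v=(v_1,v_2)$ on $\Omega$ and $E\subset\Omega$, the swept pair $(V_1^E,V_2^E)$ on $E$ consists of the lower semicontinuous regularizations of the infima of the components $w_1$, $w_2$ over all nonnegative hyperharmonic pairs $(w_1,w_2)$ on $\Omega$ with $w_j\ge v_j$ on $E$ ($j=1,2$). For nonnegative measures $\sigma,\tau$ with compact support, the swept pair $(\sigma,\tau)^E=(A_1,A_2)$ is the pair of nonnegative measures with $\int p_1dA_1+\int p_2dA_2=\int P_1^Ed\sigma+\int P_2^Ed\tau$ for every continuous potential pair $(p_1,p_2)$ on $\Omega$ with swept pair $(P_1^E,P_2^E)$; it is extended linearly to signed measures. $\complement K=\Omega\setminus K$. Normality. "Measure" means signed Radon measure. For measures supported by $K$: $(\lambda,0)$ is pure binormal for $K$ if $(\lambda,0)^{\complement K}=(0,0)$; $\lambda$ is $1$-normal for $K$ if its swept measure on $\complement K$ in the harmonic space $(\Omega,\mathcal H_1)$ is zero (equivalently $\int p^1_y\,d\lambda=0$ for all $y\in\complement K$, $p^1_y$ being the $1$-Green's potential of support $\{y\}$).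
   Formalization: Ellipticity is required only for connected regular sets: the union of two regular sets with disjoint closures is regular, but its measures at a point of one do not charge the boundary of the other, so the literal condition never holds on a nonempty space. *)

theory Defs
  imports "HOL-Analysis.Analysis"
begin

section \<open>Measures, integrals, semicontinuity\<close>

definition borel_of :: "'a topology \<Rightarrow> 'a measure" where
  "borel_of X = sigma (topspace X) {U. openin X U}"

text \<open>On the locally compact Hausdorff spaces with countable basis considered here, the
  nonnegative Radon measures are the Borel measures that are finite on compact sets.\<close>

definition radon_measure :: "'a topology \<Rightarrow> 'a measure \<Rightarrow> bool" where
  "radon_measure X M \<longleftrightarrow>
     sets M = sets (borel_of X) \<and> (\<forall>C. compactin X C \<longrightarrow> emeasure M C < \<infinity>)"

definition radon_measure_on :: "'a topology \<Rightarrow> 'a set \<Rightarrow> 'a measure \<Rightarrow> bool" where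
  "radon_measure_on X C M \<longleftrightarrow> radon_measure X M \<and> emeasure M (topspace X - C) = 0"

definition support_of :: "'a topology \<Rightarrow> 'a measure \<Rightarrow> 'a set" where
  "support_of X M = {x \<in> topspace X. \<forall>V. openin X V \<and> x \<in> V \<longrightarrow> emeasure M V > 0}"

text \<open>Signed Radon measures supported by a compact set \<open>K\<close>, as set functions on the Borel sets.\<close>

definition signed_measure_on :: "'a topology \<Rightarrow> 'a set \<Rightarrow> ('a set \<Rightarrow> real) \<Rightarrow> bool" where
  "signed_measure_on X K m \<longleftrightarrow>
     (\<forall>A::nat \<Rightarrow> 'a set. range A \<subseteq> sets (borel_of X) \<and> disjoint_family A
        \<longrightarrow> (\<lambda>n. m (A n)) sums m (\<Union>n. A n)) \<and>
     (\<forall>B\<in>sets (borel_of X). B \<inter> K = {} \<longrightarrow> m B = 0)"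

definition difference_on ::
    "'a topology \<Rightarrow> 'a set \<Rightarrow> ('a set \<Rightarrow> real) \<Rightarrow> 'a measure \<Rightarrow> 'a measure \<Rightarrow> bool" where
  "difference_on X K m \<sigma> \<tau> \<longleftrightarrow>
     radon_measure_on X K \<sigma> \<and> radon_measure_on X K \<tau> \<and>
     (\<forall>B\<in>sets (borel_of X). m B = measure \<sigma> B - measure \<tau> B)"

text \<open>Integral over \<open>S\<close> of an extended real function; it is only used for functions that are
  bounded below on \<open>S\<close> and measures that are finite on \<open>S\<close>, so the subtrahend is finite.\<close>

definition ext_integral :: "'a measure \<Rightarrow> 'a set \<Rightarrow> ('a \<Rightarrow> ereal) \<Rightarrow> ereal" where
  "ext_integral M S v =
     enn2ereal (\<integral>\<^sup>+x\<in>S. e2ennreal (v x) \<partial>M) - enn2ereal (\<integral>\<^sup>+x\<in>S. e2ennreal (- v x) \<partial>M)"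

text \<open>Lower semicontinuous functions with values in \<open>(-\<infinity>, \<infinity>]\<close>.\<close>

definition lsc_on :: "'a topology \<Rightarrow> 'a set \<Rightarrow> ('a \<Rightarrow> ereal) \<Rightarrow> bool" where
  "lsc_on X U v \<longleftrightarrow>
     (\<forall>x\<in>U. v x \<noteq> -\<infinity>) \<and>
     (\<forall>a::real. openin (subtopology X U) {x \<in> topspace X \<inter> U. ereal a < v x})"

definition lsc_regularization :: "'a topology \<Rightarrow> ('a \<Rightarrow> ereal) \<Rightarrow> 'a \<Rightarrow> ereal" where
  "lsc_regularization X f x = (SUP V\<in>{V. openin X V \<and> x \<in> V}. INF y\<in>V. f y)"

definition nonneg_on :: "'a set \<Rightarrow> ('a \<Rightarrow> ereal) \<Rightarrow> bool" where
  "nonneg_on U v \<longleftrightarrow> (\<forall>x\<in>U. 0 \<le> v x)"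

definition relatively_compact :: "'a topology \<Rightarrow> 'a set \<Rightarrow> bool" where
  "relatively_compact X U \<longleftrightarrow> U \<subseteq> topspace X \<and> compactin X (X closure_of U)"


section \<open>Sheaves of pairs and the Riquier problem\<close>

text \<open>A function on an open set \<open>U\<close> is represented by a total function whose values outside
  \<open>U\<close> are irrelevant; \<open>presheaf_of_pairs\<close> requires \<open>H U\<close> to respect this.\<close>

type_synonym 'a pairs = "'a set \<Rightarrow> (('a \<Rightarrow> real) \<times> ('a \<Rightarrow> real)) set"

definition presheaf_of_pairs :: "'a topology \<Rightarrow> 'a pairs \<Rightarrow> bool" where
  "presheaf_of_pairs X H \<longleftrightarrow> (\<forall>U. openin X U \<and> U \<noteq> {} \<longrightarrow>
     (\<forall>(u1, u2)\<in>H U.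
        continuous_map (subtopology X U) euclideanreal u1 \<and>
        continuous_map (subtopology X U) euclideanreal u2 \<and>
        (\<forall>V. openin X V \<and> V \<subseteq> U \<and> (\<forall>x\<in>V. u1 x = 0) \<longrightarrow> (\<forall>x\<in>V. u2 x = 0)) \<and>
        (\<forall>v1 v2. (\<forall>x\<in>U. v1 x = u1 x \<and> v2 x = u2 x) \<longrightarrow> (v1, v2) \<in> H U)) \<and>
     (\<lambda>x. 0, \<lambda>x. 0) \<in> H U \<and>
     (\<forall>(u1, u2)\<in>H U. \<forall>(v1, v2)\<in>H U. \<forall>a b.
        (\<lambda>x. a * u1 x + b * v1 x, \<lambda>x. a * u2 x + b * v2 x) \<in> H U))"

definition sheaf_axiom :: "'a topology \<Rightarrow> 'a pairs \<Rightarrow> bool" where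
  "sheaf_axiom X H \<longleftrightarrow>
     (\<forall>U V. openin X U \<and> openin X V \<and> V \<noteq> {} \<and> V \<subseteq> U \<longrightarrow> H U \<subseteq> H V) \<and>
     (\<forall>\<U> u. \<U> \<noteq> {} \<and> (\<forall>U\<in>\<U>. openin X U \<and> U \<noteq> {} \<and> u \<in> H U) \<longrightarrow> u \<in> H (\<Union>\<U>))"

definition riquier_solution ::
    "'a topology \<Rightarrow> 'a pairs \<Rightarrow> 'a set \<Rightarrow> ('a \<Rightarrow> real) \<Rightarrow> ('a \<Rightarrow> real)
       \<Rightarrow> ('a \<Rightarrow> real) \<Rightarrow> ('a \<Rightarrow> real) \<Rightarrow> bool" where
  "riquier_solution X H \<omega> f1 f2 h1 h2 \<longleftrightarrow>
     (h1, h2) \<in> H \<omega> \<and>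
     (\<forall>z\<in>X frontier_of \<omega>. (h1 \<longlongrightarrow> f1 z) (atin_within X z \<omega>) \<and>
                           (h2 \<longlongrightarrow> f2 z) (atin_within X z \<omega>))"

definition cont_on :: "'a topology \<Rightarrow> 'a set \<Rightarrow> ('a \<Rightarrow> real) \<Rightarrow> bool" where
  "cont_on X S f \<longleftrightarrow> continuous_map (subtopology X S) euclideanreal f"

definition regular_set :: "'a topology \<Rightarrow> 'a pairs \<Rightarrow> 'a set \<Rightarrow> bool" where
  "regular_set X H \<omega> \<longleftrightarrow>
     openin X \<omega> \<and> \<omega> \<noteq> {} \<and> relatively_compact X \<omega> \<and> X frontier_of \<omega> \<noteq> {} \<and>
     (\<forall>f1 f2. cont_on X (X frontier_of \<omega>) f1 \<and> cont_on X (X frontier_of \<omega>) f2 \<longrightarrow>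
        (\<exists>h1 h2. riquier_solution X H \<omega> f1 f2 h1 h2 \<and>
           (\<forall>k1 k2. riquier_solution X H \<omega> f1 f2 k1 k2 \<longrightarrow>
              (\<forall>x\<in>\<omega>. k1 x = h1 x \<and> k2 x = h2 x)) \<and>
           ((\<forall>z\<in>X frontier_of \<omega>. 0 \<le> f1 z \<and> 0 \<le> f2 z) \<longrightarrow> (\<forall>x\<in>\<omega>. 0 \<le> h1 x)) \<and>
           ((\<forall>z\<in>X frontier_of \<omega>. 0 \<le> f2 z) \<longrightarrow> (\<forall>x\<in>\<omega>. 0 \<le> h2 x))))"

text \<open>The triple \<open>(\<mu>, \<nu>, \<lambda>)\<close> of the measures (\<open>\<lambda>\<close> being written \<open>\<kappa>\<close>) representing the Riquier solution at \<open>x \<in> \<omega>\<close>.\<close>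

definition riquier_measures ::
    "'a topology \<Rightarrow> 'a pairs \<Rightarrow> 'a set \<Rightarrow> 'a \<Rightarrow> 'a measure \<times> 'a measure \<times> 'a measure" where
  "riquier_measures X H \<omega> x = (THE (\<mu>, \<nu>, \<kappa>).
     radon_measure_on X (X frontier_of \<omega>) \<mu> \<and>
     radon_measure_on X (X frontier_of \<omega>) \<nu> \<and>
     radon_measure_on X (X frontier_of \<omega>) \<kappa> \<and>
     (\<forall>f1 f2 h1 h2. cont_on X (X frontier_of \<omega>) f1 \<and> cont_on X (X frontier_of \<omega>) f2 \<and>
        riquier_solution X H \<omega> f1 f2 h1 h2 \<longrightarrow>
        h1 x = (LINT z:X frontier_of \<omega>|\<mu>. f1 z) + (LINT z:X frontier_of \<omega>|\<nu>. f2 z) \<and>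
        h2 x = (LINT z:X frontier_of \<omega>|\<kappa>. f2 z)))"

definition mu_measure :: "'a topology \<Rightarrow> 'a pairs \<Rightarrow> 'a set \<Rightarrow> 'a \<Rightarrow> 'a measure" where
  "mu_measure X H \<omega> x = fst (riquier_measures X H \<omega> x)"

definition nu_measure :: "'a topology \<Rightarrow> 'a pairs \<Rightarrow> 'a set \<Rightarrow> 'a \<Rightarrow> 'a measure" where
  "nu_measure X H \<omega> x = fst (snd (riquier_measures X H \<omega> x))"

definition lambda_measure :: "'a topology \<Rightarrow> 'a pairs \<Rightarrow> 'a set \<Rightarrow> 'a \<Rightarrow> 'a measure" where
  "lambda_measure X H \<omega> x = snd (snd (riquier_measures X H \<omega> x))"


section \<open>Hyperharmonic, superharmonic and potential pairs\<close>

definition hyperharmonic_pair ::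
    "'a topology \<Rightarrow> 'a pairs \<Rightarrow> 'a set \<Rightarrow> ('a \<Rightarrow> ereal) \<Rightarrow> ('a \<Rightarrow> ereal) \<Rightarrow> bool" where
  "hyperharmonic_pair X H U v1 v2 \<longleftrightarrow>
     lsc_on X U v1 \<and> lsc_on X U v2 \<and>
     (\<forall>\<omega> x. regular_set X H \<omega> \<and> X closure_of \<omega> \<subseteq> U \<and> x \<in> \<omega> \<longrightarrow>
        v1 x \<ge> ext_integral (mu_measure X H \<omega> x) (X frontier_of \<omega>) v1
             + ext_integral (nu_measure X H \<omega> x) (X frontier_of \<omega>) v2 \<and>
        v2 x \<ge> ext_integral (lambda_measure X H \<omega> x) (X frontier_of \<omega>) v2)"

definition superharmonic_pair ::
    "'a topology \<Rightarrow> 'a pairs \<Rightarrow> 'a set \<Rightarrow> ('a \<Rightarrow> ereal) \<Rightarrow> ('a \<Rightarrow> ereal) \<Rightarrow> bool" where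
  "superharmonic_pair X H U v1 v2 \<longleftrightarrow>
     hyperharmonic_pair X H U v1 v2 \<and> U \<subseteq> X closure_of {x\<in>U. v1 x \<noteq> \<infinity>}"

definition nonneg_hyperharmonic_pair ::
    "'a topology \<Rightarrow> 'a pairs \<Rightarrow> ('a \<Rightarrow> ereal) \<Rightarrow> ('a \<Rightarrow> ereal) \<Rightarrow> bool" where
  "nonneg_hyperharmonic_pair X H v1 v2 \<longleftrightarrow>
     hyperharmonic_pair X H (topspace X) v1 v2 \<and>
     nonneg_on (topspace X) v1 \<and> nonneg_on (topspace X) v2"

definition potential_pair ::
    "'a topology \<Rightarrow> 'a pairs \<Rightarrow> ('a \<Rightarrow> ereal) \<Rightarrow> ('a \<Rightarrow> ereal) \<Rightarrow> bool" where
  "potential_pair X H p1 p2 \<longleftrightarrow>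
     superharmonic_pair X H (topspace X) p1 p2 \<and>
     nonneg_on (topspace X) p1 \<and> nonneg_on (topspace X) p2 \<and>
     (\<forall>(h1, h2)\<in>H (topspace X).
        (\<forall>x\<in>topspace X. 0 \<le> h1 x \<and> ereal (h1 x) \<le> p1 x \<and> 0 \<le> h2 x \<and> ereal (h2 x) \<le> p2 x)
        \<longrightarrow> (\<forall>x\<in>topspace X. h1 x = 0 \<and> h2 x = 0))"

definition continuous_potential_pair ::
    "'a topology \<Rightarrow> 'a pairs \<Rightarrow> ('a \<Rightarrow> real) \<Rightarrow> ('a \<Rightarrow> real) \<Rightarrow> bool" where
  "continuous_potential_pair X H p1 p2 \<longleftrightarrow>
     cont_on X (topspace X) p1 \<and> cont_on X (topspace X) p2 \<and>
     potential_pair X H (\<lambda>x. ereal (p1 x)) (\<lambda>x. ereal (p2 x))"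


section \<open>Biharmonic spaces\<close>

definition base_axiom :: "'a topology \<Rightarrow> 'a pairs \<Rightarrow> bool" where
  "base_axiom X H \<longleftrightarrow>
     (\<forall>U x. openin X U \<and> x \<in> U \<longrightarrow> (\<exists>\<omega>. regular_set X H \<omega> \<and> x \<in> \<omega> \<and> \<omega> \<subseteq> U))"

text \<open>Doob's form of the convergence property: the limit of an increasing sequence of biharmonic
  pairs is biharmonic as soon as it is finite on a dense set.\<close>

definition convergence_axiom :: "'a topology \<Rightarrow> 'a pairs \<Rightarrow> bool" where
  "convergence_axiom X H \<longleftrightarrow>
     (\<forall>U (h1::nat \<Rightarrow> 'a \<Rightarrow> real) h2. openin X U \<and> U \<noteq> {} \<and>
        (\<forall>n. (h1 n, h2 n) \<in> H U) \<and>
        (\<forall>n. \<forall>x\<in>U. h1 n x \<le> h1 (Suc n) x \<and> h2 n x \<le> h2 (Suc n) x) \<and>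
        U \<subseteq> X closure_of {x\<in>U. bdd_above (range (\<lambda>n. h1 n x)) \<and> bdd_above (range (\<lambda>n. h2 n x))}
        \<longrightarrow> (\<forall>x\<in>U. bdd_above (range (\<lambda>n. h1 n x)) \<and> bdd_above (range (\<lambda>n. h2 n x))) \<and>
            (\<lambda>x. SUP n. h1 n x, \<lambda>x. SUP n. h2 n x) \<in> H U)"

text \<open>Linear separation of points by the first, and by the second, components of the nonnegative
  hyperharmonic pairs on the whole space.\<close>

definition separation_axiom :: "'a topology \<Rightarrow> 'a pairs \<Rightarrow> bool" where
  "separation_axiom X H \<longleftrightarrow>
     (\<forall>x\<in>topspace X. \<forall>y\<in>topspace X. \<forall>a::real. x \<noteq> y \<and> 0 \<le> a \<longrightarrow>
        (\<exists>v1 v2. nonneg_hyperharmonic_pair X H v1 v2 \<and> v1 x \<noteq> ereal a * v1 y) \<and>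
        (\<exists>v1 v2. nonneg_hyperharmonic_pair X H v1 v2 \<and> v2 x \<noteq> ereal a * v2 y))"

definition biharmonic_space :: "'a topology \<Rightarrow> 'a pairs \<Rightarrow> bool" where
  "biharmonic_space X H \<longleftrightarrow>
     Hausdorff_space X \<and> locally_compact_space X \<and> connected_space X \<and> second_countable X \<and>
     presheaf_of_pairs X H \<and> sheaf_axiom X H \<and> base_axiom X H \<and>
     convergence_axiom X H \<and> separation_axiom X H"

text \<open>Ellipticity concerns connected regular sets: the union of two regular sets with disjoint
  closures is regular, but its measures at a point of one of them do not charge the boundary of
  the other, so the condition could not hold for all regular sets of any space.\<close>

definition elliptic :: "'a topology \<Rightarrow> 'a pairs \<Rightarrow> bool" where
  "elliptic X H \<longleftrightarrow>
     (\<forall>\<omega> x. regular_set X H \<omega> \<and> connectedin X \<omega> \<and> x \<in> \<omega> \<longrightarrow>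
        support_of X (lambda_measure X H \<omega> x) = X frontier_of \<omega> \<and>
        support_of X (mu_measure X H \<omega> x) = X frontier_of \<omega> \<and>
        support_of X (nu_measure X H \<omega> x) = X frontier_of \<omega>)"

definition strong :: "'a topology \<Rightarrow> 'a pairs \<Rightarrow> bool" where
  "strong X H \<longleftrightarrow>
     (\<exists>p1 p2. potential_pair X H p1 p2 \<and> (\<forall>x\<in>topspace X. 0 < p1 x \<and> 0 < p2 x))"


section \<open>Harmonic structures\<close>

text \<open>The notions common to the two associated harmonic spaces and to their adjoints: a sheaf of
  harmonic functions, the sets entering the mean value inequality that defines hyperharmonicity,
  and their harmonic measures (carried by the frontier).\<close>

record 'a harmonic_structure =
  harmonic :: "'a set \<Rightarrow> ('a \<Rightarrow> real) set"
  mean_sets :: "'a set set"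
  harmonic_measure :: "'a set \<Rightarrow> 'a \<Rightarrow> 'a measure"

definition hyperharmonic ::
    "'a topology \<Rightarrow> 'a harmonic_structure \<Rightarrow> 'a set \<Rightarrow> ('a \<Rightarrow> ereal) \<Rightarrow> bool" where
  "hyperharmonic X S U v \<longleftrightarrow> lsc_on X U v \<and>
     (\<forall>\<omega>\<in>mean_sets S. X closure_of \<omega> \<subseteq> U \<longrightarrow>
        (\<forall>x\<in>\<omega>. v x \<ge> ext_integral (harmonic_measure S \<omega> x) (X frontier_of \<omega>) v))"

definition superharmonic ::
    "'a topology \<Rightarrow> 'a harmonic_structure \<Rightarrow> 'a set \<Rightarrow> ('a \<Rightarrow> ereal) \<Rightarrow> bool" where
  "superharmonic X S U v \<longleftrightarrow>
     hyperharmonic X S U v \<and> U \<subseteq> X closure_of {x\<in>U. v x \<noteq> \<infinity>}"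

definition potential :: "'a topology \<Rightarrow> 'a harmonic_structure \<Rightarrow> ('a \<Rightarrow> ereal) \<Rightarrow> bool" where
  "potential X S p \<longleftrightarrow>
     superharmonic X S (topspace X) p \<and> nonneg_on (topspace X) p \<and>
     (\<forall>h\<in>harmonic S (topspace X). (\<forall>x\<in>topspace X. 0 \<le> h x \<and> ereal (h x) \<le> p x)
        \<longrightarrow> (\<forall>x\<in>topspace X. h x = 0))"

definition harmonic_in :: "'a harmonic_structure \<Rightarrow> ('a \<Rightarrow> ereal) \<Rightarrow> 'a set \<Rightarrow> bool" where
  "harmonic_in S v V \<longleftrightarrow> (\<exists>u\<in>harmonic S V. \<forall>x\<in>V. v x = ereal (u x))"

definition harmonic_support ::
    "'a topology \<Rightarrow> 'a harmonic_structure \<Rightarrow> ('a \<Rightarrow> ereal) \<Rightarrow> 'a set" where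
  "harmonic_support X S v =
     topspace X - \<Union>{V. openin X V \<and> V \<noteq> {} \<and> harmonic_in S v V}"

definition green_potential ::
    "'a topology \<Rightarrow> 'a harmonic_structure \<Rightarrow> 'a \<Rightarrow> ('a \<Rightarrow> ereal) \<Rightarrow> bool" where
  "green_potential X S y p \<longleftrightarrow> potential X S p \<and> harmonic_support X S p = {y}"

definition proportionality :: "'a topology \<Rightarrow> 'a harmonic_structure \<Rightarrow> bool" where
  "proportionality X S \<longleftrightarrow>
     (\<forall>y\<in>topspace X. \<forall>p q. green_potential X S y p \<and> green_potential X S y q \<longrightarrow>
        (\<exists>c::real. 0 < c \<and> (\<forall>x\<in>topspace X. q x = ereal c * p x)))"

definition swept ::
    "'a topology \<Rightarrow> 'a harmonic_structure \<Rightarrow> 'a set \<Rightarrow> ('a \<Rightarrow> ereal) \<Rightarrow> 'a \<Rightarrow> ereal" where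
  "swept X S E v = lsc_regularization X (\<lambda>x.
     INF w\<in>{w. hyperharmonic X S (topspace X) w \<and> nonneg_on (topspace X) w \<and>
              (\<forall>y\<in>E. v y \<le> w y)}. w x)"

definition completely_determining ::
    "'a topology \<Rightarrow> 'a harmonic_structure \<Rightarrow> 'a set \<Rightarrow> bool" where
  "completely_determining X S \<omega> \<longleftrightarrow>
     openin X \<omega> \<and> \<omega> \<noteq> {} \<and> connectedin X \<omega> \<and> relatively_compact X \<omega> \<and>
     (\<forall>p. potential X S p \<and> harmonic_in S p \<omega> \<longrightarrow>
        (\<forall>x\<in>topspace X. p x = swept X S (topspace X - \<omega>) p x))"

definition completely_determining_basis ::
    "'a topology \<Rightarrow> 'a harmonic_structure \<Rightarrow> bool" where
  "completely_determining_basis X S \<longleftrightarrow>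
     (\<forall>U x. openin X U \<and> x \<in> U \<longrightarrow>
        (\<exists>\<omega>. completely_determining X S \<omega> \<and> x \<in> \<omega> \<and> \<omega> \<subseteq> U))"


section \<open>The adjoint of a harmonic structure (R.-M. Herve)\<close>

text \<open>A normalized family of Green's potentials, \<open>p y\<close> having support \<open>{y}\<close>. Two such families
  differ by a positive continuous function of \<open>y\<close>, and passing from one to the other multiplies
  every adjoint harmonic or hyperharmonic function by it; whether adjoint Green's potentials with
  the same support are proportional does not depend on the choice.\<close>

definition green_family ::
    "'a topology \<Rightarrow> 'a harmonic_structure \<Rightarrow> ('a \<Rightarrow> 'a \<Rightarrow> ereal) \<Rightarrow> bool" where
  "green_family X S p \<longleftrightarrow>
     (\<forall>y\<in>topspace X. green_potential X S y (p y)) \<and>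
     continuous_map (subtopology (prod_topology X X) {(x, y). x \<noteq> y}) euclidean
       (\<lambda>(x, y). p y x)"

text \<open>For a completely determining domain \<open>\<omega>\<close> and \<open>y \<in> \<omega>\<close>, the adjoint harmonic measure is the
  measure on the frontier of \<open>\<omega>\<close> representing the swept function of \<open>p y\<close> on the complement
  of \<open>\<omega>\<close> as an integral of the potentials \<open>p z\<close>.\<close>

definition adjoint_measure ::
    "'a topology \<Rightarrow> 'a harmonic_structure \<Rightarrow> ('a \<Rightarrow> 'a \<Rightarrow> ereal) \<Rightarrow> 'a set \<Rightarrow> 'a \<Rightarrow> 'a measure"
  where
  "adjoint_measure X S p \<omega> y = (THE \<sigma>.
     radon_measure_on X (X frontier_of \<omega>) \<sigma> \<and>
     (\<forall>x\<in>topspace X. swept X S (topspace X - \<omega>) (p y) x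
        = ext_integral \<sigma> (X frontier_of \<omega>) (\<lambda>z. p z x)))"

definition adjoint_structure ::
    "'a topology \<Rightarrow> 'a harmonic_structure \<Rightarrow> ('a \<Rightarrow> 'a \<Rightarrow> ereal) \<Rightarrow> 'a harmonic_structure" where
  "adjoint_structure X S p =
     \<lparr> harmonic = (\<lambda>U. {u. cont_on X U u \<and>
         (\<forall>\<omega>. completely_determining X S \<omega> \<and> X closure_of \<omega> \<subseteq> U \<longrightarrow>
            (\<forall>y\<in>\<omega>. u y = (LINT z:X frontier_of \<omega>|adjoint_measure X S p \<omega> y. u z)))}),
       mean_sets = {\<omega>. completely_determining X S \<omega>},
       harmonic_measure = adjoint_measure X S p \<rparr>"

definition adjoint_proportionality :: "'a topology \<Rightarrow> 'a harmonic_structure \<Rightarrow> bool" where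
  "adjoint_proportionality X S \<longleftrightarrow>
     (\<exists>p. green_family X S p \<and> proportionality X (adjoint_structure X S p))"


section \<open>The associated harmonic spaces and the standing assumptions\<close>

definition harmonic1 :: "'a pairs \<Rightarrow> 'a set \<Rightarrow> ('a \<Rightarrow> real) set" where
  "harmonic1 H U = {u. (u, \<lambda>x. 0) \<in> H U}"

definition harmonic2 :: "'a topology \<Rightarrow> 'a pairs \<Rightarrow> 'a set \<Rightarrow> ('a \<Rightarrow> real) set" where
  "harmonic2 X H U =
     {u. \<forall>x\<in>U. \<exists>V. openin X V \<and> x \<in> V \<and> V \<subseteq> U \<and> (\<exists>u1. (u1, u) \<in> H V)}"

definition assoc1 :: "'a topology \<Rightarrow> 'a pairs \<Rightarrow> 'a harmonic_structure" where
  "assoc1 X H =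
     \<lparr> harmonic = harmonic1 H, mean_sets = {\<omega>. regular_set X H \<omega>},
       harmonic_measure = mu_measure X H \<rparr>"

definition assoc2 :: "'a topology \<Rightarrow> 'a pairs \<Rightarrow> 'a harmonic_structure" where
  "assoc2 X H =
     \<lparr> harmonic = harmonic2 X H, mean_sets = {\<omega>. regular_set X H \<omega>},
       harmonic_measure = lambda_measure X H \<rparr>"

definition associated_spaces_coincide :: "'a topology \<Rightarrow> 'a pairs \<Rightarrow> bool" where
  "associated_spaces_coincide X H \<longleftrightarrow>
     (\<forall>U. openin X U \<and> U \<noteq> {} \<longrightarrow> harmonic1 H U = harmonic2 X H U)"

definition standing_assumptions :: "'a topology \<Rightarrow> 'a pairs \<Rightarrow> bool" where
  "standing_assumptions X H \<longleftrightarrow>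
     biharmonic_space X H \<and> elliptic X H \<and> strong X H \<and>
     (\<forall>S\<in>{assoc1 X H, assoc2 X H}.
        proportionality X S \<and> adjoint_proportionality X S \<and> completely_determining_basis X S)"


section \<open>Sweeping and normality\<close>

definition sweeping_class ::
    "'a topology \<Rightarrow> 'a pairs \<Rightarrow> 'a set \<Rightarrow> ('a \<Rightarrow> ereal) \<Rightarrow> ('a \<Rightarrow> ereal)
       \<Rightarrow> (('a \<Rightarrow> ereal) \<times> ('a \<Rightarrow> ereal)) set" where
  "sweeping_class X H E v1 v2 =
     {(w1, w2). nonneg_hyperharmonic_pair X H w1 w2 \<and> (\<forall>y\<in>E. v1 y \<le> w1 y \<and> v2 y \<le> w2 y)}"

definition swept1 ::
    "'a topology \<Rightarrow> 'a pairs \<Rightarrow> 'a set \<Rightarrow> ('a \<Rightarrow> ereal) \<Rightarrow> ('a \<Rightarrow> ereal) \<Rightarrow> 'a \<Rightarrow> ereal" where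
  "swept1 X H E v1 v2 =
     lsc_regularization X (\<lambda>x. INF (w1, w2)\<in>sweeping_class X H E v1 v2. w1 x)"

definition swept2 ::
    "'a topology \<Rightarrow> 'a pairs \<Rightarrow> 'a set \<Rightarrow> ('a \<Rightarrow> ereal) \<Rightarrow> ('a \<Rightarrow> ereal) \<Rightarrow> 'a \<Rightarrow> ereal" where
  "swept2 X H E v1 v2 =
     lsc_regularization X (\<lambda>x. INF (w1, w2)\<in>sweeping_class X H E v1 v2. w2 x)"

text \<open>\<open>(A1, A2)\<close> is the swept pair on \<open>E\<close> of the pair \<open>(\<sigma>, \<tau>)\<close> of nonnegative measures.\<close>

definition swept_measure_pair ::
    "'a topology \<Rightarrow> 'a pairs \<Rightarrow> 'a set \<Rightarrow> 'a measure \<Rightarrow> 'a measure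
       \<Rightarrow> 'a measure \<Rightarrow> 'a measure \<Rightarrow> bool" where
  "swept_measure_pair X H E \<sigma> \<tau> A1 A2 \<longleftrightarrow>
     radon_measure X A1 \<and> radon_measure X A2 \<and>
     (\<forall>p1 p2. continuous_potential_pair X H p1 p2 \<longrightarrow>
        (\<integral>\<^sup>+x. ennreal (p1 x) \<partial>A1) + (\<integral>\<^sup>+x. ennreal (p2 x) \<partial>A2)
        = (\<integral>\<^sup>+x. e2ennreal (swept1 X H E (\<lambda>x. ereal (p1 x)) (\<lambda>x. ereal (p2 x)) x) \<partial>\<sigma>)
        + (\<integral>\<^sup>+x. e2ennreal (swept2 X H E (\<lambda>x. ereal (p1 x)) (\<lambda>x. ereal (p2 x)) x) \<partial>\<tau>))"

definition swept_measure ::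
    "'a topology \<Rightarrow> 'a harmonic_structure \<Rightarrow> 'a set \<Rightarrow> 'a measure \<Rightarrow> 'a measure \<Rightarrow> bool" where
  "swept_measure X S E \<sigma> A \<longleftrightarrow>
     radon_measure X A \<and>
     (\<forall>p. cont_on X (topspace X) p \<and> potential X S (\<lambda>x. ereal (p x)) \<longrightarrow>
        (\<integral>\<^sup>+x. ennreal (p x) \<partial>A)
        = (\<integral>\<^sup>+x. e2ennreal (swept X S E (\<lambda>x. ereal (p x)) x) \<partial>\<sigma>))"

text \<open>Sweeping is extended linearly to signed measures: if \<open>m = \<sigma> - \<tau>\<close>, then
  \<open>(m, 0)\<^sup>E = (\<sigma>, 0)\<^sup>E - (\<tau>, 0)\<^sup>E\<close>, which is \<open>(0, 0)\<close> iff \<open>(\<sigma>, 0)\<close> and \<open>(\<tau>, 0)\<close> have the same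
  swept pair.\<close>

definition pure_binormal :: "'a topology \<Rightarrow> 'a pairs \<Rightarrow> 'a set \<Rightarrow> ('a set \<Rightarrow> real) \<Rightarrow> bool" where
  "pure_binormal X H K m \<longleftrightarrow>
     (\<exists>\<sigma> \<tau> A1 A2. difference_on X K m \<sigma> \<tau> \<and>
        swept_measure_pair X H (topspace X - K) \<sigma> (null_measure (borel_of X)) A1 A2 \<and>
        swept_measure_pair X H (topspace X - K) \<tau> (null_measure (borel_of X)) A1 A2)"

definition one_normal :: "'a topology \<Rightarrow> 'a pairs \<Rightarrow> 'a set \<Rightarrow> ('a set \<Rightarrow> real) \<Rightarrow> bool" where
  "one_normal X H K m \<longleftrightarrow>
     (\<exists>\<sigma> \<tau> A. difference_on X K m \<sigma> \<tau> \<and>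
        swept_measure X (assoc1 X H) (topspace X - K) \<sigma> A \<and>
        swept_measure X (assoc1 X H) (topspace X - K) \<tau> A)"

end

theory Submission
  imports Defs
begin

text \<open>
  For (i), a continuous \<open>1\<close>-potential \<open>p\<close> gives the continuous potential pair \<open>(p, 0)\<close>, whose swept
  pair has the \<open>1\<close>-swept function of \<open>p\<close> as first component, because the first component of a
  nonnegative hyperharmonic pair is \<open>1\<close>-hyperharmonic. Hence the first measure of the swept pair of
  \<open>(\<sigma>, 0)\<close> is the \<open>1\<close>-swept measure of \<open>\<sigma>\<close>.

  For (ii), take \<open>\<Omega> = (0, 1)\<close> with the pairs \<open>- u1'' = u2\<close>, \<open>u2'' = 0\<close>, the set \<open>K = [1/4, 3/4]\<close> and
  \<open>\<lambda> = \<delta>(1/4) + \<delta>(3/4) - 2 \<delta>(1/2)\<close>. Both associated harmonic spaces consist of the affine functions.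
  Sweeping on the complement of \<open>K\<close> replaces a concave function by its chord over \<open>K\<close>, which \<open>\<lambda>\<close>
  annihilates, whereas the first component of a swept pair is strictly concave on \<open>K\<close> as soon as the
  second one is positive.
\<close>

text \<open>What makes the example tractable is dimension one: the component of a regular set around
  a point is an interval, so every harmonic measure is a pair of point masses at its ends, and
  nonnegative superharmonic functions are the nonnegative concave ones. The Green kernel of the
  interval is symmetric, so the adjoint structures are again affine and the same results apply to
  them.

  The swept pair is never computed. The test pair has x(1 - x) in both components, which works
  because - p1'' = 2 dominates p2 and because x(1 - x) lies below both x and 1 - x. The first swept
  component P1 is at most 3/16 at 1/4 and at 3/4, and the second component lifts P1(1/2) just above
  3/16; annihilation by \<lambda> would require P1(1/4) + P1(3/4) = 2 P1(1/2).

  The obstacle in the refutation is that \<open>pure_binormal\<close> allows every representation of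
  \<lambda> as a difference of two measures. Any two such measures agree away from the three atoms
  of \<lambda>, and this common part has a finite integral, so it can be cancelled.\<close>

section \<open>First components of hyperharmonic and swept pairs\<close>

lemma ext_integral_nonneg:
  assumes "\<And>x. x \<in> F \<Longrightarrow> 0 \<le> v x"
  shows "ext_integral M F v = enn2ereal (\<integral>\<^sup>+x\<in>F. e2ennreal (v x) \<partial>M)"
proof -
  have "(\<lambda>x. e2ennreal (- v x) * indicator F x) = (\<lambda>x. 0)"
    using assms by (auto simp: fun_eq_iff indicator_def e2ennreal_neg)
  then show ?thesis by (simp add: ext_integral_def zero_ennreal.rep_eq)
qed

lemma ext_integral_nonneg_ge0:
  assumes "\<And>x. x \<in> F \<Longrightarrow> 0 \<le> v x"
  shows "0 \<le> ext_integral M F v"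
  using ext_integral_nonneg[of F v M, OF assms] by simp

lemma ext_integral_zero [simp]: "ext_integral M F (\<lambda>x. 0) = 0"
  by (subst ext_integral_nonneg) (simp_all add: zero_ereal_def[symmetric] zero_ennreal.rep_eq flip: zero_ennreal_def)

lemma lsc_on_zero: "lsc_on X (topspace X) (\<lambda>x. 0)"
proof -
  have "{x \<in> topspace X. ereal a < 0} = (if a < 0 then topspace X else {})" for a
    by auto
  then show ?thesis by (auto simp: lsc_on_def)
qed

text \<open>With second component 0 the \<open>nu_measure\<close> term drops out of the pair
  inequality, and the mean sets of \<open>assoc1\<close> are exactly the regular sets.\<close>

lemma hyperharmonic_assoc1_imp_pair:
  assumes "hyperharmonic X (assoc1 X H) (topspace X) w" "nonneg_on (topspace X) w"
  shows "nonneg_hyperharmonic_pair X H w (\<lambda>x. 0)"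
  using assms
  by (auto simp: hyperharmonic_def assoc1_def nonneg_hyperharmonic_pair_def hyperharmonic_pair_def
      nonneg_on_def lsc_on_zero)

text \<open>Since \<open>w2\<close> is nonnegative, so is the \<open>nu_measure\<close> term;
  omitting it only weakens the inequality for \<open>w1\<close>.\<close>

lemma nonneg_hyperharmonic_pair_imp_assoc1:
  assumes "nonneg_hyperharmonic_pair X H w1 w2"
  shows "hyperharmonic X (assoc1 X H) (topspace X) w1" "nonneg_on (topspace X) w1"
proof -
  have ge: "w1 x \<ge> ext_integral (mu_measure X H \<omega> x) (X frontier_of \<omega>) w1"
    if "regular_set X H \<omega>" "X closure_of \<omega> \<subseteq> topspace X" "x \<in> \<omega>" for \<omega> x
  proof -
    have "0 \<le> ext_integral (nu_measure X H \<omega> x) (X frontier_of \<omega>) w2"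
      using assms frontier_of_subset_topspace[of X \<omega>]
      by (intro ext_integral_nonneg_ge0) (auto simp: nonneg_hyperharmonic_pair_def nonneg_on_def)
    then have "ext_integral (mu_measure X H \<omega> x) (X frontier_of \<omega>) w1
        \<le> ext_integral (mu_measure X H \<omega> x) (X frontier_of \<omega>) w1
          + ext_integral (nu_measure X H \<omega> x) (X frontier_of \<omega>) w2"
      by (simp add: ereal_le_add_self)
    also have "\<dots> \<le> w1 x"
      using assms that by (auto simp: nonneg_hyperharmonic_pair_def hyperharmonic_pair_def)
    finally show ?thesis .
  qed
  show "hyperharmonic X (assoc1 X H) (topspace X) w1" "nonneg_on (topspace X) w1"
    using assms ge
    by (auto simp: hyperharmonic_def assoc1_def nonneg_hyperharmonic_pair_def hyperharmonic_pair_def)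
qed

text \<open>Dropping the second component in one direction and adding the second component 0 in the
  other shows that both infima run over the same functions.\<close>

lemma swept1_zero:
  assumes "E \<subseteq> topspace X"
  shows "swept1 X H E p (\<lambda>x. 0) = swept X (assoc1 X H) E p"
proof -
  define A where "A = {w. hyperharmonic X (assoc1 X H) (topspace X) w \<and> nonneg_on (topspace X) w \<and>
              (\<forall>y\<in>E. p y \<le> w y)}"
  have fst_eq: "fst ` sweeping_class X H E p (\<lambda>x. 0) = A"
  proof (intro set_eqI iffI)
    fix w assume "w \<in> fst ` sweeping_class X H E p (\<lambda>x. 0)"
    then show "w \<in> A"
      by (auto simp: A_def sweeping_class_def intro: nonneg_hyperharmonic_pair_imp_assoc1)
  next
    fix w assume "w \<in> A"
    then have "(w, \<lambda>x. 0) \<in> sweeping_class X H E p (\<lambda>x. 0)"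
      by (auto simp: A_def sweeping_class_def intro: hyperharmonic_assoc1_imp_pair)
    then show "w \<in> fst ` sweeping_class X H E p (\<lambda>x. 0)"
      by force
  qed
  have "(INF (w1, w2)\<in>sweeping_class X H E p (\<lambda>x. 0). w1 x) = (INF w\<in>A. w x)" for x
    unfolding fst_eq[symmetric] by (simp add: image_image case_prod_beta)
  then show ?thesis
    by (simp add: swept1_def swept_def A_def)
qed

text \<open>A biharmonic pair squeezed between 0 and \<open>(p, 0)\<close> has vanishing second
  component, so its first component is a \<open>1\<close>-harmonic minorant of the potential
  \<open>p\<close>.\<close>

lemma continuous_potential_pair_zero:
  assumes pre: "presheaf_of_pairs X H"
    and p: "cont_on X (topspace X) p" "potential X (assoc1 X H) (\<lambda>x. ereal (p x))"
  shows "continuous_potential_pair X H p (\<lambda>x. 0)"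
proof -
  have zero: "\<forall>x\<in>topspace X. h1 x = 0 \<and> h2 x = 0"
    if h: "(h1, h2) \<in> H (topspace X)"
      and b: "\<forall>x\<in>topspace X. 0 \<le> h1 x \<and> ereal (h1 x) \<le> ereal (p x) \<and> 0 \<le> h2 x \<and> ereal (h2 x) \<le> 0"
    for h1 h2
  proof (cases "topspace X = {}")
    case False
    have h2: "h2 x = 0" if "x \<in> topspace X" for x
      using b that by (force simp: zero_ereal_def)
    \<comment> \<open>\<open>h2\<close> vanishes only on the space, whereas \<open>harmonic1\<close>
      asks for the total function \<open>\<lambda>x. 0\<close>; the presheaf clause on
      representatives bridges the difference.\<close>
    have "\<forall>v1 v2. (\<forall>x\<in>topspace X. v1 x = h1 x \<and> v2 x = h2 x) \<longrightarrow> (v1, v2) \<in> H (topspace X)"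
      using pre[unfolded presheaf_of_pairs_def, rule_format, of "topspace X"] False h by auto
    then have "(h1, \<lambda>x. 0) \<in> H (topspace X)"
      using h2 by simp
    then have "h1 \<in> harmonic1 H (topspace X)"
      by (simp add: harmonic1_def)
    then show ?thesis
      using p(2) b h2 by (auto simp: potential_def assoc1_def)
  qed auto
  have "nonneg_hyperharmonic_pair X H (\<lambda>x. ereal (p x)) (\<lambda>x. 0)"
    using p(2) by (intro hyperharmonic_assoc1_imp_pair) (auto simp: potential_def superharmonic_def)
  then show ?thesis
    using p zero
    by (auto simp: continuous_potential_pair_def potential_pair_def superharmonic_pair_def
        nonneg_hyperharmonic_pair_def potential_def superharmonic_def cont_on_def zero_ereal_def)
qed

text \<open>Test with the pairs \<open>(p, 0)\<close> only: the \<open>A2\<close> integral vanishes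
  because its integrand does, and the \<open>swept2\<close> integral because the second measure is
  null.\<close>

lemma swept_measure_pair_imp_swept_measure:
  assumes "presheaf_of_pairs X H" "E \<subseteq> topspace X"
    and "swept_measure_pair X H E \<sigma> (null_measure (borel_of X)) A1 A2"
  shows "swept_measure X (assoc1 X H) E \<sigma> A1"
  using assms(3) continuous_potential_pair_zero[OF assms(1)] swept1_zero[OF assms(2), of H]
  by (fastforce simp: swept_measure_pair_def swept_measure_def zero_ereal_def[symmetric])

lemma pure_binormal_imp_one_normal:
  assumes "presheaf_of_pairs X H" "pure_binormal X H K m"
  shows "one_normal X H K m"
  using assms(2) swept_measure_pair_imp_swept_measure[OF assms(1), of "topspace X - K"]
  unfolding pure_binormal_def one_normal_def by blast

subsection \<open>Measures on the unit interval\<close>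

abbreviation unit_interval :: "real topology" where
  "unit_interval \<equiv> top_of_set {0<..<1}"

lemma openin_unit_interval: "openin unit_interval U \<longleftrightarrow> open U \<and> U \<subseteq> {0<..<1}"
  by (simp add: openin_open_eq)

text \<open>The open sets of the subspace are the traces of the open sets of the line, and
  generating a sigma-algebra commutes with taking traces.\<close>

lemma sets_borel_of_unit_interval:
  "sets (borel_of unit_interval) = {B. B \<in> sets borel \<and> B \<subseteq> {0<..<1}}"
proof -
  have opens: "{U. openin unit_interval U} = (\<inter>) {0<..<1} ` {S. open S}"
    by (auto simp: openin_open image_iff)
  have "sets (borel_of unit_interval) = sigma_sets {0<..<1} {U. openin unit_interval U}"
    by (simp add: borel_of_def sets_measure_of openin_unit_interval subset_eq)
  also have "\<dots> = (\<inter>) {0<..<1} ` sigma_sets UNIV {S. open S}"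
    unfolding opens
    by (rule sigma_sets_Int[symmetric]) (auto intro: sigma_sets.Basic)
  also have "\<dots> = {B. B \<in> sets borel \<and> B \<subseteq> {0<..<1::real}}"
  proof (intro set_eqI iffI)
    fix B :: "real set"
    assume "B \<in> (\<inter>) {0<..<1} ` sigma_sets UNIV {S. open S}"
    then obtain C where "C \<in> sets borel" "B = {0<..<1} \<inter> C"
      by (auto simp: borel_def)
    then show "B \<in> {B. B \<in> sets borel \<and> B \<subseteq> {0<..<1}}"
      by auto
  next
    fix B :: "real set"
    assume "B \<in> {B. B \<in> sets borel \<and> B \<subseteq> {0<..<1}}"
    then have "B \<in> sigma_sets UNIV {S. open S}" "B = {0<..<1} \<inter> B"
      by (auto simp: borel_def)
    then show "B \<in> (\<inter>) {0<..<1} ` sigma_sets UNIV {S. open S}"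
      by blast
  qed
  finally show ?thesis .
qed

lemma space_borel_of: "space (borel_of X) = topspace X"
  by (simp add: borel_of_def space_measure_of_conv)

lemma space_eq_unit_interval:
  "sets M = sets (borel_of unit_interval) \<Longrightarrow> space M = {0<..<1}"
  using sets_eq_imp_space_eq[of M "borel_of unit_interval"] by (simp add: space_borel_of)

text \<open>\<open>point_measure\<close> lives on the set \<open>F\<close> with all its subsets
  measurable; the image under the identity turns it into a Borel measure on the interval.\<close>

definition atoms :: "real set \<Rightarrow> (real \<Rightarrow> real) \<Rightarrow> real measure" where
  "atoms F w = distr (point_measure F (\<lambda>x. ennreal (w x))) (borel_of unit_interval) (\<lambda>x. x)"

lemma sets_atoms [simp]: "sets (atoms F w) = sets (borel_of unit_interval)"
  by (simp add: atoms_def)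

lemma emeasure_atoms:
  assumes "finite F" "F \<subseteq> {0<..<1}" "B \<in> sets (borel_of unit_interval)"
  shows "emeasure (atoms F w) B = (\<Sum>x\<in>F \<inter> B. ennreal (w x))"
proof -
  have "(\<lambda>x. x) \<in> measurable (point_measure F (\<lambda>x. ennreal (w x))) (borel_of unit_interval)"
    using assms by (auto simp: measurable_def space_point_measure sets_point_measure space_borel_of)
  then show ?thesis
    using assms by (simp add: atoms_def emeasure_distr space_point_measure
        emeasure_point_measure_finite2 Int_commute)
qed

lemma singleton_borel_of_unit_interval: "0 < x \<Longrightarrow> x < 1 \<Longrightarrow> {x} \<in> sets (borel_of unit_interval)"
  by (simp add: sets_borel_of_unit_interval)

lemma AE_in_carrier:
  assumes "sets M = sets (borel_of unit_interval)" "S \<in> sets M" "emeasure M ({0<..<1} - S) = 0"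
  shows "AE x in M. x \<in> S"
  using assms by (intro AE_I[where N="{0<..<1} - S"])
    (auto simp: space_eq_unit_interval sets_borel_of_unit_interval)

text \<open>No measurability of \<open>f\<close> is needed, because \<open>f\<close> coincides almost everywhere with a simple
  function.\<close>

lemma nn_integral_finite_carrier:
  assumes M: "sets M = sets (borel_of unit_interval)" "emeasure M ({0<..<1} - F) = 0"
    and F: "finite F" "F \<subseteq> {0<..<1}"
  shows "(\<integral>\<^sup>+x. f x \<partial>M) = (\<Sum>y\<in>F. f y * emeasure M {y})"
proof -
  have FM: "F \<in> sets M" "\<And>y. y \<in> F \<Longrightarrow> {y} \<in> sets M"
    using M F by (auto simp: sets_borel_of_unit_interval borel_closed finite_imp_closed)
  have "(\<integral>\<^sup>+x. f x \<partial>M) = (\<integral>\<^sup>+x. (\<Sum>y\<in>F. f y * indicator {y} x) \<partial>M)"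
  proof (rule nn_integral_cong_AE)
    have "AE x in M. x \<in> F"
      using M FM by (intro AE_in_carrier) auto
    then show "AE x in M. f x = (\<Sum>y\<in>F. f y * indicator {y} x)"
    proof eventually_elim
      case (elim x)
      have "(\<Sum>y\<in>F. f y * indicator {y} x) = (\<Sum>y\<in>F. if x = y then f y else 0)"
        by (intro sum.cong) (auto simp: indicator_def)
      then show ?case
        using elim F by simp
    qed
  qed
  also have "\<dots> = (\<Sum>y\<in>F. f y * emeasure M {y})"
    using FM by (subst nn_integral_sum) (auto intro!: sum.cong simp: nn_integral_cmult_indicator)
  finally show ?thesis .
qed

text \<open>Replacing the integrand almost everywhere in a Bochner integral asks for measurability
  on both sides; here it comes from the continuity of \<open>u\<close> on the compact set
  \<open>S\<close>.\<close>

lemma set_integral_finite_carrier: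
  fixes u :: "real \<Rightarrow> real"
  assumes M: "sets M = sets (borel_of unit_interval)" "emeasure M ({0<..<1} - F) = 0"
    and fin: "\<And>y. y \<in> F \<Longrightarrow> emeasure M {y} < \<infinity>"
    and F: "finite F" "F \<subseteq> S"
    and S: "compact S" "S \<subseteq> {0<..<1}" and u: "continuous_on S u"
  shows "(LINT z:S|M. u z) = (\<Sum>y\<in>F. u y * measure M {y})"
proof -
  have FI: "F \<subseteq> {0<..<1}" using F S by auto
  have FM: "F \<in> sets M" "\<And>y. y \<in> F \<Longrightarrow> {y} \<in> sets M"
    using M F FI 
    by (auto simp: sets_borel_of_unit_interval borel_closed finite_imp_closed)
  have id: "(\<lambda>x. x) \<in> measurable M borel"
    using M by (auto simp: measurable_def space_eq_unit_interval sets_borel_of_unit_interval)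
  have "(\<lambda>x. indicator S x *\<^sub>R u x) \<in> borel_measurable borel"
    using S u by (intro borel_measurable_continuous_on_indicator) (auto simp: borel_compact)
  from measurable_compose[OF id this]
  have meas: "(\<lambda>x. indicator S x *\<^sub>R u x) \<in> borel_measurable M" .
  have "(LINT z:S|M. u z) = (\<integral>x. (\<Sum>y\<in>F. indicator {y} x *\<^sub>R u y) \<partial>M)"
    unfolding set_lebesgue_integral_def
  proof (rule integral_cong_AE)
    have "AE x in M. x \<in> F"
      using M FM by (intro AE_in_carrier) auto
    then show "AE x in M. indicator S x *\<^sub>R u x = (\<Sum>y\<in>F. indicator {y} x *\<^sub>R u y)"
    proof eventually_elim
      case (elim x)
      have "(\<Sum>y\<in>F. indicator {y} x *\<^sub>R u y) = (\<Sum>y\<in>F. if x = y then u y else 0)"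
        by (intro sum.cong) (auto simp: indicator_def)
      then show ?case
        using elim F by (auto simp: indicator_def)
    qed
    show "(\<lambda>x. \<Sum>y\<in>F. indicator {y} x *\<^sub>R u y) \<in> borel_measurable M"
      using FM by (intro borel_measurable_sum borel_measurable_scaleR borel_measurable_indicator) auto
  qed (rule meas)
  also have "\<dots> = (\<Sum>y\<in>F. \<integral>x. indicator {y} x *\<^sub>R u y \<partial>M)"
    using FM fin by (intro Bochner_Integration.integral_sum integrable_scaleR_left) 
      (auto intro!: integrable_real_indicator)
  also have "\<dots> = (\<Sum>y\<in>F. u y * measure M {y})"
    using FM fin by (intro sum.cong) (auto simp: sets.Int_space_eq2)
  finally show ?thesis .
qed

definition two_point :: "real \<Rightarrow> real \<Rightarrow> real \<Rightarrow> real \<Rightarrow> real measure" where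
  "two_point a b \<alpha> \<beta> = atoms {a, b} (\<lambda>x. if x = a then \<alpha> else \<beta>)"

lemma sets_two_point [simp]: "sets (two_point a b \<alpha> \<beta>) = sets (borel_of unit_interval)"
  by (simp add: two_point_def)

context
  fixes a b \<alpha> \<beta> :: real
  assumes ab: "0 < a" "a < b" "b < 1" and weights: "0 \<le> \<alpha>" "0 \<le> \<beta>"
begin

lemma emeasure_two_point:
  assumes "B \<in> sets (borel_of unit_interval)"
  shows "emeasure (two_point a b \<alpha> \<beta>) B = ennreal (\<alpha> * indicator B a + \<beta> * indicator B b)"
  using ab weights assms
  by (cases "a \<in> B"; cases "b \<in> B")
     (simp_all add: two_point_def emeasure_atoms)

lemma two_point_values:
  "emeasure (two_point a b \<alpha> \<beta>) {a} = ennreal \<alpha>" "emeasure (two_point a b \<alpha> \<beta>) {b} = ennreal \<beta>"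
  "{a, b} \<subseteq> S \<Longrightarrow> emeasure (two_point a b \<alpha> \<beta>) ({0<..<1} - S) = 0"
proof -
  show "emeasure (two_point a b \<alpha> \<beta>) {a} = ennreal \<alpha>" "emeasure (two_point a b \<alpha> \<beta>) {b} = ennreal \<beta>"
    using ab by (simp_all add: emeasure_two_point singleton_borel_of_unit_interval)
  show "emeasure (two_point a b \<alpha> \<beta>) ({0<..<1} - S) = 0" if "{a, b} \<subseteq> S"
  \<comment> \<open>\<open>S\<close> is an arbitrary set, and \<open>emeasure\<close> is 0 on sets
    that are not measurable.\<close>
  proof (cases "{0<..<1} - S \<in> sets (borel_of unit_interval)")
    case True
    then show ?thesis using that by (simp add: emeasure_two_point)
  qed (simp add: emeasure_notin_sets)
qed

lemma radon_measure_on_two_point: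
  assumes "{a, b} \<subseteq> S"
  shows "radon_measure_on unit_interval S (two_point a b \<alpha> \<beta>)"
proof -
  have "emeasure (two_point a b \<alpha> \<beta>) C < \<infinity>" if "compact C" "C \<subseteq> {0<..<1}" for C
    using that by (subst emeasure_two_point) (auto simp: sets_borel_of_unit_interval borel_compact)
  then show ?thesis
    using assms two_point_values(3)
    by (auto simp: radon_measure_on_def radon_measure_def compactin_subtopology)
qed

lemma ext_integral_two_point:
  assumes M: "sets M = sets (borel_of unit_interval)" "emeasure M ({0<..<1} - {a, b}) = 0"
    "emeasure M {a} = ennreal \<alpha>" "emeasure M {b} = ennreal \<beta>"
    and S: "{a, b} \<subseteq> S" and v: "\<And>x. x \<in> S \<Longrightarrow> 0 \<le> v x"
  shows "ext_integral M S v = ereal \<alpha> * v a + ereal \<beta> * v b"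
proof -
  have "(\<integral>\<^sup>+x\<in>S. e2ennreal (v x) \<partial>M) = e2ennreal (v a) * ennreal \<alpha> + e2ennreal (v b) * ennreal \<beta>"
    using ab S by (subst nn_integral_finite_carrier[OF M(1,2)]) (auto simp: M(3,4))
  then show ?thesis
    using S v weights
    by (simp add: ext_integral_nonneg plus_ennreal.rep_eq times_ennreal.rep_eq enn2ereal_e2ennreal
        mult.commute)
qed

lemma set_integral_two_point:
  assumes "{a, b} \<subseteq> S" "compact S" "S \<subseteq> {0<..<1}" "continuous_on S (u :: real \<Rightarrow> real)"
  shows "(LINT z:S|two_point a b \<alpha> \<beta>. u z) = \<alpha> * u a + \<beta> * u b"
proof -
  have "(LINT z:S|two_point a b \<alpha> \<beta>. u z) = (\<Sum>y\<in>{a, b}. u y * measure (two_point a b \<alpha> \<beta>) {y})"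
    using assms by (intro set_integral_finite_carrier) (auto simp: two_point_values)
  then show ?thesis
    using ab weights by (simp add: Sigma_Algebra.measure_def two_point_values mult.commute)
qed

lemma two_point_unique_carrier:
  assumes M: "sets M = sets (borel_of unit_interval)" "emeasure M ({0<..<1} - {a, b}) = 0"
    "emeasure M {a} = ennreal \<alpha>" "emeasure M {b} = ennreal \<beta>"
  shows "M = two_point a b \<alpha> \<beta>"
proof (rule measure_eqI)
  fix B assume B: "B \<in> sets M"
  have sum_pair: "(\<Sum>y\<in>{a, b}. g y) = g a + g b" for g :: "real \<Rightarrow> ennreal"
    using ab by simp
  have "emeasure M B = (\<integral>\<^sup>+x. indicator B x \<partial>M)"
    using B by (rule nn_integral_indicator[symmetric])
  also have "\<dots> = (\<Sum>y\<in>{a, b}. indicator B y * emeasure M {y})"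
    using ab by (intro nn_integral_finite_carrier[OF M(1,2)]) auto
  also have "\<dots> = indicator B a * emeasure M {a} + indicator B b * emeasure M {b}"
    by (rule sum_pair)
  also have "\<dots> = emeasure (two_point a b \<alpha> \<beta>) B"
    using B M ab weights
    by (cases "a \<in> B"; cases "b \<in> B") (simp_all add: emeasure_two_point)
  finally show "emeasure M B = emeasure (two_point a b \<alpha> \<beta>) B" .
qed (simp add: M)

text \<open>Uniqueness in the Riesz representation for a two-point functional. The test function
  \<bar>(z - a) (z - b)\<bar> has integral 0, so \<open>M\<close> is carried by
  \<open>{a, b}\<close>; the affine functions that are 1 at one end and 0 at the other then read off
  the masses.\<close>

lemma two_point_unique:
  assumes M: "radon_measure_on unit_interval S M"
    and S: "{a, b} \<subseteq> S" "compact S" "S \<subseteq> {0<..<1}"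
    and eq: "\<And>f. continuous_on S f \<Longrightarrow> (LINT z:S|M. f z) = \<alpha> * f a + \<beta> * f b"
  shows "M = two_point a b \<alpha> \<beta>"
proof -
  have sM: "sets M = sets (borel_of unit_interval)" and carr: "emeasure M ({0<..<1} - S) = 0"
    and fin: "emeasure M S < \<infinity>"
    using M S by (auto simp: radon_measure_on_def radon_measure_def compactin_subtopology)
  have SM: "S \<in> sets M" "{a, b} \<in> sets M" "{a} \<in> sets M" "{b} \<in> sets M"
    using sM S ab by (auto simp: sets_borel_of_unit_interval borel_compact)
  have id: "(\<lambda>x. x) \<in> measurable M borel"
    using sM by (auto simp: measurable_def space_eq_unit_interval sets_borel_of_unit_interval)
  define f where "f = (\<lambda>z::real. \<bar>(z - a) * (z - b)\<bar>)"
  have f: "continuous_on S f"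
    unfolding f_def by (intro continuous_intros)
  have meas: "(\<lambda>x. indicator S x *\<^sub>R f x) \<in> borel_measurable M"
    using S f by (intro measurable_compose[OF id] borel_measurable_continuous_on_indicator)
      (auto simp: borel_compact)
  have "bounded (f ` S)"
    using S f by (intro compact_imp_bounded compact_continuous_image)
  then obtain C where C: "\<And>x. x \<in> S \<Longrightarrow> norm (f x) \<le> C"
    by (auto simp: bounded_iff)
  have int: "integrable M (\<lambda>x. indicator S x *\<^sub>R f x)"
  proof (rule integrableI_bounded_set[OF SM(1) meas fin, where B=C])
    show "AE x in M. x \<in> S \<longrightarrow> norm (indicator S x *\<^sub>R f x) \<le> C"
      using C by (intro AE_I2) simp
  qed simp
  have "(LINT z:S|M. f z) = 0"
    using eq[OF f] by (simp add: f_def)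
  then have "AE x in M. indicator S x *\<^sub>R f x = 0"
    unfolding set_lebesgue_integral_def
    by (subst (asm) integral_nonneg_eq_0_iff_AE[OF int]) (auto simp: f_def indicator_def)
  moreover have "AE x in M. x \<in> S"
    using sM SM carr by (intro AE_in_carrier)
  ultimately have "AE x in M. x \<in> {a, b}"
    by eventually_elim (auto simp: f_def)
  then have null: "emeasure M ({0<..<1} - {a, b}) = 0"
    using emeasure_eq_0_AE[where M=M and P="\<lambda>x. x \<notin> {a, b}"] sM
    by (simp add: space_eq_unit_interval set_diff_eq)
  have finab: "emeasure M {a} < \<infinity>" "emeasure M {b} < \<infinity>"
    using S SM fin by (auto intro: le_less_trans[OF emeasure_mono])
  have sum: "(LINT z:S|M. g z) = (\<Sum>y\<in>{a, b}. g y * measure M {y})" if "continuous_on S g" for g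
    using finab S that by (intro set_integral_finite_carrier[OF sM null]) auto
  have "measure M {a} = \<alpha>"
    using ab sum[of "\<lambda>z. (b - z) / (b - a)"] eq[of "\<lambda>z. (b - z) / (b - a)"]
    by (auto simp: continuous_intros)
  moreover have "measure M {b} = \<beta>"
    using ab sum[of "\<lambda>z. (z - a) / (b - a)"] eq[of "\<lambda>z. (z - a) / (b - a)"]
    by (auto simp: continuous_intros)
  ultimately show ?thesis
    using finab by (intro two_point_unique_carrier[OF sM null])
      (auto simp: emeasure_eq_ennreal_measure less_top[symmetric])
qed

end

subsection \<open>The sheaf of cubic pairs\<close>

text \<open>The solutions of - u1'' = u2, u2'' = 0 on an interval in closed form, so that
  derivatives never enter.\<close>

definition cubic_pair_on :: "real set \<Rightarrow> (real \<Rightarrow> real) \<Rightarrow> (real \<Rightarrow> real) \<Rightarrow> bool" where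
  "cubic_pair_on V u1 u2 \<longleftrightarrow>
     (\<exists>a b c d. \<forall>y\<in>V. u1 y = a + b * y + c * y^2 + d * y^3 \<and> u2 y = - (2 * c + 6 * d * y))"

text \<open>The coefficients are required to exist only locally: they may change from one component
  of \<open>U\<close> to another, and gluing is immediate.\<close>

definition cubic_pairs :: "real pairs" where
  "cubic_pairs U = {(u1, u2). \<forall>x\<in>U. \<exists>V. open V \<and> x \<in> V \<and> V \<subseteq> U \<and> cubic_pair_on V u1 u2}"

lemma cubic_pair_onI:
  assumes "\<And>y. y \<in> V \<Longrightarrow> u1 y = a + b * y + c * y^2 + d * y^3"
    "\<And>y. y \<in> V \<Longrightarrow> u2 y = - (2 * c + 6 * d * y)"
  shows "cubic_pair_on V u1 u2"
  unfolding cubic_pair_on_def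
  by (rule exI[of _ a], rule exI[of _ b], rule exI[of _ c], rule exI[of _ d]) (simp add: assms)

lemma cubic_pair_onE:
  assumes "cubic_pair_on V u1 u2"
  obtains a b c d where "\<forall>y\<in>V. u1 y = a + b * y + c * y^2 + d * y^3"
    "\<forall>y\<in>V. u2 y = - (2 * c + 6 * d * y)"
  using assms unfolding cubic_pair_on_def by (elim exE) (rule that, auto)

lemma cubic_pair_on_mono:
  assumes "cubic_pair_on V u1 u2" "W \<subseteq> V"
  shows "cubic_pair_on W u1 u2"
proof -
  obtain a b c d where "\<forall>y\<in>V. u1 y = a + b * y + c * y^2 + d * y^3"
    "\<forall>y\<in>V. u2 y = - (2 * c + 6 * d * y)"
    by (rule cubic_pair_onE[OF assms(1)])
  then show ?thesis
    using assms(2) by (intro cubic_pair_onI) (auto simp: subset_eq)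
qed

lemma cubic_pair_on_cong:
  "(\<And>x. x \<in> V \<Longrightarrow> u1 x = v1 x \<and> u2 x = v2 x) \<Longrightarrow> cubic_pair_on V u1 u2 = cubic_pair_on V v1 v2"
  unfolding cubic_pair_on_def by (simp cong: ball_cong)

lemma cubic_pair_on_imp_cubic_pairs: "open U \<Longrightarrow> cubic_pair_on U u1 u2 \<Longrightarrow> (u1, u2) \<in> cubic_pairs U"
  unfolding cubic_pairs_def by blast

lemma cubic_pair_on_linear:
  assumes "cubic_pair_on V u1 u2" "cubic_pair_on V v1 v2"
  shows "cubic_pair_on V (\<lambda>x. a * u1 x + b * v1 x) (\<lambda>x. a * u2 x + b * v2 x)"
proof -
  obtain a1 b1 c1 d1 where u: "\<forall>y\<in>V. u1 y = a1 + b1 * y + c1 * y^2 + d1 * y^3"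
    "\<forall>y\<in>V. u2 y = - (2 * c1 + 6 * d1 * y)"
    by (rule cubic_pair_onE[OF assms(1)])
  obtain a2 b2 c2 d2 where v: "\<forall>y\<in>V. v1 y = a2 + b2 * y + c2 * y^2 + d2 * y^3"
    "\<forall>y\<in>V. v2 y = - (2 * c2 + 6 * d2 * y)"
    by (rule cubic_pair_onE[OF assms(2)])
  show ?thesis
    by (rule cubic_pair_onI[of _ _ "a * a1 + b * a2" "a * b1 + b * b2" "a * c1 + b * c2" "a * d1 + b * d2"])
      (simp_all add: u v algebra_simps)
qed

lemma open_contains_two_points:
  fixes V :: "real set"
  assumes "open V" "x \<in> V"
  obtains h where "h > 0" "x + h \<in> V" "x - h \<in> V"
proof -
  obtain e where "e > 0" "\<And>y. dist y x < e \<Longrightarrow> y \<in> V"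
    using assms unfolding open_dist by auto
  then show ?thesis
    by (intro that[of "e/2"]) (auto simp: dist_real_def)
qed

text \<open>The symmetric second difference quotient of a cubic is its second derivative.\<close>

lemma cubic_pair_compatible:
  assumes "cubic_pair_on V u1 u2" "open V" "\<forall>x\<in>V. u1 x = 0" "x \<in> V"
  shows "u2 x = 0"
proof -
  obtain a b c d where u: "\<forall>y\<in>V. u1 y = a + b * y + c * y^2 + d * y^3"
    "\<forall>y\<in>V. u2 y = - (2 * c + 6 * d * y)"
    by (rule cubic_pair_onE[OF assms(1)])
  obtain h where h: "h > 0" "x + h \<in> V" "x - h \<in> V"
    by (rule open_contains_two_points[OF assms(2,4)])
  have "u1 (x + h) - 2 * u1 x + u1 (x - h) = - (h^2 * u2 x)"
    unfolding u(1)[rule_format, OF h(2)] u(1)[rule_format, OF h(3)] u(1)[rule_format, OF assms(4)]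
      u(2)[rule_format, OF assms(4)]
    by (simp add: power2_eq_square power3_eq_cube algebra_simps)
  then show ?thesis
    using h assms by simp
qed

text \<open>Compare both representations at \<open>x\<close> and at a nearby \<open>x + h\<close>.
  The affine function \<open>u2\<close> determines \<open>c\<close> and \<open>d\<close>; what
  remains of \<open>u1\<close> is affine and determines \<open>a\<close> and
  \<open>b\<close>.\<close>

lemma cubic_coefficients_unique:
  fixes V W :: "real set"
  assumes "open V" "open W" "x \<in> V" "x \<in> W"
    and "\<forall>y\<in>V. u1 y = a + b * y + c * y^2 + d * y^3 \<and> u2 y = - (2 * c + 6 * d * y)"
    and "\<forall>y\<in>W. u1 y = a' + b' * y + c' * y^2 + d' * y^3 \<and> u2 y = - (2 * c' + 6 * d' * y)"
  shows "(a, b, c, d) = (a', b', c', d')"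
proof -
  obtain h where h: "h > 0" "x + h \<in> V \<inter> W" "x - h \<in> V \<inter> W"
    by (rule open_contains_two_points[of "V \<inter> W" x]) (use assms(1-4) in auto)
  have x: "2 * c + 6 * d * x = 2 * c' + 6 * d' * x"
    and xh: "2 * c + 6 * d * (x + h) = 2 * c' + 6 * d' * (x + h)"
    using bspec[OF assms(5) assms(3)] bspec[OF assms(6) assms(4)]
      bspec[OF assms(5) IntD1[OF h(2)]] bspec[OF assms(6) IntD2[OF h(2)]] by linarith+
  then have "d * h = d' * h"
    unfolding ring_distribs by linarith
  then have d: "d = d'" using h by simp
  with x have c: "c = c'" by simp
  have x: "a + b * x = a' + b' * x"
    and xh: "a + b * (x + h) = a' + b' * (x + h)"
    using bspec[OF assms(5) assms(3)] bspec[OF assms(6) assms(4)]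
      bspec[OF assms(5) IntD1[OF h(2)]] bspec[OF assms(6) IntD2[OF h(2)]] unfolding c d by linarith+
  then have "b * h = b' * h"
    unfolding ring_distribs by linarith
  then have "b = b'" using h by simp
  with x c d show ?thesis by simp
qed

text \<open>The coefficient vector \<open>C x\<close> of a local representation at \<open>x\<close>
  does not depend on that representation, so \<open>C\<close> is locally constant, hence constant on
  the connected interval.\<close>

lemma cubic_pairs_on_interval:
  assumes u: "(u1, u2) \<in> cubic_pairs U" and I: "{p<..<q} \<subseteq> U"
  shows "cubic_pair_on {p<..<q} u1 u2"
proof -
  define coeffs where "coeffs V = (\<lambda>(a, b, c, d).
    \<forall>y\<in>V. u1 y = a + b * y + c * y^2 + d * y^3 \<and> u2 y = - (2 * c + 6 * d * y))" for V
  define C where "C x = (SOME k. \<exists>V. open V \<and> x \<in> V \<and> coeffs V k)" for x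
  have unique: "k = l" if "open V" "open W" "x \<in> V" "x \<in> W" "coeffs V k" "coeffs W l" for x V W k l
  proof -
    obtain a b c d a' b' c' d' where kl: "k = (a, b, c, d)" "l = (a', b', c', d')"
      by (cases k, cases l)
    show ?thesis
      unfolding kl
      by (rule cubic_coefficients_unique[OF that(1-4) that(5)[unfolded kl coeffs_def prod.case]
            that(6)[unfolded kl coeffs_def prod.case]])
  qed
  have C: "C x = k" if "open V" "x \<in> V" "coeffs V k" for x V k
  proof -
    have "\<exists>V. open V \<and> x \<in> V \<and> coeffs V (C x)"
      unfolding C_def by (rule someI[of _ k]) (use that in blast)
    then obtain W where "open W" "x \<in> W" "coeffs W (C x)"
      by blast
    then show ?thesis
      using unique[of W V x "C x" k] that by simp
  qed
  have ex: "\<exists>V k. open V \<and> x \<in> V \<and> coeffs V k" if "x \<in> {p<..<q}" for x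
  proof -
    have "x \<in> U"
      using I that by (rule subsetD)
    with u obtain V where "open V" "x \<in> V" "cubic_pair_on V u1 u2"
      by (auto simp: cubic_pairs_def)
    moreover have "cubic_pair_on V u1 u2 \<longleftrightarrow> (\<exists>a b c d. coeffs V (a, b, c, d))"
      by (simp only: cubic_pair_on_def coeffs_def prod.case)
    ultimately show ?thesis by blast
  qed
  have const: "C x = C y" if "x \<in> {p<..<q}" "y \<in> {p<..<q}" for x y
  proof (rule connected_local_const[OF _ that])
    show "\<forall>x\<in>{p<..<q}. \<forall>\<^sub>F y in at x within {p<..<q}. C x = C y"
    proof
      fix x assume "x \<in> {p<..<q}"
      then obtain V k where V: "open V" "x \<in> V" "coeffs V k"
        using ex by blast
      then have "\<forall>\<^sub>F y in at x within {p<..<q}. y \<in> V"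
        by (auto simp: eventually_at_topological)
      then show "\<forall>\<^sub>F y in at x within {p<..<q}. C x = C y"
      proof eventually_elim
        case (elim y)
        then show ?case using C[OF V] C[OF V(1) _ V(3)] by simp
      qed
    qed
  qed simp
  show ?thesis
  proof (cases "{p<..<q} = {}")
    case True
    then show ?thesis by (auto simp: cubic_pair_on_def)
  next
    case False
    then obtain x where x: "x \<in> {p<..<q}" by blast
    obtain a b c d where k: "C x = (a, b, c, d)"
      by (cases "C x")
    have "u1 y = a + b * y + c * y^2 + d * y^3 \<and> u2 y = - (2 * c + 6 * d * y)" if y: "y \<in> {p<..<q}" for y
    proof -
      obtain V k' where V: "open V" "y \<in> V" "coeffs V k'"
        using ex y by blast
      then have "coeffs V (a, b, c, d)"
        using C[of V y k'] const[OF y x] k by simp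
      then show ?thesis
        using V by (simp add: coeffs_def)
    qed
    then show ?thesis
      by (intro cubic_pair_onI) auto
  qed
qed

text \<open>The harmonic measure of \<open>{a<..<b}\<close> at \<open>x\<close> has the masses \<open>wl\<close> and \<open>wr\<close> at \<open>a\<close> and \<open>b\<close>;
  \<open>nl\<close> and \<open>nr\<close> are the solutions of \<open>- n'' = wl\<close> and \<open>- n'' = wr\<close> that vanish at \<open>a\<close> and \<open>b\<close>.\<close>

definition wl :: "real \<Rightarrow> real \<Rightarrow> real \<Rightarrow> real" where
  "wl a b x = (b - x) / (b - a)"

definition wr :: "real \<Rightarrow> real \<Rightarrow> real \<Rightarrow> real" where
  "wr a b x = (x - a) / (b - a)"

definition nl :: "real \<Rightarrow> real \<Rightarrow> real \<Rightarrow> real" where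
  "nl a b x = (b - x) * (x - a) * (2 * b - a - x) / (6 * (b - a))"

definition nr :: "real \<Rightarrow> real \<Rightarrow> real \<Rightarrow> real" where
  "nr a b x = (b - x) * (x - a) * (b + x - 2 * a) / (6 * (b - a))"

lemma weights_nonneg:
  assumes "a < x" "x < b"
  shows "0 < wl a b x" "0 < wr a b x" "0 < nl a b x" "0 < nr a b x"
  using assms by (auto simp: wl_def wr_def nl_def nr_def)

lemma weights_at_ends [simp]:
  assumes "a < b"
  shows "wl a b a = 1" "wr a b a = 0" "nl a b a = 0" "nr a b a = 0"
    "wl a b b = 0" "wr a b b = 1" "nl a b b = 0" "nr a b b = 0"
  using assms by (auto simp: wl_def wr_def nl_def nr_def)

lemma weights_affine:
  assumes "a < b"
  shows "wl a b x * (c + d * a) + wr a b x * (c + d * b) = c + d * x"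
  using assms by (simp add: wl_def wr_def divide_simps) (simp add: algebra_simps)

lemma weights_sum: "a < b \<Longrightarrow> wl a b x + wr a b x = 1"
  using weights_affine[of a b x 1 0] by simp

lemma continuous_on_weights [continuous_intros]:
  "continuous_on S (wl a b)" "continuous_on S (wr a b)" "continuous_on S (nl a b)" "continuous_on S (nr a b)"
  unfolding wl_def wr_def nl_def nr_def divide_inverse by (intro continuous_intros)+

text \<open>A cubic has four parameters, fixed by the values of both components at two points. Being
  polynomial identities, the formulas extrapolate as well: \<open>y\<close> may lie outside the
  segment from \<open>p\<close> to \<open>q\<close>.\<close>

lemma cubic_pair_formula:
  assumes u: "cubic_pair_on S u1 u2" and S: "p \<in> S" "q \<in> S" "y \<in> S" "p < q"
  shows "u2 y = wl p q y * u2 p + wr p q y * u2 q"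
    "u1 y = wl p q y * u1 p + wr p q y * u1 q + nl p q y * u2 p + nr p q y * u2 q"
proof -
  obtain a b c d where f: "\<forall>x\<in>S. u1 x = a + b * x + c * x^2 + d * x^3"
    "\<forall>x\<in>S. u2 x = - (2 * c + 6 * d * x)"
    by (rule cubic_pair_onE[OF u])
  have pq: "q - p \<noteq> 0" using S by simp
  show "u2 y = wl p q y * u2 p + wr p q y * u2 q"
    using pq unfolding f(2)[rule_format, OF S(1)] f(2)[rule_format, OF S(2)] f(2)[rule_format, OF S(3)] wl_def wr_def
    by (simp add: divide_simps) (simp add: algebra_simps)
  show "u1 y = wl p q y * u1 p + wr p q y * u1 q + nl p q y * u2 p + nr p q y * u2 q"
    using pq unfolding f(1)[rule_format, OF S(1)] f(1)[rule_format, OF S(2)] f(1)[rule_format, OF S(3)]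
      f(2)[rule_format, OF S(1)] f(2)[rule_format, OF S(2)] wl_def wr_def nl_def nr_def
    by (simp add: divide_simps) (simp add: algebra_simps power2_eq_square power3_eq_cube)
qed

lemma cubic_pair_on_formula:
  assumes pq: "p < q"
  shows "cubic_pair_on S (\<lambda>y. wl p q y * A + wr p q y * B + nl p q y * C + nr p q y * D)
    (\<lambda>y. wl p q y * C + wr p q y * D)"
proof -
  \<comment> \<open>The line \<open>u2\<close> through \<open>(p, C)\<close> and
    \<open>(q, D)\<close> yields \<open>d\<close> and \<open>c\<close>; once the quadratic and cubic
    terms are subtracted from the values of \<open>u1\<close>, the remaining line yields
    \<open>b\<close> and \<open>a\<close>.\<close>
  define d where "d = - (D - C) / (6 * (q - p))"
  define c where "c = - C / 2 - 3 * d * p"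
  define b where "b = (B - c * q^2 - d * q^3 - (A - c * p^2 - d * p^3)) / (q - p)"
  define a where "a = A - c * p^2 - d * p^3 - b * p"
  define u1 where "u1 y = a + b * y + c * y^2 + d * y^3" for y
  define u2 where "u2 y = - (2 * c + 6 * d * y)" for y
  have bd: "b * (q - p) = B - c * q^2 - d * q^3 - (A - c * p^2 - d * p^3)" "6 * d * (q - p) = C - D"
    using pq by (simp add: b_def, simp add: d_def divide_simps) (simp add: algebra_simps)
  have cubic: "cubic_pair_on UNIV u1 u2"
    unfolding u1_def u2_def by (rule cubic_pair_onI) auto
  have ends: "u1 p = A" "u1 q = B" "u2 p = C" "u2 q = D"
    using bd by (simp_all add: u1_def u2_def a_def c_def algebra_simps)
  have "wl p q y * A + wr p q y * B + nl p q y * C + nr p q y * D = u1 y"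
    "wl p q y * C + wr p q y * D = u2 y" for y
    using cubic_pair_formula[OF cubic, of p q y] pq by (simp_all add: ends)
  then show ?thesis
    using cubic_pair_on_mono[OF cubic, of S] by simp
qed

lemma cubic_pairs_continuous:
  assumes u: "(u1, u2) \<in> cubic_pairs U"
  shows "continuous_on U u1" "continuous_on U u2"
proof -
  have "isCont u1 x \<and> isCont u2 x" if x: "x \<in> U" for x
  proof -
    obtain V where V: "open V" "x \<in> V" "cubic_pair_on V u1 u2"
      using u x unfolding cubic_pairs_def by blast
    obtain a b c d where f: "\<forall>y\<in>V. u1 y = a + b * y + c * y^2 + d * y^3"
      "\<forall>y\<in>V. u2 y = - (2 * c + 6 * d * y)"
      by (rule cubic_pair_onE[OF V(3)])
    have "continuous_on V (\<lambda>y. a + b * y + c * y^2 + d * y^3)" "continuous_on V (\<lambda>y. - (2 * c + 6 * d * y))"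
      by (intro continuous_intros)+
    then have "continuous_on V u1" "continuous_on V u2"
      using f by (simp_all cong: continuous_on_cong)
    then show ?thesis
      using V by (simp add: continuous_on_eq_continuous_at)
  qed
  then show "continuous_on U u1" "continuous_on U u2"
    by (simp_all add: continuous_at_imp_continuous_on)
qed

lemma cubic_pairs_subset:
  assumes "(u1, u2) \<in> cubic_pairs U" "open W" "W \<subseteq> U"
  shows "(u1, u2) \<in> cubic_pairs W"
  unfolding cubic_pairs_def
proof clarify
  fix x assume "x \<in> W"
  then obtain V where "open V" "x \<in> V" "V \<subseteq> U" "cubic_pair_on V u1 u2"
    using assms unfolding cubic_pairs_def by blast
  with \<open>x \<in> W\<close> assms show "\<exists>V. open V \<and> x \<in> V \<and> V \<subseteq> W \<and> cubic_pair_on V u1 u2"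
    by (intro exI[of _ "V \<inter> W"]) (auto intro: cubic_pair_on_mono)
qed

section \<open>Sheaf and convergence axioms\<close>

lemma presheaf_cubic_pairs: "presheaf_of_pairs unit_interval cubic_pairs"
proof -
  have local: "continuous_map (subtopology unit_interval U) euclideanreal u1 \<and>
        continuous_map (subtopology unit_interval U) euclideanreal u2 \<and>
        (\<forall>V. openin unit_interval V \<and> V \<subseteq> U \<and> (\<forall>x\<in>V. u1 x = 0) \<longrightarrow> (\<forall>x\<in>V. u2 x = 0)) \<and>
        (\<forall>v1 v2. (\<forall>x\<in>U. v1 x = u1 x \<and> v2 x = u2 x) \<longrightarrow> (v1, v2) \<in> cubic_pairs U)"
    if U: "openin unit_interval U" and u: "(u1, u2) \<in> cubic_pairs U" for U u1 u2
  proof (intro conjI allI impI ballI)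
    have sub: "subtopology unit_interval U = top_of_set U"
      using U by (simp add: openin_unit_interval subtopology_subtopology inf.absorb2)
    show "continuous_map (subtopology unit_interval U) euclideanreal u1"
      "continuous_map (subtopology unit_interval U) euclideanreal u2"
      using cubic_pairs_continuous[OF u] by (simp_all add: sub)
  next
    fix V x assume V: "openin unit_interval V \<and> V \<subseteq> U \<and> (\<forall>x\<in>V. u1 x = 0)" and x: "x \<in> V"
    then obtain W where W: "open W" "x \<in> W" "cubic_pair_on W u1 u2"
      using u unfolding cubic_pairs_def by blast
    have "open V"
      using V by (simp add: openin_unit_interval)
    then show "u2 x = 0"
      using V x W cubic_pair_compatible[of "V \<inter> W" u1 u2 x]
      by (meson IntE IntI Int_lower2 cubic_pair_on_mono open_Int)
  next
    fix v1 v2 assume eq: "\<forall>x\<in>U. v1 x = u1 x \<and> v2 x = u2 x"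
    have "cubic_pair_on V v1 v2" if "cubic_pair_on V u1 u2" "V \<subseteq> U" for V
      using that eq cubic_pair_on_cong[of V v1 u1 v2 u2] by blast
    then show "(v1, v2) \<in> cubic_pairs U"
      using u unfolding cubic_pairs_def by blast
  qed
  have zero: "(\<lambda>x. 0, \<lambda>x. 0) \<in> cubic_pairs U" if "openin unit_interval U" for U
    using that by (intro cubic_pair_on_imp_cubic_pairs)
      (auto simp: openin_unit_interval intro: cubic_pair_onI[of _ _ 0 0 0 0])
  have linear: "(\<lambda>x. a * u1 x + b * v1 x, \<lambda>x. a * u2 x + b * v2 x) \<in> cubic_pairs U"
    if u: "(u1, u2) \<in> cubic_pairs U" and v: "(v1, v2) \<in> cubic_pairs U" for U u1 u2 v1 v2 a b
    unfolding cubic_pairs_def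
  proof clarify
    fix x assume "x \<in> U"
    then obtain V W where "open V" "x \<in> V" "V \<subseteq> U" "cubic_pair_on V u1 u2"
      "open W" "x \<in> W" "W \<subseteq> U" "cubic_pair_on W v1 v2"
      using u v unfolding cubic_pairs_def by blast
    then show "\<exists>V. open V \<and> x \<in> V \<and> V \<subseteq> U \<and>
        cubic_pair_on V (\<lambda>x. a * u1 x + b * v1 x) (\<lambda>x. a * u2 x + b * v2 x)"
      by (intro exI[of _ "V \<inter> W"]) (auto intro!: cubic_pair_on_linear intro: cubic_pair_on_mono)
  qed
  show ?thesis
    unfolding presheaf_of_pairs_def
  proof (intro allI impI conjI, goal_cases)
    case (1 U)
    then show ?case by (intro ballI case_prodI2, intro local) auto
  next
    case (2 U)
    then show ?case by (intro zero) simp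
  next
    case (3 U)
    then show ?case by (intro ballI case_prodI2 allI, intro linear) auto
  qed
qed

lemma sheaf_cubic_pairs: "sheaf_axiom unit_interval cubic_pairs"
  unfolding sheaf_axiom_def
proof (intro conjI allI impI)
  fix U V assume "openin unit_interval U \<and> openin unit_interval V \<and> V \<noteq> {} \<and> V \<subseteq> U"
  then show "cubic_pairs U \<subseteq> cubic_pairs V"
    using cubic_pairs_subset by (auto simp: openin_unit_interval)
next
  fix \<U> u assume *: "\<U> \<noteq> {} \<and> (\<forall>U\<in>\<U>. openin unit_interval U \<and> U \<noteq> {} \<and> u \<in> cubic_pairs U)"
  obtain u1 u2 where u: "u = (u1, u2)"
    by (cases u)
  show "u \<in> cubic_pairs (\<Union>\<U>)"
    unfolding cubic_pairs_def u
  proof clarify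
    fix x U assume "x \<in> U" "U \<in> \<U>"
    then obtain V where "open V" "x \<in> V" "V \<subseteq> U" "cubic_pair_on V u1 u2"
      using * u unfolding cubic_pairs_def by blast
    then show "\<exists>V. open V \<and> x \<in> V \<and> V \<subseteq> \<Union>\<U> \<and> cubic_pair_on V u1 u2"
      using \<open>U \<in> \<U>\<close> by blast
  qed
qed

lemma bdd_incseq_tendsto_SUP:
  fixes f :: "nat \<Rightarrow> real"
  assumes "\<And>n. f n \<le> f (Suc n)" "bdd_above (range f)"
  shows "f \<longlonglongrightarrow> (SUP n. f n)"
  using assms by (intro LIMSEQ_incseq_SUP) (auto simp: incseq_Suc_iff)

text \<open>Near each point of \<open>U\<close> choose two points \<open>p < q\<close> where both
  sequences are bounded. The four sequences of values at \<open>p\<close> and \<open>q\<close>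
  converge, and the interpolation formula carries convergence, and the cubic form of the limit, to a
  whole neighbourhood.\<close>

lemma convergence_cubic_pairs: "convergence_axiom unit_interval cubic_pairs"
  unfolding convergence_axiom_def
proof (intro allI impI, elim conjE)
  fix U and h1 h2 :: "nat \<Rightarrow> real \<Rightarrow> real"
  assume U: "openin unit_interval U"
    and h: "\<forall>n. (h1 n, h2 n) \<in> cubic_pairs U"
    and inc: "\<forall>n. \<forall>x\<in>U. h1 n x \<le> h1 (Suc n) x \<and> h2 n x \<le> h2 (Suc n) x"
    and dense: "U \<subseteq> unit_interval closure_of
      {x\<in>U. bdd_above (range (\<lambda>n. h1 n x)) \<and> bdd_above (range (\<lambda>n. h2 n x))}"
  define D where "D = {x\<in>U. bdd_above (range (\<lambda>n. h1 n x)) \<and> bdd_above (range (\<lambda>n. h2 n x))}"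
  \<comment> \<open>Density in the form that is used: the set of boundedness meets every nonempty
    open interval contained in \<open>U\<close>.\<close>
  have DU: "\<exists>z\<in>D. a < z \<and> z < b" if "{a<..<b} \<subseteq> U" "a < b" for a b
  proof -
    have "(a + b) / 2 \<in> unit_interval closure_of D"
      using dense that unfolding D_def by (intro subsetD[OF dense]) auto
    moreover have "openin unit_interval {a<..<b}"
      using that U by (auto simp: openin_unit_interval)
    ultimately show ?thesis
      using that by (auto simp: in_closure_of dest!: spec[of _ "{a<..<b}"])
  qed
  have local: "\<exists>V. open V \<and> x \<in> V \<and> V \<subseteq> U \<and>
      (\<forall>y\<in>V. bdd_above (range (\<lambda>n. h1 n y)) \<and> bdd_above (range (\<lambda>n. h2 n y))) \<and>
      cubic_pair_on V (\<lambda>x. SUP n. h1 n x) (\<lambda>x. SUP n. h2 n x)" if x: "x \<in> U" for x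
  proof -
    have "open U" using U by (simp add: openin_unit_interval)
    then obtain e where e: "e > 0" "\<And>y. dist y x < e \<Longrightarrow> y \<in> U"
      using x unfolding open_dist by auto
    define I where "I = {x - e<..<x + e}"
    have IU: "I \<subseteq> U"
      using e by (auto simp: I_def dist_real_def)
    obtain p where p: "p \<in> D" "x - e < p" "p < x"
      using DU[of "x - e" x] IU e by (auto simp: I_def subset_eq)
    obtain q where q: "q \<in> D" "x < q" "q < x + e"
      using DU[of x "x + e"] IU e by (auto simp: I_def subset_eq)
    have pq: "p < q" "p \<in> I" "q \<in> I"
      using p q by (auto simp: I_def)
    have cub: "cubic_pair_on I (h1 n) (h2 n)" for n
      unfolding I_def using h IU by (intro cubic_pairs_on_interval[of _ _ U]) (auto simp: I_def)
    define A B C E where "A = (SUP n. h1 n p)" "B = (SUP n. h1 n q)" "C = (SUP n. h2 n p)" "E = (SUP n. h2 n q)"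
    have lim: "(\<lambda>n. h1 n p) \<longlonglongrightarrow> A" "(\<lambda>n. h1 n q) \<longlonglongrightarrow> B" "(\<lambda>n. h2 n p) \<longlonglongrightarrow> C" "(\<lambda>n. h2 n q) \<longlonglongrightarrow> E"
      unfolding A_B_C_E_def using p q inc
      by (auto simp: D_def intro!: bdd_incseq_tendsto_SUP)
    have limy: "(\<lambda>n. h1 n y) \<longlonglongrightarrow> wl p q y * A + wr p q y * B + nl p q y * C + nr p q y * E"
      "(\<lambda>n. h2 n y) \<longlonglongrightarrow> wl p q y * C + wr p q y * E" if y: "y \<in> I" for y
    proof -
      have "(\<lambda>n. wl p q y * h1 n p + wr p q y * h1 n q + nl p q y * h2 n p + nr p q y * h2 n q)
          \<longlonglongrightarrow> wl p q y * A + wr p q y * B + nl p q y * C + nr p q y * E"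
        "(\<lambda>n. wl p q y * h2 n p + wr p q y * h2 n q) \<longlonglongrightarrow> wl p q y * C + wr p q y * E"
        by (intro tendsto_intros lim)+
      then show "(\<lambda>n. h1 n y) \<longlonglongrightarrow> wl p q y * A + wr p q y * B + nl p q y * C + nr p q y * E"
        "(\<lambda>n. h2 n y) \<longlonglongrightarrow> wl p q y * C + wr p q y * E"
        using cubic_pair_formula[OF cub pq(2,3) y pq(1)] by simp_all
    qed
    have bdd: "bdd_above (range (\<lambda>n. h1 n y)) \<and> bdd_above (range (\<lambda>n. h2 n y))" if y: "y \<in> I" for y
      using limy[OF y] Bseq_bdd_above convergentI convergent_imp_Bseq by metis
    have eq: "(SUP n. h1 n y) = wl p q y * A + wr p q y * B + nl p q y * C + nr p q y * E \<and>
        (SUP n. h2 n y) = wl p q y * C + wr p q y * E" if y: "y \<in> I" for y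
    proof -
      have "y \<in> U" using y IU by auto
      then have "(\<lambda>n. h1 n y) \<longlonglongrightarrow> (SUP n. h1 n y)" "(\<lambda>n. h2 n y) \<longlonglongrightarrow> (SUP n. h2 n y)"
        using bdd[OF y] inc by (auto intro!: bdd_incseq_tendsto_SUP)
      then show ?thesis
        using limy[OF y] LIMSEQ_unique by blast
    qed
    have "cubic_pair_on I (\<lambda>x. SUP n. h1 n x) (\<lambda>x. SUP n. h2 n x)"
      using cubic_pair_on_formula[OF pq(1), of I A B C E] eq
      by (subst cubic_pair_on_cong[OF eq])
    then show ?thesis
      using bdd IU e by (intro exI[of _ I]) (auto simp: I_def)
  qed
  then show "(\<forall>x\<in>U. bdd_above (range (\<lambda>n. h1 n x)) \<and> bdd_above (range (\<lambda>n. h2 n x))) \<and>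
      (\<lambda>x. SUP n. h1 n x, \<lambda>x. SUP n. h2 n x) \<in> cubic_pairs U"
    unfolding cubic_pairs_def by fast
qed

subsection \<open>Regular sets and the Riquier problem\<close>

lemma compactin_unit_interval: "compactin unit_interval C \<longleftrightarrow> compact C \<and> C \<subseteq> {0<..<1}"
  by (auto simp: compactin_subtopology)

text \<open>The relative closure is compact, hence closed in the line, so it already contains the
  full closure. Thus the closure stays away from 0 and 1, and relative and ordinary topological
  notions agree.\<close>

lemma relatively_compact_openin_unit_interval:
  assumes "openin unit_interval \<omega>" "relatively_compact unit_interval \<omega>"
  shows "unit_interval closure_of \<omega> = closure \<omega>" "compact (closure \<omega>)" "closure \<omega> \<subseteq> {0<..<1}"
    "unit_interval frontier_of \<omega> = closure \<omega> - \<omega>"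
    "compact (closure \<omega> - \<omega>)" "open \<omega>" "\<omega> \<subseteq> {0<..<1}"
proof -
  show \<omega>: "open \<omega>" "\<omega> \<subseteq> {0<..<1}"
    using assms by (auto simp: openin_unit_interval)
  have eq: "unit_interval closure_of \<omega> = {0<..<1} \<inter> closure \<omega>"
    using \<omega> by (simp add: closure_of_subtopology inf.absorb2)
  have "compact ({0<..<1} \<inter> closure \<omega>)"
    using assms eq by (simp add: relatively_compact_def compactin_unit_interval)
  then have "closure \<omega> \<subseteq> {0<..<1} \<inter> closure \<omega>"
    using \<omega> closure_subset by (intro closure_minimal) (auto simp: compact_imp_closed)
  then show sub: "closure \<omega> \<subseteq> {0<..<1}" by blast
  then show cl: "unit_interval closure_of \<omega> = closure \<omega>" "compact (closure \<omega>)"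
    using eq \<open>compact ({0<..<1} \<inter> closure \<omega>)\<close> by (simp_all add: inf.absorb2)
  then show "unit_interval frontier_of \<omega> = closure \<omega> - \<omega>"
    using assms by (simp add: frontier_of_openin)
  show "compact (closure \<omega> - \<omega>)"
    using cl \<omega> by (simp add: compact_diff)
qed

text \<open>The ends are the nearest points of the complement of \<omega> on either side of
  \<open>x\<close>. They exist because the complement is closed and contains 0 and 1.\<close>

lemma component_interval:
  assumes \<omega>: "open \<omega>" "\<omega> \<subseteq> {0<..<1}" and x: "x \<in> \<omega>"
  obtains a b :: real where "a < x" "x < b" "{a<..<b} \<subseteq> \<omega>" "a \<in> closure \<omega> - \<omega>" "b \<in> closure \<omega> - \<omega>"
proof -
  define A B where "A = {..x} - \<omega>" and "B = {x..} - \<omega>"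
  have cl: "closed A" "closed B"
    unfolding A_def B_def using \<omega> by (auto intro: closed_Diff)
  have ne: "0 \<in> A" "1 \<in> B"
    using \<omega> x by (auto simp: A_def B_def)
  have bd: "bdd_above A" "bdd_below B"
    by (auto simp: A_def B_def intro: bdd_above.I2 bdd_below.I2)
  define a b where "a = Sup A" and "b = Inf B"
  have aA: "a \<in> A" and bB: "b \<in> B"
    unfolding a_def b_def using cl ne bd by (auto intro!: closed_contains_Sup closed_contains_Inf)
  have ax: "a < x" "x < b"
    using aA bB x by (auto simp: A_def B_def less_le)
  have sub: "{a<..<b} \<subseteq> \<omega>"
  proof
    fix y assume y: "y \<in> {a<..<b}"
    show "y \<in> \<omega>"
    proof (rule ccontr)
      assume "y \<notin> \<omega>"
      then have "y \<in> A \<or> y \<in> B" by (auto simp: A_def B_def)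
      then show False
        using y cSup_upper[OF _ bd(1)] cInf_lower[OF _ bd(2)] by (fastforce simp: a_def b_def)
    qed
  qed
  have "{a..b} \<subseteq> closure \<omega>"
    using closure_mono[OF sub] ax by simp
  then show ?thesis
    using aA bB ax sub by (intro that[of a b]) (auto simp: A_def B_def)
qed

lemma interval_in_unit_interval:
  assumes "0 < a" "a < b" "b < 1"
  shows "openin unit_interval {a<..<b}" "relatively_compact unit_interval {a<..<b}"
    "unit_interval closure_of {a<..<b} = {a..b}" "unit_interval frontier_of {a<..<b} = {a, b}"
proof -
  show op: "openin unit_interval {a<..<b}"
    using assms by (auto simp: openin_unit_interval)
  show cl: "unit_interval closure_of {a<..<b} = {a..b}"
    using assms by (auto simp: closure_of_subtopology inf.absorb2)
  then show "relatively_compact unit_interval {a<..<b}"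
    using assms by (auto simp: relatively_compact_def compactin_unit_interval)
  show "unit_interval frontier_of {a<..<b} = {a, b}"
    using assms op cl by (auto simp: frontier_of_openin)
qed

lemma connected_relatively_compact_unit_interval:
  assumes \<omega>: "openin unit_interval \<omega>" "relatively_compact unit_interval \<omega>" "connectedin unit_interval \<omega>" "x \<in> \<omega>"
  obtains a b where "0 < a" "a < x" "x < b" "b < 1" "\<omega> = {a<..<b}"
proof -
  note rc = relatively_compact_openin_unit_interval[OF \<omega>(1,2)]
  obtain a b where ab: "a < x" "x < b" "{a<..<b} \<subseteq> \<omega>" "a \<in> closure \<omega> - \<omega>" "b \<in> closure \<omega> - \<omega>"
    using component_interval[OF rc(6,7) \<omega>(4)] .
  have "connected \<omega>"
    using \<omega>(3) by (simp add: connectedin_subtopology)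
  then have iv: "is_interval \<omega>"
    by (simp add: is_interval_connected_1)
  have "\<omega> \<subseteq> {a<..<b}"
  proof
    fix y assume y: "y \<in> \<omega>"
    have "\<not> y \<le> a" "\<not> b \<le> y"
      using mem_is_interval_1_I[OF iv y \<omega>(4), of a] mem_is_interval_1_I[OF iv \<omega>(4) y, of b] ab by auto
    then show "y \<in> {a<..<b}" by simp
  qed
  moreover have "a \<in> {0<..<1}" "b \<in> {0<..<1}"
    using ab rc(3) by blast+
  ultimately show ?thesis
    using ab by (intro that[of a b]) auto
qed

lemma atin_within_unit_interval:
  assumes "z \<in> {0<..<1}"
  shows "atin_within unit_interval z \<omega> = at z within \<omega>"
proof (rule filter_eq_iff[THEN iffD2], rule allI)
  fix P
  have "(\<exists>T. openin unit_interval T \<and> z \<in> T \<and> (\<forall>x\<in>T. x \<in> \<omega> \<and> x \<noteq> z \<longrightarrow> P x)) \<longleftrightarrow>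
      (\<exists>S. open S \<and> z \<in> S \<and> (\<forall>x\<in>S. x \<noteq> z \<longrightarrow> x \<in> \<omega> \<longrightarrow> P x))" (is "?L \<longleftrightarrow> ?R")
  proof
    show "?L \<Longrightarrow> ?R" by (auto simp: openin_unit_interval)
    assume ?R
    then obtain S where "open S" "z \<in> S" "\<forall>x\<in>S. x \<noteq> z \<longrightarrow> x \<in> \<omega> \<longrightarrow> P x" by blast
    then show ?L
      using assms by (intro exI[of _ "S \<inter> {0<..<1}"]) (auto simp: openin_unit_interval)
  qed
  then show "eventually P (atin_within unit_interval z \<omega>) = eventually P (at z within \<omega>)"
    using assms by (simp add: eventually_atin_within eventually_at_topological)
qed

lemma cubic_pair_extend:
  assumes "cubic_pair_on V u1 u2"
  obtains P1 P2 where "cubic_pair_on UNIV P1 P2" "\<forall>y\<in>V. u1 y = P1 y" "\<forall>y\<in>V. u2 y = P2 y"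
proof -
  obtain a b c d where u: "\<forall>y\<in>V. u1 y = a + b * y + c * y^2 + d * y^3"
    "\<forall>y\<in>V. u2 y = - (2 * c + 6 * d * y)"
    by (rule cubic_pair_onE[OF assms])
  show ?thesis
    by (rule that[of "\<lambda>y. a + b * y + c * y^2 + d * y^3" "\<lambda>y. - (2 * c + 6 * d * y)"])
       (auto simp: u intro: cubic_pair_onI)
qed

lemma limit_at_interval_end:
  fixes h P :: "real \<Rightarrow> real"
  assumes "(h \<longlongrightarrow> l) (at z within \<omega>)" "{a<..<b} \<subseteq> \<omega>" "a < b" "z = a \<or> z = b"
    and "\<forall>y\<in>{a<..<b}. h y = P y" "isCont P z"
  shows "P z = l"
proof -
  have nt: "at z within {a<..<b} \<noteq> bot"
    using assms(3,4) by (auto simp: trivial_limit_within islimpt_greaterThanLessThan1 islimpt_greaterThanLessThan2)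
  have "(h \<longlongrightarrow> l) (at z within {a<..<b})"
    using assms(1,2) by (rule tendsto_within_subset)
  moreover have "(h \<longlongrightarrow> P z) (at z within {a<..<b})"
  proof (rule tendsto_cong[THEN iffD1])
    show "(P \<longlongrightarrow> P z) (at z within {a<..<b})"
      using assms(6) unfolding isCont_def by (rule tendsto_within_subset) simp
    show "\<forall>\<^sub>F y in at z within {a<..<b}. P y = h y"
      using assms(5) by (simp add: eventually_at_topological) (metis UNIV_I open_UNIV)
  qed
  ultimately show ?thesis
    using nt tendsto_unique by blast
qed

text \<open>On one component the solution coincides with a polynomial pair defined on the whole
  line, whose values at the two ends are the prescribed limits by continuity. The interpolation
  formula does the rest.\<close>

lemma riquier_solution_formula:
  assumes h: "riquier_solution unit_interval cubic_pairs \<omega> f1 f2 h1 h2"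
    and ab: "a < b" "{a<..<b} \<subseteq> \<omega>" "{a, b} \<subseteq> unit_interval frontier_of \<omega>" and x: "x \<in> {a<..<b}"
  shows "h1 x = wl a b x * f1 a + wr a b x * f1 b + nl a b x * f2 a + nr a b x * f2 b"
    "h2 x = wl a b x * f2 a + wr a b x * f2 b"
proof -
  have I: "a \<in> {0<..<1}" "b \<in> {0<..<1}"
    using ab(3) frontier_of_subset_topspace[of unit_interval \<omega>] by auto
  have "(h1, h2) \<in> cubic_pairs \<omega>"
    using h by (simp add: riquier_solution_def)
  then have "cubic_pair_on {a<..<b} h1 h2"
    using ab(2) by (rule cubic_pairs_on_interval)
  then obtain P1 P2 where P: "cubic_pair_on UNIV P1 P2" "\<forall>y\<in>{a<..<b}. h1 y = P1 y" "\<forall>y\<in>{a<..<b}. h2 y = P2 y"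
    by (rule cubic_pair_extend)
  have "(P1, P2) \<in> cubic_pairs UNIV"
    using P(1) by (intro cubic_pair_on_imp_cubic_pairs) auto
  then have cont: "isCont P1 z" "isCont P2 z" for z
    using cubic_pairs_continuous[of P1 P2 UNIV] by (auto simp: continuous_on_eq_continuous_at)
  have lim: "(h1 \<longlongrightarrow> f1 z) (at z within \<omega>)" "(h2 \<longlongrightarrow> f2 z) (at z within \<omega>)" if "z = a \<or> z = b" for z
    using h ab(3) that I atin_within_unit_interval[of z \<omega>] by (auto simp: riquier_solution_def)
  have "P1 a = f1 a" "P1 b = f1 b" "P2 a = f2 a" "P2 b = f2 b"
    using limit_at_interval_end[OF lim(1) ab(2,1) _ P(2) cont(1)]
      limit_at_interval_end[OF lim(2) ab(2,1) _ P(3) cont(2)] by simp_all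
  then show "h1 x = wl a b x * f1 a + wr a b x * f1 b + nl a b x * f2 a + nr a b x * f2 b"
    "h2 x = wl a b x * f2 a + wr a b x * f2 b"
    using cubic_pair_formula[OF P(1), of a b x] P x ab by simp_all
qed

text \<open>The interpolation formula provides a solution and is forced on every other one; its
  weights are positive inside the interval, which gives both positivity requirements.\<close>

lemma regular_interval:
  assumes ab: "0 < a" "a < b" "b < 1"
  shows "regular_set unit_interval cubic_pairs {a<..<b}"
proof -
  note iv = interval_in_unit_interval[OF ab]
  have ex: "\<exists>h1 h2. riquier_solution unit_interval cubic_pairs {a<..<b} f1 f2 h1 h2" for f1 f2
  proof (intro exI)
    let ?h1 = "\<lambda>y. wl a b y * f1 a + wr a b y * f1 b + nl a b y * f2 a + nr a b y * f2 b"
    let ?h2 = "\<lambda>y. wl a b y * f2 a + wr a b y * f2 b"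
    have "(?h1, ?h2) \<in> cubic_pairs {a<..<b}"
      using cubic_pair_on_formula[OF ab(2)] by (intro cubic_pair_on_imp_cubic_pairs) auto
    moreover have "continuous_on UNIV ?h1" "continuous_on UNIV ?h2"
      by (intro continuous_intros)+
    then have "(?h1 \<longlongrightarrow> ?h1 z) (at z within {a<..<b})" "(?h2 \<longlongrightarrow> ?h2 z) (at z within {a<..<b})" for z
      by (auto simp: continuous_on_def intro: tendsto_within_subset[OF _ subset_UNIV])
    from this[of a] this[of b] 
    have "(?h1 \<longlongrightarrow> f1 z) (at z within {a<..<b})" "(?h2 \<longlongrightarrow> f2 z) (at z within {a<..<b})" 
      if "z \<in> {a, b}" for z
      using ab that by auto
    moreover have "atin_within unit_interval z {a<..<b} = at z within {a<..<b}" if "z \<in> {a, b}" for z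
      using ab that by (intro atin_within_unit_interval) auto
    ultimately show "riquier_solution unit_interval cubic_pairs {a<..<b} f1 f2 ?h1 ?h2"
      unfolding riquier_solution_def iv(4) by simp
  qed
  have formula: "\<forall>x\<in>{a<..<b}. k1 x = wl a b x * f1 a + wr a b x * f1 b + nl a b x * f2 a + nr a b x * f2 b
      \<and> k2 x = wl a b x * f2 a + wr a b x * f2 b"
    if "riquier_solution unit_interval cubic_pairs {a<..<b} f1 f2 k1 k2" for f1 f2 k1 k2
    using riquier_solution_formula[OF that ab(2)] iv(4) by simp
  have "\<exists>h1 h2. riquier_solution unit_interval cubic_pairs {a<..<b} f1 f2 h1 h2 \<and>
      (\<forall>k1 k2. riquier_solution unit_interval cubic_pairs {a<..<b} f1 f2 k1 k2 \<longrightarrow>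
        (\<forall>x\<in>{a<..<b}. k1 x = h1 x \<and> k2 x = h2 x)) \<and>
      ((\<forall>z\<in>unit_interval frontier_of {a<..<b}. 0 \<le> f1 z \<and> 0 \<le> f2 z) \<longrightarrow> (\<forall>x\<in>{a<..<b}. 0 \<le> h1 x)) \<and>
      ((\<forall>z\<in>unit_interval frontier_of {a<..<b}. 0 \<le> f2 z) \<longrightarrow> (\<forall>x\<in>{a<..<b}. 0 \<le> h2 x))" for f1 f2
  proof -
    obtain h1 h2 where h: "riquier_solution unit_interval cubic_pairs {a<..<b} f1 f2 h1 h2"
      using ex by blast
    have uniq: "\<forall>x\<in>{a<..<b}. k1 x = h1 x \<and> k2 x = h2 x"
      if "riquier_solution unit_interval cubic_pairs {a<..<b} f1 f2 k1 k2" for k1 k2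
      using formula[OF h] formula[OF that] by simp
    have pos1: "0 \<le> h1 x" if "0 \<le> f1 a \<and> 0 \<le> f2 a \<and> 0 \<le> f1 b \<and> 0 \<le> f2 b" "x \<in> {a<..<b}" for x
      using formula[OF h] that weights_nonneg[of a x b] by simp
    have pos2: "0 \<le> h2 x" if "0 \<le> f2 a \<and> 0 \<le> f2 b" "x \<in> {a<..<b}" for x
      using formula[OF h] that weights_nonneg[of a x b] by simp
    show ?thesis
      unfolding iv(4)
      by (rule exI[of _ h1], rule exI[of _ h2], intro conjI h allI impI uniq ballI pos1 pos2) auto
  qed
  then show ?thesis
    using iv ab by (simp add: regular_set_def)
qed

lemma interval_inside_open:
  fixes x :: real
  assumes "openin unit_interval U" "x \<in> U"
  obtains a b where "0 < a" "a < x" "x < b" "b < 1" "{a..b} \<subseteq> U"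
proof -
  have U: "open U" "U \<subseteq> {0<..<1}"
    using assms by (auto simp: openin_unit_interval)
  then obtain e where e: "e > 0" "\<And>y. dist y x < e \<Longrightarrow> y \<in> U"
    using assms unfolding open_dist by auto
  have sub: "{x - e/2..x + e/2} \<subseteq> U"
    using e by (auto simp: dist_real_def)
  moreover have "x - e/2 \<in> {x - e/2..x + e/2}" "x + e/2 \<in> {x - e/2..x + e/2}"
    using e by auto
  ultimately have "x - e/2 \<in> {0<..<1}" "x + e/2 \<in> {0<..<1}"
    using U(2) by blast+
  then show ?thesis
    using e sub by (intro that[of "x - e/2" "x + e/2"]) auto
qed

lemma base_cubic_pairs: "base_axiom unit_interval cubic_pairs"
  unfolding base_axiom_def
proof (intro allI impI)
  fix U x assume "openin unit_interval U \<and> x \<in> U"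
  then obtain a b where "0 < a" "a < x" "x < b" "b < 1" "{a..b} \<subseteq> U"
    using interval_inside_open by metis
  then show "\<exists>\<omega>. regular_set unit_interval cubic_pairs \<omega> \<and> x \<in> \<omega> \<and> \<omega> \<subseteq> U"
    using regular_interval[of a b] by (intro exI[of _ "{a<..<b}"]) auto
qed

lemma cont_on_unit_interval:
  "S \<subseteq> {0<..<1} \<Longrightarrow> cont_on unit_interval S f \<longleftrightarrow> continuous_on S f"
  by (simp add: cont_on_def subtopology_subtopology inf.absorb2)

section \<open>Riquier measures and ellipticity\<close>

text \<open>A regular set may have many components, but the solution at \<open>x\<close> depends
  only on the data at the two ends of the component of \<open>x\<close>. This holds for every
  regular set, so all mean value inequalities reduce to intervals.\<close>

lemma riquier_measures_regular:
  assumes reg: "regular_set unit_interval cubic_pairs \<omega>" and x: "x \<in> \<omega>"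
  obtains a b where "0 < a" "a < x" "x < b" "b < 1" "{a<..<b} \<subseteq> \<omega>" "{a, b} \<subseteq> unit_interval frontier_of \<omega>"
    "mu_measure unit_interval cubic_pairs \<omega> x = two_point a b (wl a b x) (wr a b x)"
    "nu_measure unit_interval cubic_pairs \<omega> x = two_point a b (nl a b x) (nr a b x)"
    "lambda_measure unit_interval cubic_pairs \<omega> x = two_point a b (wl a b x) (wr a b x)"
proof -
  have op: "openin unit_interval \<omega>" "relatively_compact unit_interval \<omega>"
    using reg by (auto simp: regular_set_def)
  note rc = relatively_compact_openin_unit_interval[OF op]
  obtain a b where ab: "a < x" "x < b" "{a<..<b} \<subseteq> \<omega>" "a \<in> closure \<omega> - \<omega>" "b \<in> closure \<omega> - \<omega>"
    using component_interval[OF rc(6,7) x] .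
  define S where "S = unit_interval frontier_of \<omega>"
  have S: "S \<subseteq> {0<..<1}" "compact S" "{a, b} \<subseteq> S"
    using rc ab by (auto simp: S_def)
  have ab': "0 < a" "a < b" "b < 1" "x \<in> {a<..<b}"
    using ab S by auto
  note w = weights_nonneg[OF ab(1,2), THEN less_imp_le]
  note radon = radon_measure_on_two_point[OF ab'(1-3) _ _ S(3)]
  note int = set_integral_two_point[OF ab'(1-3) _ _ S(3,2,1)]
  note uniq = two_point_unique[OF ab'(1-3) _ _ _ S(3,2,1)]
  note cont = cont_on_unit_interval[OF S(1)]
  note formula = riquier_solution_formula[OF _ ab'(2) ab(3) S(3)[unfolded S_def] ab'(4)]
  let ?P = "\<lambda>(\<mu>, \<nu>, \<kappa>). radon_measure_on unit_interval S \<mu> \<and> radon_measure_on unit_interval S \<nu> \<and>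
     radon_measure_on unit_interval S \<kappa> \<and>
     (\<forall>f1 f2 h1 h2. cont_on unit_interval S f1 \<and> cont_on unit_interval S f2 \<and>
        riquier_solution unit_interval cubic_pairs \<omega> f1 f2 h1 h2 \<longrightarrow>
        h1 x = (LINT z:S|\<mu>. f1 z) + (LINT z:S|\<nu>. f2 z) \<and> h2 x = (LINT z:S|\<kappa>. f2 z))"
  let ?m = "two_point a b (wl a b x) (wr a b x)" and ?n = "two_point a b (nl a b x) (nr a b x)"
  have ex: "?P (?m, ?n, ?m)"
    using w by (auto simp: radon int cont dest: formula)
  have unique: "t = (?m, ?n, ?m)" if t: "?P t" for t
  proof -
    obtain \<mu> \<nu> \<kappa> where t_def: "t = (\<mu>, \<nu>, \<kappa>)"
      by (cases t)
    have rep: "(LINT z:S|\<mu>. f1 z) + (LINT z:S|\<nu>. f2 z) = wl a b x * f1 a + wr a b x * f1 b + nl a b x * f2 a + nr a b x * f2 b"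
      "(LINT z:S|\<kappa>. f2 z) = wl a b x * f2 a + wr a b x * f2 b"
      if f: "continuous_on S f1" "continuous_on S f2" for f1 f2
    proof -
      obtain h1 h2 where "riquier_solution unit_interval cubic_pairs \<omega> f1 f2 h1 h2"
        using reg f cont unfolding regular_set_def S_def by meson
      with t f formula[OF this] show "(LINT z:S|\<mu>. f1 z) + (LINT z:S|\<nu>. f2 z) = wl a b x * f1 a + wr a b x * f1 b + nl a b x * f2 a + nr a b x * f2 b"
        "(LINT z:S|\<kappa>. f2 z) = wl a b x * f2 a + wr a b x * f2 b"
        by (auto simp: t_def cont)
    qed
    \<comment> \<open>The representation only controls the sum of the integrals against \<mu> and
      \<nu>; the data \<open>f2 = 0\<close> isolate \<mu> and the data \<open>f1 = 0\<close> isolate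
      \<nu>.\<close>
    have "\<mu> = ?m"
      using t w rep(1)[of _ "\<lambda>_. 0"] by (intro uniq) (auto simp: t_def set_lebesgue_integral_def)
    moreover have "\<nu> = ?n"
      using t w rep(1)[of "\<lambda>_. 0"] by (intro uniq) (auto simp: t_def set_lebesgue_integral_def)
    moreover have "\<kappa> = ?m"
      using t w rep(2)[of "\<lambda>_. 0"] by (intro uniq) (auto simp: t_def)
    ultimately show ?thesis
      by (simp add: t_def)
  qed
  have "riquier_measures unit_interval cubic_pairs \<omega> x = (?m, ?n, ?m)"
    unfolding riquier_measures_def S_def[symmetric]
    by (rule the_equality[of ?P, OF ex unique])
  then show ?thesis
    using ab ab' S(3) by (intro that[of a b])
      (auto simp: mu_measure_def nu_measure_def lambda_measure_def S_def)
qed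

lemma riquier_measures_interval:
  assumes ab: "0 < a" "b < 1" and x: "a < x" "x < b"
  shows "mu_measure unit_interval cubic_pairs {a<..<b} x = two_point a b (wl a b x) (wr a b x)"
    "nu_measure unit_interval cubic_pairs {a<..<b} x = two_point a b (nl a b x) (nr a b x)"
    "lambda_measure unit_interval cubic_pairs {a<..<b} x = two_point a b (wl a b x) (wr a b x)"
proof -
  have lt: "a < b" using x by simp
  obtain c d where cd: "0 < c" "c < x" "x < d" "d < 1" "{c<..<d} \<subseteq> {a<..<b}"
    "{c, d} \<subseteq> unit_interval frontier_of {a<..<b}"
    "mu_measure unit_interval cubic_pairs {a<..<b} x = two_point c d (wl c d x) (wr c d x)"
    "nu_measure unit_interval cubic_pairs {a<..<b} x = two_point c d (nl c d x) (nr c d x)"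
    "lambda_measure unit_interval cubic_pairs {a<..<b} x = two_point c d (wl c d x) (wr c d x)"
    by (rule riquier_measures_regular[OF regular_interval[OF ab(1) lt ab(2)]]) (use x in auto)
  have "c = a" "d = b"
    using cd(2,3,6) x interval_in_unit_interval[OF ab(1) lt ab(2)] by auto
  then show "mu_measure unit_interval cubic_pairs {a<..<b} x = two_point a b (wl a b x) (wr a b x)"
    "nu_measure unit_interval cubic_pairs {a<..<b} x = two_point a b (nl a b x) (nr a b x)"
    "lambda_measure unit_interval cubic_pairs {a<..<b} x = two_point a b (wl a b x) (wr a b x)"
    using cd by simp_all
qed

lemma support_two_point:
  assumes "0 < a" "a < b" "b < 1" "0 < \<alpha>" "0 < \<beta>"
  shows "support_of unit_interval (two_point a b \<alpha> \<beta>) = {a, b}"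
proof (intro set_eqI iffI)
  fix x assume x: "x \<in> support_of unit_interval (two_point a b \<alpha> \<beta>)"
  show "x \<in> {a, b}"
  proof (rule ccontr)
    assume n: "x \<notin> {a, b}"
    let ?V = "{0<..<1} - {a, b}"
    have "open ?V" by (intro open_Diff) auto
    then have "openin unit_interval ?V" by (auto simp: openin_unit_interval)
    then have "emeasure (two_point a b \<alpha> \<beta>) ?V > 0"
      using x n by (auto simp: support_of_def)
    then show False
      using assms two_point_values(3)[of a b \<alpha> \<beta> "{a, b}"] by simp
  qed
next
  fix x assume x: "x \<in> {a, b}"
  have "emeasure (two_point a b \<alpha> \<beta>) V > 0" if V: "openin unit_interval V" "x \<in> V" for V
  proof -
    have "V \<in> sets (borel_of unit_interval)"
      using V by (auto simp: sets_borel_of_unit_interval openin_unit_interval)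
    then show ?thesis
      using x V assms by (auto simp: emeasure_two_point indicator_def simp del: ennreal_plus)
  qed
  then show "x \<in> support_of unit_interval (two_point a b \<alpha> \<beta>)"
    using x assms by (auto simp: support_of_def)
qed

lemma elliptic_cubic_pairs: "elliptic unit_interval cubic_pairs"
  unfolding elliptic_def
proof (intro allI impI, elim conjE)
  fix \<omega> x assume reg: "regular_set unit_interval cubic_pairs \<omega>" "connectedin unit_interval \<omega>" "x \<in> \<omega>"
  then obtain a b where ab: "0 < a" "a < x" "x < b" "b < 1" "\<omega> = {a<..<b}"
    using connected_relatively_compact_unit_interval[of \<omega> x] by (auto simp: regular_set_def)
  show "support_of unit_interval (lambda_measure unit_interval cubic_pairs \<omega> x) = unit_interval frontier_of \<omega> \<and>
       support_of unit_interval (mu_measure unit_interval cubic_pairs \<omega> x) = unit_interval frontier_of \<omega> \<and>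
       support_of unit_interval (nu_measure unit_interval cubic_pairs \<omega> x) = unit_interval frontier_of \<omega>"
    unfolding ab(5) using ab(1-4) weights_nonneg[of a x b]
    by (simp add: riquier_measures_interval interval_in_unit_interval support_two_point)
qed

subsection \<open>Concave functions\<close>

text \<open>Concavity on the open interval, written with the weights of harmonic measure so that it
  is literally the mean value inequality.\<close>

definition concave_unit :: "(real \<Rightarrow> real) \<Rightarrow> bool" where
  "concave_unit p \<longleftrightarrow> (\<forall>a x b. 0 < a \<and> a < x \<and> x < b \<and> b < 1 \<longrightarrow>
     wl a b x * p a + wr a b x * p b \<le> p x)"

lemma concave_unitD:
  "concave_unit p \<Longrightarrow> 0 < a \<Longrightarrow> a < x \<Longrightarrow> x < b \<Longrightarrow> b < 1 \<Longrightarrow> wl a b x * p a + wr a b x * p b \<le> p x"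
  by (auto simp: concave_unit_def)

lemma concave_unit_affine: "concave_unit (\<lambda>x. c + d * x)"
  by (simp add: concave_unit_def weights_affine)

lemma concave_unit_min:
  assumes "concave_unit p" "concave_unit q"
  shows "concave_unit (\<lambda>x. min (p x) (q x))"
  unfolding concave_unit_def
proof (intro allI impI, elim conjE)
  fix a x b :: real assume ab: "0 < a" "a < x" "x < b" "b < 1"
  note w = weights_nonneg(1,2)[OF ab(2,3)]
  have "wl a b x * min (p a) (q a) + wr a b x * min (p b) (q b) \<le> wl a b x * p a + wr a b x * p b"
    "wl a b x * min (p a) (q a) + wr a b x * min (p b) (q b) \<le> wl a b x * q a + wr a b x * q b"
    using w by (intro add_mono mult_left_mono; simp)+
  then show "wl a b x * min (p a) (q a) + wr a b x * min (p b) (q b) \<le> min (p x) (q x)"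
    using concave_unitD[OF assms(1) ab] concave_unitD[OF assms(2) ab] by linarith
qed

text \<open>Convex functions on an open set are continuous; the work is to see that
  \<open>1 - t\<close> and \<open>t\<close> are the weights \<open>wl\<close> and \<open>wr\<close>
  at the point that they define.\<close>

lemma concave_unit_continuous:
  assumes "concave_unit p"
  shows "continuous_on {0<..<1} p"
proof -
  have "convex_on {0<..<1} (\<lambda>x. - p x)"
  proof (rule convex_on_linorderI)
    fix t x y :: real
    assume t: "0 < t" "t < 1" and xy: "x \<in> {0<..<1}" "y \<in> {0<..<1}" "x < y"
    let ?z = "(1 - t) * x + t * y"
    have z: "?z = x + t * (y - x)" by (simp add: algebra_simps)
    have "t * (y - x) < 1 * (y - x)" using t xy by (intro mult_strict_right_mono) auto
    then have "?z < y" unfolding z by (simp only: mult_1 less_diff_eq add.commute)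
    moreover have "x < ?z" unfolding z using t xy by simp
    moreover have "wr x y ?z = t"
      unfolding z using xy by (simp add: wr_def)
    moreover from this have "wl x y ?z = 1 - t"
      using weights_sum[OF xy(3), of ?z] by simp
    ultimately have "(1 - t) * p x + t * p y \<le> p ?z"
      using concave_unitD[OF assms, of x ?z y] xy by simp
    then show "- p ((1 - t) *\<^sub>R x + t *\<^sub>R y) \<le> (1 - t) * - p x + t * - p y"
      by simp
  qed simp
  then have "continuous_on {0<..<1} (\<lambda>x. - p x)"
    by (intro convex_on_continuous) auto
  then have "continuous_on {0<..<1} (\<lambda>x. - (- p x))"
    by (rule continuous_on_minus)
  then show ?thesis by simp
qed

text \<open>For \<open>x < a\<close> take the concavity inequality at \<open>a\<close> between
  \<open>x\<close> and \<open>b\<close> and solve it for \<open>p x\<close>; for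
  \<open>b < x\<close> use the one at \<open>b\<close> in the same way.\<close>

lemma concave_unit_below_chord:
  assumes p: "concave_unit p" and ab: "0 < a" "a < b" "b < 1"
    and x: "0 < x" "x < 1" "x \<le> a \<or> b \<le> x"
  shows "p x \<le> wl a b x * p a + wr a b x * p b"
proof -
  consider "x < a" | "b < x" | "x = a" | "x = b" using x by linarith
  then show ?thesis
  proof cases
    case 1
    have "wl x b a * p x + wr x b a * p b \<le> p a"
      using 1 ab x by (intro concave_unitD[OF p]) auto
    then have "(b - x) * (wl x b a * p x + wr x b a * p b) \<le> (b - x) * p a"
      using 1 ab by (intro mult_left_mono) auto
    also have "(b - x) * (wl x b a * p x + wr x b a * p b) = (b - a) * p x + (a - x) * p b"
      using 1 ab by (simp add: wl_def wr_def distrib_left)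
    finally have "(b - a) * p x \<le> (b - x) * p a + (x - a) * p b"
      by (simp add: algebra_simps)
    then have "p x \<le> ((b - x) * p a + (x - a) * p b) / (b - a)"
      using ab by (simp add: pos_le_divide_eq mult.commute)
    then show ?thesis by (simp add: wl_def wr_def add_divide_distrib)
  next
    case 2
    have "wl a x b * p a + wr a x b * p x \<le> p b"
      using 2 ab x by (intro concave_unitD[OF p]) auto
    then have "(x - a) * (wl a x b * p a + wr a x b * p x) \<le> (x - a) * p b"
      using 2 ab by (intro mult_left_mono) auto
    also have "(x - a) * (wl a x b * p a + wr a x b * p x) = (x - b) * p a + (b - a) * p x"
      using 2 ab by (simp add: wl_def wr_def distrib_left)
    finally have "(b - a) * p x \<le> (b - x) * p a + (x - a) * p b"
      by (simp add: algebra_simps)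
    then have "p x \<le> ((b - x) * p a + (x - a) * p b) / (b - a)"
      using ab by (simp add: pos_le_divide_eq mult.commute)
    then show ?thesis by (simp add: wl_def wr_def add_divide_distrib)
  qed (use ab in simp_all)
qed

text \<open>The Poisson modification of \<open>p\<close> on \<open>{a<..<b}\<close>; for concave
  nonnegative \<open>p\<close> it turns out to be the swept function on the complement.\<close>

definition chord_cut :: "real \<Rightarrow> real \<Rightarrow> (real \<Rightarrow> real) \<Rightarrow> real \<Rightarrow> real" where
  "chord_cut a b p x = (if a < x \<and> x < b then wl a b x * p a + wr a b x * p b else p x)"

context
  fixes a b :: real and p :: "real \<Rightarrow> real"
  assumes p: "concave_unit p" and ab: "0 < a" "a < b" "b < 1"
begin

lemma chord_cut_le: "0 < x \<Longrightarrow> x < 1 \<Longrightarrow> chord_cut a b p x \<le> p x"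
  using concave_unitD[OF p, of a x b] ab by (simp add: chord_cut_def)

lemma chord_cut_le_chord:
  "0 < x \<Longrightarrow> x < 1 \<Longrightarrow> chord_cut a b p x \<le> wl a b x * p a + wr a b x * p b"
  using concave_unit_below_chord[OF p ab, of x] by (auto simp: chord_cut_def)

text \<open>\<open>chord_cut a b p\<close> is the minimum of \<open>p\<close> and the line through
  its values at \<open>a\<close> and \<open>b\<close>. At \<open>x\<close> inside the interval the
  bound by the line is used, elsewhere the bound by \<open>p\<close>.\<close>

lemma concave_unit_chord_cut: "concave_unit (chord_cut a b p)"
  unfolding concave_unit_def
proof (intro allI impI, elim conjE)
  fix u x v :: real assume uv: "0 < u" "u < x" "x < v" "v < 1"
  note w = weights_nonneg(1,2)[OF uv(2,3)]
  let ?c = "\<lambda>x. wl a b x * p a + wr a b x * p b"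
  have c: "?c x = (b * p a - a * p b) / (b - a) + (p b - p a) / (b - a) * x" for x
    by (simp add: wl_def wr_def diff_divide_distrib add_divide_distrib algebra_simps)
  show "wl u v x * chord_cut a b p u + wr u v x * chord_cut a b p v \<le> chord_cut a b p x"
  proof (cases "a < x \<and> x < b")
    case True
    have "wl u v x * chord_cut a b p u + wr u v x * chord_cut a b p v \<le> wl u v x * ?c u + wr u v x * ?c v"
      using w uv by (intro add_mono mult_left_mono chord_cut_le_chord) auto
    also have "\<dots> = ?c x"
      unfolding c using uv by (intro weights_affine) auto
    also have "\<dots> = chord_cut a b p x"
      using True by (simp add: chord_cut_def)
    finally show ?thesis .
  next
    case False
    have "wl u v x * chord_cut a b p u + wr u v x * chord_cut a b p v \<le> wl u v x * p u + wr u v x * p v"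
      using w uv by (intro add_mono mult_left_mono chord_cut_le) auto
    also have "\<dots> \<le> p x"
      using concave_unitD[OF p] uv by simp
    also have "\<dots> = chord_cut a b p x"
      by (simp only: chord_cut_def False if_False)
    finally show ?thesis .
  qed
qed

end

lemma chord_cut_nonneg:
  assumes "a < b" "0 < a" "b < 1" "\<And>x. 0 < x \<Longrightarrow> x < 1 \<Longrightarrow> 0 \<le> p x" "0 < x" "x < 1"
  shows "0 \<le> chord_cut a b p x"
  using assms weights_nonneg[of a x b] by (auto simp: chord_cut_def)

text \<open>Letting \<open>x\<close> tend to 0 gives \<open>c = 0\<close>, and letting it tend to 1
  gives \<open>c + d = 0\<close>. Every function below both x and 1 - x thus has no nonzero affine
  minorant that is nonnegative, which is how potentials are recognized.\<close>

lemma affine_minorant_zero: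
  fixes c d :: real
  assumes "\<And>x. 0 < x \<Longrightarrow> x < 1 \<Longrightarrow> 0 \<le> c + d * x \<and> c + d * x \<le> x \<and> c + d * x \<le> 1 - x"
  shows "c = 0" "d = 0"
proof -
  have "((\<lambda>x. c + d * x) \<longlongrightarrow> 0) (at_right 0)"
  proof (rule tendsto_sandwich[of "\<lambda>_. 0" _ _ "\<lambda>x. x"])
    have ev: "\<forall>\<^sub>F x in at_right (0::real). 0 < x \<and> x < 1"
      by (auto simp: eventually_at_right_field intro: exI[of _ 1])
    show "\<forall>\<^sub>F x in at_right 0. 0 \<le> c + d * x" "\<forall>\<^sub>F x in at_right 0. c + d * x \<le> x"
      by (rule eventually_mono[OF ev]; use assms in simp)+
  qed (rule tendsto_const, rule tendsto_ident_at)
  moreover have "((\<lambda>x. c + d * x) \<longlongrightarrow> c + d * 0) (at_right 0)"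
    by (intro tendsto_intros)
  ultimately have c: "c = 0"
    using tendsto_unique[of "at_right (0::real)"] by fastforce
  have "((\<lambda>x. c + d * x) \<longlongrightarrow> 0) (at_left 1)"
  proof (rule tendsto_sandwich[of "\<lambda>_. 0" _ _ "\<lambda>x. 1 - x"])
    have ev: "\<forall>\<^sub>F x in at_left (1::real). 0 < x \<and> x < 1"
      by (auto simp: eventually_at_left_field intro: exI[of _ 0])
    show "\<forall>\<^sub>F x in at_left 1. 0 \<le> c + d * x" "\<forall>\<^sub>F x in at_left 1. c + d * x \<le> 1 - x"
      by (rule eventually_mono[OF ev]; use assms in simp)+
    show "((\<lambda>x. 1 - x) \<longlongrightarrow> (0::real)) (at_left 1)"
      using tendsto_diff[OF tendsto_const[of "1::real"] tendsto_ident_at[of 1 "{..<1}"]] by simp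
  qed (rule tendsto_const)
  moreover have "((\<lambda>x. c + d * x) \<longlongrightarrow> c + d * 1) (at_left 1)"
    by (intro tendsto_intros)
  ultimately have "c + d * 1 = 0"
    using tendsto_unique[of "at_left (1::real)"] by fastforce
  with c show "c = 0" "d = 0" by simp_all
qed

lemma lsc_on_continuous:
  assumes "continuous_on {0<..<1} p"
  shows "lsc_on unit_interval {0<..<1} (\<lambda>x. ereal (p x))"
proof -
  have "open ({0<..<1} \<inter> p -` {a<..})" for a
    using assms by (intro continuous_open_preimage) auto
  then have "openin unit_interval ({0<..<1} \<inter> p -` {a<..})" for a
    by (simp add: openin_unit_interval)
  moreover have "{x \<in> {0<..<1}. a < p x} = {0<..<1} \<inter> p -` {a<..}" for a
    by auto
  ultimately show ?thesis
    by (simp add: lsc_on_def subtopology_subtopology)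
qed

lemma lsc_regularization_continuous:
  assumes p: "continuous_on {0<..<1} p" and f: "\<And>x. x \<in> {0<..<1} \<Longrightarrow> f x = ereal (p x)"
    and x: "x \<in> {0<..<1}"
  shows "lsc_regularization unit_interval f x = ereal (p x)"
proof (rule antisym)
  show "lsc_regularization unit_interval f x \<le> ereal (p x)"
    unfolding lsc_regularization_def using x f by (intro SUP_least) (auto intro: INF_lower2[of x])
  show "ereal (p x) \<le> lsc_regularization unit_interval f x"
  proof (rule ereal_le_epsilon2)
    fix e :: real assume e: "0 < e"
    define V where "V = {0<..<1} \<inter> p -` {p x - e<..}"
    have "openin unit_interval V"
      unfolding V_def using p by (auto simp: openin_unit_interval intro!: continuous_open_preimage)
    then have "(INF y\<in>V. f y) \<le> lsc_regularization unit_interval f x"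
      unfolding lsc_regularization_def using x e by (intro SUP_upper) (auto simp: V_def)
    moreover have "ereal (p x - e) \<le> (INF y\<in>V. f y)"
      using f by (intro INF_greatest) (auto simp: V_def)
    ultimately have "ereal (p x - e) \<le> lsc_regularization unit_interval f x"
      by (rule order_trans[rotated])
    then have "ereal (p x - e) + ereal e \<le> lsc_regularization unit_interval f x + ereal e"
      by (rule add_right_mono)
    then show "ereal (p x) \<le> lsc_regularization unit_interval f x + ereal e"
      by simp
  qed
qed

lemma affine_on_interval:
  assumes "cubic_pair_on {p<..<q} u (\<lambda>x. 0)"
  shows "\<exists>c d. \<forall>x\<in>{p<..<q}. u x = c + d * x"
proof (cases "p < q")
  case True
  \<comment> \<open>Any two interior points would do: with second component 0 the interpolation
    formula reduces to the line through the values at \<open>r\<close> and \<open>s\<close>.\<close>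
  define r s where "r = (2 * p + q) / 3" and "s = (p + 2 * q) / 3"
  have rs: "r \<in> {p<..<q}" "s \<in> {p<..<q}" "r < s"
    using True by (auto simp: r_def s_def)
  have "u x = (s * u r - r * u s) / (s - r) + (u s - u r) / (s - r) * x" if x: "x \<in> {p<..<q}" for x
  proof -
    have "u x = wl r s x * u r + wr r s x * u s"
      using cubic_pair_formula(2)[OF assms rs(1,2) x rs(3)] cubic_pair_formula(1)[OF assms rs(1,2) x rs(3)]
      by simp
    also have "\<dots> = (s * u r - r * u s) / (s - r) + (u s - u r) / (s - r) * x"
      by (simp add: wl_def wr_def diff_divide_distrib add_divide_distrib algebra_simps)
    finally show ?thesis .
  qed
  then show ?thesis by blast
qed auto

text \<open>A locally affine function is the first component of a cubic pair with second component
  0, so the passage from local to global coefficients for cubic pairs applies.\<close>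

lemma locally_affine_on_interval:
  fixes u :: "real \<Rightarrow> real"
  assumes "\<And>x. x \<in> {p<..<q} \<Longrightarrow> \<exists>a b c d. a < x \<and> x < b \<and> (\<forall>y\<in>{a<..<b}. u y = c + d * y)"
  shows "\<exists>c d. \<forall>x\<in>{p<..<q}. u x = c + d * x"
proof -
  have "(u, \<lambda>x. 0) \<in> cubic_pairs {p<..<q}"
    unfolding cubic_pairs_def
  proof clarify
    fix x assume x: "x \<in> {p<..<q}"
    then obtain a b c d where ab: "a < x" "x < b" "\<forall>y\<in>{a<..<b}. u y = c + d * y"
      using assms by blast
    have "cubic_pair_on ({a<..<b} \<inter> {p<..<q}) u (\<lambda>x. 0)"
      using ab by (intro cubic_pair_onI[of _ _ c d 0 0]) auto
    then show "\<exists>V. open V \<and> x \<in> V \<and> V \<subseteq> {p<..<q} \<and> cubic_pair_on V u (\<lambda>x. 0)"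
      using ab x by (intro exI[of _ "{a<..<b} \<inter> {p<..<q}"]) auto
  qed
  then have "cubic_pair_on {p<..<q} u (\<lambda>x. 0)"
    by (rule cubic_pairs_on_interval) simp
  then show ?thesis
    by (rule affine_on_interval)
qed

subsection \<open>Potentials, sweeping and Green's functions\<close>

text \<open>The two associated harmonic structures and the adjoint structures all have the affine
  functions as harmonic functions, but differ in their families of mean sets.\<close>

locale affine_structure =
  fixes S :: "real harmonic_structure"
  assumes affine_harmonic: "openin unit_interval U \<Longrightarrow> (\<And>x. x \<in> U \<Longrightarrow> u x = c + d * x) \<Longrightarrow> u \<in> harmonic S U"
    and harmonic_affine: "openin unit_interval U \<Longrightarrow> u \<in> harmonic S U \<Longrightarrow> {a<..<b} \<subseteq> U \<Longrightarrow>
      \<exists>c d. \<forall>x\<in>{a<..<b}. u x = c + d * x"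
    and interval_mean_set: "0 < a \<Longrightarrow> a < b \<Longrightarrow> b < 1 \<Longrightarrow> {a<..<b} \<in> mean_sets S"
    and interval_measure: "0 < a \<Longrightarrow> a < x \<Longrightarrow> x < b \<Longrightarrow> b < 1 \<Longrightarrow>
      harmonic_measure S {a<..<b} x = two_point a b (wl a b x) (wr a b x)"
    and mean_set_measure: "\<omega> \<in> mean_sets S \<Longrightarrow> x \<in> \<omega> \<Longrightarrow>
      \<exists>a b. 0 < a \<and> a < x \<and> x < b \<and> b < 1 \<and> {a, b} \<subseteq> unit_interval frontier_of \<omega> \<and>
        harmonic_measure S \<omega> x = two_point a b (wl a b x) (wr a b x)"

lemma ext_integral_two_point':
  assumes "0 < a" "a < b" "b < 1" "0 \<le> \<alpha>" "0 \<le> \<beta>" "{a, b} \<subseteq> F" "F \<subseteq> {0<..<1}"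
    and "nonneg_on {0<..<1} v"
  shows "ext_integral (two_point a b \<alpha> \<beta>) F v = ereal \<alpha> * v a + ereal \<beta> * v b"
  using assms two_point_values[OF assms(1-5)]
  by (intro ext_integral_two_point) (auto simp: nonneg_on_def)

lemma frontier_of_unit_interval_subset: "unit_interval frontier_of U \<subseteq> {0<..<1}"
  using frontier_of_subset_topspace[of unit_interval U] by simp

context affine_structure
begin

text \<open>Each harmonic measure of the structure is that of some interval with ends in the
  frontier, so intervals suffice as a test. The converse \<open>hyperharmonicD\<close> holds because
  intervals are themselves mean sets.\<close>

lemma hyperharmonicI:
  assumes v: "nonneg_on {0<..<1} v" "lsc_on unit_interval {0<..<1} v"
    and c: "\<And>a x b. 0 < a \<Longrightarrow> a < x \<Longrightarrow> x < b \<Longrightarrow> b < 1 \<Longrightarrow>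
      ereal (wl a b x) * v a + ereal (wr a b x) * v b \<le> v x"
  shows "hyperharmonic unit_interval S {0<..<1} v"
  unfolding hyperharmonic_def
proof (intro conjI ballI impI v)
  fix \<omega> x assume "\<omega> \<in> mean_sets S" "x \<in> \<omega>"
  then obtain a b where ab: "0 < a" "a < x" "x < b" "b < 1" "{a, b} \<subseteq> unit_interval frontier_of \<omega>"
     and m: "harmonic_measure S \<omega> x = two_point a b (wl a b x) (wr a b x)"
    using mean_set_measure by blast
  have "ext_integral (harmonic_measure S \<omega> x) (unit_interval frontier_of \<omega>) v
      = ereal (wl a b x) * v a + ereal (wr a b x) * v b"
    unfolding m using ab v weights_nonneg[OF ab(2,3)] frontier_of_unit_interval_subset
    by (intro ext_integral_two_point') auto
  then show "ext_integral (harmonic_measure S \<omega> x) (unit_interval frontier_of \<omega>) v \<le> v x"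
    using c ab by simp
qed

lemma hyperharmonicD:
  assumes v: "nonneg_on {0<..<1} v" "hyperharmonic unit_interval S {0<..<1} v"
    and ab: "0 < a" "a < x" "x < b" "b < 1"
  shows "ereal (wl a b x) * v a + ereal (wr a b x) * v b \<le> v x"
proof -
  have lt: "a < b" using ab by simp
  have "ext_integral (harmonic_measure S {a<..<b} x) (unit_interval frontier_of {a<..<b}) v \<le> v x"
    using v(2) interval_mean_set[OF ab(1) lt ab(4)] interval_in_unit_interval[OF ab(1) lt ab(4)] ab
    by (auto simp: hyperharmonic_def)
  then show ?thesis
    using ab v weights_nonneg[OF ab(2,3)] frontier_of_unit_interval_subset[of "{a<..<b}"]
    by (simp add: interval_measure ext_integral_two_point' interval_in_unit_interval[OF ab(1) lt ab(4)])
qed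

lemma hyperharmonic_concave:
  assumes "concave_unit p" "\<And>x. 0 < x \<Longrightarrow> x < 1 \<Longrightarrow> 0 \<le> p x"
  shows "hyperharmonic unit_interval S {0<..<1} (\<lambda>x. ereal (p x))"
  using assms lsc_on_continuous[OF concave_unit_continuous[OF assms(1)]]
  by (intro hyperharmonicI) (auto simp: nonneg_on_def concave_unit_def)

lemma superharmonic_concave:
  assumes "concave_unit p" "\<And>x. 0 < x \<Longrightarrow> x < 1 \<Longrightarrow> 0 \<le> p x"
  shows "superharmonic unit_interval S {0<..<1} (\<lambda>x. ereal (p x))"
proof -
  have "{x \<in> {0<..<1}. ereal (p x) \<noteq> \<infinity>} = {0<..<1}" by auto
  then show ?thesis
    using hyperharmonic_concave[OF assms] closure_of_subset[of "{0<..<1}" unit_interval]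
    by (simp only: superharmonic_def topspace_euclidean_subtopology subset_refl simp_thms)
qed

text \<open>A single value \<infinity> spreads: any other point lies in an interval having
  \<open>c\<close> as an end, and the mean value inequality gives \<open>c\<close> a positive
  weight. Then \<open>v\<close> would be infinite everywhere, against finiteness on a dense
  set.\<close>

lemma superharmonicE:
  assumes v: "nonneg_on {0<..<1} v" "superharmonic unit_interval S {0<..<1} v"
  obtains p where "concave_unit p" "\<And>x. 0 < x \<Longrightarrow> x < 1 \<Longrightarrow> v x = ereal (p x)"
    "\<And>x. 0 < x \<Longrightarrow> x < 1 \<Longrightarrow> 0 \<le> p x"
proof -
  have hyp: "hyperharmonic unit_interval S {0<..<1} v"
    using v(2) by (simp add: superharmonic_def)
  note D = hyperharmonicD[OF v(1) hyp]
  have nn: "0 \<le> v x" if "0 < x" "x < 1" for x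
    using v(1) that by (simp add: nonneg_on_def)
  have fin: "v c \<noteq> \<infinity>" if c: "0 < c" "c < 1" for c
  proof
    assume inf: "v c = \<infinity>"
    have "v x = \<infinity>" if x: "0 < x" "x < 1" for x
    proof -
      consider "x < c" | "x = c" | "c < x" by linarith
      then show ?thesis
      proof cases
        case 1
        have "ereal (wl (x/2) c x) * v (x/2) + ereal (wr (x/2) c x) * v c \<le> v x"
          using 1 c x by (intro D) auto
        moreover have "0 < wr (x/2) c x" "0 < wl (x/2) c x"
          using weights_nonneg[of "x/2" x c] 1 x by auto
        moreover have "0 \<le> v (x/2)" using x by (intro nn) auto
        ultimately show ?thesis by (simp add: inf)
      next
        case 3
        let ?b = "(x + 1) / 2"
        have "ereal (wl c ?b x) * v c + ereal (wr c ?b x) * v ?b \<le> v x"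
          using 3 c x by (intro D) auto
        moreover have "0 < wr c ?b x" "0 < wl c ?b x"
          using weights_nonneg[of c x ?b] 3 x by auto
        moreover have "0 \<le> v ?b" using x by (intro nn) auto
        ultimately show ?thesis by (simp add: inf)
      qed (simp add: inf)
    qed
    then have "{x \<in> {0<..<1}. v x \<noteq> \<infinity>} = {}" by auto
    then have "{0<..<1::real} \<subseteq> unit_interval closure_of {}"
      using v(2) by (metis superharmonic_def)
    then show False by simp
  qed
  define p where "p x = real_of_ereal (v x)" for x
  have vp: "v x = ereal (p x)" if "0 < x" "x < 1" for x
    using nn[OF that] fin[OF that] by (cases "v x") (auto simp: p_def)
  have "0 \<le> p x" if "0 < x" "x < 1" for x
    using nn[OF that] vp[OF that] by simp
  moreover have "concave_unit p"
    unfolding concave_unit_def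
  proof (intro allI impI, elim conjE)
    fix a x b :: real assume ab: "0 < a" "a < x" "x < b" "b < 1"
    then show "wl a b x * p a + wr a b x * p b \<le> p x"
      using D[OF ab] by (simp add: vp)
  qed
  ultimately show ?thesis
    using that vp by blast
qed

text \<open>\<open>chord_cut a b p\<close> belongs to the class defining the infimum and lies below
  all its members. The hypothesis on \<open>E\<close> covers the complement of the closed interval,
  as in the counterexample, and that of the open interval, as for completely determining
  domains.\<close>

lemma swept_concave:
  assumes p: "concave_unit p" "\<And>x. 0 < x \<Longrightarrow> x < 1 \<Longrightarrow> 0 \<le> p x"
    and v: "\<And>x. 0 < x \<Longrightarrow> x < 1 \<Longrightarrow> v x = ereal (p x)"
    and ab: "0 < a" "a < b" "b < 1"
    and E: "{0<..<1} - {a..b} \<subseteq> E" "E \<subseteq> {0<..<1} - {a<..<b}"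
    and x: "0 < x" "x < 1"
  shows "swept unit_interval S E v x = ereal (chord_cut a b p x)"
proof -
  let ?q = "chord_cut a b p"
  define W where "W = {w. hyperharmonic unit_interval S {0<..<1} w \<and> nonneg_on {0<..<1} w \<and> (\<forall>y\<in>E. v y \<le> w y)}"
  have q: "concave_unit ?q" "\<And>x. 0 < x \<Longrightarrow> x < 1 \<Longrightarrow> 0 \<le> ?q x"
    using concave_unit_chord_cut[OF p(1) ab] chord_cut_nonneg[OF ab(2,1,3) p(2)] by auto
  have cont: "isCont p y" if "0 < y" "y < 1" for y
    using concave_unit_continuous[OF p(1)] that by (simp add: continuous_on_eq_continuous_at)
  have outside: "?q y = p y" "0 < y" "y < 1" if "y \<in> E" for y
    using E(2) that by (auto simp: chord_cut_def)
  have lower: "ereal (?q y) \<le> w y" if w: "w \<in> W" and y: "0 < y" "y < 1" for w y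
  proof (cases "y \<in> E")
    case True
    then show ?thesis using w outside v by (auto simp: W_def)
  next
    case False
    then have yab: "a \<le> y" "y \<le> b" using E(1) y by auto
    have nn: "0 \<le> w y" using w y by (auto simp: W_def nonneg_on_def)
    show ?thesis
    proof (cases "w y")
      case (real r)
      have q_chord: "?q y = wl a b y * p a + wr a b y * p b"
        using yab ab by (auto simp: chord_cut_def)
      \<comment> \<open>The ends \<open>a\<close> and \<open>b\<close> may be missing from
        \<open>E\<close>, so \<open>w\<close> is compared with \<open>p\<close> at
        \<open>a - e\<close> and \<open>b + e\<close>; continuity of \<open>p\<close> allows
        \<open>e\<close> to tend to 0.\<close>
      have ev: "\<forall>\<^sub>F e in at_right (0::real). 0 < e \<and> e < a \<and> e < 1 - b"
        using ab by (auto simp: eventually_at_right_field intro!: exI[of _ "min a (1 - b)"])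
      have "\<forall>\<^sub>F e in at_right 0. wl (a - e) (b + e) y * p (a - e) + wr (a - e) (b + e) y * p (b + e) \<le> r"
        using ev
      proof eventually_elim
        case (elim e)
        have mean: "ereal (wl (a - e) (b + e) y) * w (a - e) + ereal (wr (a - e) (b + e) y) * w (b + e) \<le> w y"
          using w elim yab ab by (intro hyperharmonicD) (auto simp: W_def)
        have w_ge: "ereal (p (a - e)) \<le> w (a - e)" "ereal (p (b + e)) \<le> w (b + e)"
        proof -
          have "a - e \<in> E" "b + e \<in> E"
            using elim ab by (auto intro!: subsetD[OF E(1)])
          then show "ereal (p (a - e)) \<le> w (a - e)" "ereal (p (b + e)) \<le> w (b + e)"
            using w v outside by (auto simp: W_def)
        qed
        have "0 \<le> wl (a - e) (b + e) y" "0 \<le> wr (a - e) (b + e) y"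
          using weights_nonneg[of "a - e" y "b + e"] elim yab by auto
        then have "ereal (wl (a - e) (b + e) y) * ereal (p (a - e)) + ereal (wr (a - e) (b + e) y) * ereal (p (b + e))
            \<le> ereal (wl (a - e) (b + e) y) * w (a - e) + ereal (wr (a - e) (b + e) y) * w (b + e)"
          using w_ge by (intro add_mono ereal_mult_left_mono) auto
        also note mean
        finally have "ereal (wl (a - e) (b + e) y) * ereal (p (a - e)) + ereal (wr (a - e) (b + e) y) * ereal (p (b + e)) \<le> ereal r"
          using real by simp
        then show ?case by simp
      qed
      moreover have "((\<lambda>e. wl (a - e) (b + e) y * p (a - e) + wr (a - e) (b + e) y * p (b + e)) \<longlongrightarrow>
          wl (a - 0) (b + 0) y * p (a - 0) + wr (a - 0) (b + 0) y * p (b + 0)) (at_right 0)"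
      proof -
        have "((\<lambda>e. p (a - e)) \<longlongrightarrow> p (a - 0)) (at_right 0)" "((\<lambda>e. p (b + e)) \<longlongrightarrow> p (b + 0)) (at_right 0)"
          using ab by (intro isCont_tendsto_compose[where g=p] cont tendsto_intros; simp)+
        then show ?thesis
          unfolding wl_def wr_def using ab by (intro tendsto_intros) auto
      qed
      ultimately have "wl (a - 0) (b + 0) y * p (a - 0) + wr (a - 0) (b + 0) y * p (b + 0) \<le> r"
        by (intro tendsto_upperbound) auto
      then show ?thesis by (simp add: real q_chord)
    qed (use nn in auto)
  qed
  have mem: "(\<lambda>x. ereal (?q x)) \<in> W"
    using hyperharmonic_concave[OF q] q(2) v outside by (auto simp: W_def nonneg_on_def)
  have "(INF w\<in>W. w y) = ereal (?q y)" if "y \<in> {0<..<1}" for y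
  proof (rule antisym)
    show "(INF w\<in>W. w y) \<le> ereal (?q y)"
      using mem by (rule INF_lower)
    show "ereal (?q y) \<le> (INF w\<in>W. w y)"
      using lower that by (intro INF_greatest) auto
  qed
  then have "lsc_regularization unit_interval (\<lambda>x. INF w\<in>W. w x) x = ereal (?q x)"
    using x by (intro lsc_regularization_continuous concave_unit_continuous q) auto
  then show ?thesis
    by (simp add: swept_def W_def)
qed

lemma potentialE:
  assumes "potential unit_interval S v"
  obtains p where "concave_unit p" "\<And>x. 0 < x \<Longrightarrow> x < 1 \<Longrightarrow> v x = ereal (p x)"
    "\<And>x. 0 < x \<Longrightarrow> x < 1 \<Longrightarrow> 0 \<le> p x"
    "\<forall>c d. (\<forall>x. 0 < x \<and> x < 1 \<longrightarrow> 0 \<le> c + d * x \<and> c + d * x \<le> p x) \<longrightarrow> (\<forall>x. 0 < x \<and> x < 1 \<longrightarrow> c + d * x = 0)"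
proof -
  have v: "nonneg_on {0<..<1} v" "superharmonic unit_interval S {0<..<1} v"
    and m: "\<forall>h\<in>harmonic S {0<..<1}. (\<forall>x\<in>{0<..<1}. 0 \<le> h x \<and> ereal (h x) \<le> v x) \<longrightarrow> (\<forall>x\<in>{0<..<1}. h x = 0)"
    using assms by (auto simp: potential_def)
  obtain p where p: "concave_unit p" "\<And>x. 0 < x \<Longrightarrow> x < 1 \<Longrightarrow> v x = ereal (p x)"
    "\<And>x. 0 < x \<Longrightarrow> x < 1 \<Longrightarrow> 0 \<le> p x"
    by (rule superharmonicE[OF v]) blast
  have "c + d * x = 0" if b: "\<forall>x. 0 < x \<and> x < 1 \<longrightarrow> 0 \<le> c + d * x \<and> c + d * x \<le> p x"
    and x: "0 < x" "x < 1" for c d x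
  proof -
    have "(\<lambda>x. c + d * x) \<in> harmonic S {0<..<1}"
      by (rule affine_harmonic) (auto simp: openin_unit_interval)
    with m have "(\<forall>x\<in>{0<..<1}. 0 \<le> c + d * x \<and> ereal (c + d * x) \<le> v x) \<longrightarrow> (\<forall>x\<in>{0<..<1}. c + d * x = 0)"
      by (rule bspec)
    then show ?thesis using b p(2) x by simp
  qed
  then show ?thesis
    using that[OF p] by blast
qed

text \<open>A potential that is harmonic in the interval is affine there and continuous at the ends,
  so it is its own chord and \<open>chord_cut\<close> does not change it.\<close>

lemma completely_determining_interval:
  assumes ab: "0 < a" "a < b" "b < 1"
  shows "completely_determining unit_interval S {a<..<b}"
proof -
  have "v x = swept unit_interval S ({0<..<1} - {a<..<b}) v x"
    if v: "potential unit_interval S v" "harmonic_in S v {a<..<b}" and x: "0 < x" "x < 1" for v x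
  proof -
    obtain p where p: "concave_unit p" "\<And>x. 0 < x \<Longrightarrow> x < 1 \<Longrightarrow> v x = ereal (p x)"
      "\<And>x. 0 < x \<Longrightarrow> x < 1 \<Longrightarrow> 0 \<le> p x"
      by (rule potentialE[OF v(1)]) blast
    obtain u where u: "u \<in> harmonic S {a<..<b}" "\<forall>x\<in>{a<..<b}. v x = ereal (u x)"
      using v(2) by (auto simp: harmonic_in_def)
    obtain c d where cd: "\<forall>x\<in>{a<..<b}. u x = c + d * x"
      using harmonic_affine[OF interval_in_unit_interval(1)[OF ab] u(1) subset_refl] by blast
    have affine: "\<forall>x\<in>{a<..<b}. p x = c + d * x"
      using u(2) cd p(2) ab by auto
    have "isCont p z" if "z = a \<or> z = b" for z
      using concave_unit_continuous[OF p(1)] ab that by (auto simp: continuous_on_eq_continuous_at)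
    then have tends: "(p \<longlongrightarrow> p z) (at z within {a<..<b})" if "z = a \<or> z = b" for z
      using that unfolding isCont_def by (blast intro: tendsto_within_subset)
    have ends: "c + d * z = p z" if z: "z = a \<or> z = b" for z
      by (rule limit_at_interval_end[OF tends[OF z] subset_refl ab(2) z affine]) simp
    have "p y = chord_cut a b p y" if "0 < y" "y < 1" for y
      using weights_affine[OF ab(2), of y c d] ends[of a] ends[of b] affine by (auto simp: chord_cut_def)
    moreover have "{0<..<1} - {a..b} \<subseteq> {0<..<1} - {a<..<b}"
      by auto
    ultimately show ?thesis
      using swept_concave[OF p(1,3,2) ab _ subset_refl x] p(2) x by simp
  qed
  then show ?thesis
    using interval_in_unit_interval[OF ab] ab
    by (auto simp: completely_determining_def connectedin_subtopology)
qed

lemma completely_determiningE: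
  assumes "completely_determining unit_interval S \<omega>" "x \<in> \<omega>"
  obtains a b where "0 < a" "a < x" "x < b" "b < 1" "\<omega> = {a<..<b}"
proof -
  have "openin unit_interval \<omega>" "relatively_compact unit_interval \<omega>" "connectedin unit_interval \<omega>"
    using assms(1) by (auto simp: completely_determining_def)
  from connected_relatively_compact_unit_interval[OF this assms(2)] that show ?thesis
    by blast
qed

lemma completely_determining_basis_unit_interval: "completely_determining_basis unit_interval S"
  unfolding completely_determining_basis_def
proof (intro allI impI)
  fix U x assume "openin unit_interval U \<and> x \<in> U"
  then obtain a b where "0 < a" "a < x" "x < b" "b < 1" "{a..b} \<subseteq> U"
    using interval_inside_open by metis
  then show "\<exists>\<omega>. completely_determining unit_interval S \<omega> \<and> x \<in> \<omega> \<and> \<omega> \<subseteq> U"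
    using completely_determining_interval[of a b] by (intro exI[of _ "{a<..<b}"]) auto
qed

end

section \<open>The Green kernel of the unit interval\<close>

text \<open>The Green function of - u'' on the unit interval with zero boundary values and pole
  \<open>y\<close>. As a minimum of two affine functions it is visibly concave.\<close>

definition green :: "real \<Rightarrow> real \<Rightarrow> real" where
  "green y x = min (x * (1 - y)) (y * (1 - x))"

lemma green_eq: "x \<le> y \<Longrightarrow> green y x = x * (1 - y)" "y \<le> x \<Longrightarrow> green y x = y * (1 - x)"
  by (auto simp: green_def algebra_simps)

lemma concave_unit_green: "concave_unit (green y)"
proof -
  have "concave_unit (\<lambda>x. min (0 + (1 - y) * x) (y + (- y) * x))"
    by (intro concave_unit_min concave_unit_affine)
  moreover have "green y = (\<lambda>x. min (0 + (1 - y) * x) (y + (- y) * x))"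
    by (auto simp: green_def fun_eq_iff algebra_simps)
  ultimately show ?thesis by simp
qed

lemma green_nonneg: "0 < y \<Longrightarrow> y < 1 \<Longrightarrow> 0 < x \<Longrightarrow> x < 1 \<Longrightarrow> 0 \<le> green y x"
  by (simp add: green_def)

lemma green_le: "0 < y \<Longrightarrow> y < 1 \<Longrightarrow> 0 < x \<Longrightarrow> x < 1 \<Longrightarrow> green y x \<le> x \<and> green y x \<le> 1 - x"
  by (auto simp: green_def min_le_iff_disj mult_left_le mult_left_le_one_le)

context affine_structure
begin

lemma green_potential_green:
  assumes y: "0 < y" "y < 1"
  shows "green_potential unit_interval S y (\<lambda>x. ereal (green y x))"
proof -
  have zero: "h x = 0" if h: "h \<in> harmonic S {0<..<1}"
    and b: "\<forall>x\<in>{0<..<1}. 0 \<le> h x \<and> h x \<le> green y x" and x: "0 < x" "x < 1" for h x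
  proof -
    obtain c d where cd: "\<forall>x\<in>{0<..<1}. h x = c + d * x"
      using harmonic_affine[of "{0<..<1}" h 0 1] h by (auto simp: openin_unit_interval)
    have "0 \<le> c + d * x \<and> c + d * x \<le> x \<and> c + d * x \<le> 1 - x" if "0 < x" "x < 1" for x
    proof -
      have "h x = c + d * x" "0 \<le> h x" "h x \<le> green y x"
        using b cd that by auto
      with green_le[OF y that] show ?thesis by linarith
    qed
    then have "c = 0" "d = 0"
      by (rule affine_minorant_zero; blast)+
    then show ?thesis using cd x by simp
  qed
  have pot: "potential unit_interval S (\<lambda>x. ereal (green y x))"
    using superharmonic_concave[OF concave_unit_green green_nonneg[OF y]] zero green_nonneg[OF y]
    by (auto simp: potential_def nonneg_on_def)
  have left: "openin unit_interval {0<..<y} \<and> {0<..<y} \<noteq> {} \<and> harmonic_in S (\<lambda>x. ereal (green y x)) {0<..<y}"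
    using y affine_harmonic[of "{0<..<y}" "\<lambda>x. 0 + (1 - y) * x" 0 "1 - y"]
    by (auto simp: greaterThanLessThan_subseteq_greaterThanLessThan openin_unit_interval harmonic_in_def green_eq mult.commute intro!: bexI[of _ "\<lambda>x. 0 + (1 - y) * x"])
  have right: "openin unit_interval {y<..<1} \<and> {y<..<1} \<noteq> {} \<and> harmonic_in S (\<lambda>x. ereal (green y x)) {y<..<1}"
    using y affine_harmonic[of "{y<..<1}" "\<lambda>x. y + (- y) * x" y "- y"]
    by (auto simp: greaterThanLessThan_subseteq_greaterThanLessThan openin_unit_interval harmonic_in_def green_eq algebra_simps intro!: bexI[of _ "\<lambda>x. y + (- y) * x"])
  have kink: False if V: "openin unit_interval V" "y \<in> V" "harmonic_in S (\<lambda>x. ereal (green y x)) V" for V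
  proof -
    obtain a b where ab: "0 < a" "a < y" "y < b" "b < 1" "{a..b} \<subseteq> V"
      by (rule interval_inside_open[OF V(1,2)])
    obtain u where u: "u \<in> harmonic S V" "\<forall>x\<in>V. green y x = u x"
      using V(3) by (auto simp: harmonic_in_def)
    have "{a<..<b} \<subseteq> V"
      using ab(5) by (rule subset_trans[rotated]) auto
    then obtain c d where "\<forall>x\<in>{a<..<b}. u x = c + d * x" "{a<..<b} \<subseteq> V"
      using harmonic_affine[OF V(1) u(1)] by blast
    then have cd: "green y x = c + d * x" if "a < x" "x < b" for x
      using u(2) that by auto
    \<comment> \<open>The slope of \<open>green y\<close> drops by 1 at \<open>y\<close>, so its
      symmetric second difference with step \<open>t\<close> is - t, while that of an affine
      function is 0.\<close>
    define t where "t = min (y - a) (b - y) / 2"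
    have t: "0 < t" "a < y - t" "y + t < b"
      using ab by (auto simp: t_def min_def field_simps)
    have "green y (y - t) + green y (y + t) = 2 * green y y"
      using t ab cd[of "y - t"] cd[of "y + t"] cd[of y] by (simp add: algebra_simps)
    moreover have "green y (y - t) + green y (y + t) = 2 * green y y - t"
      using t by (simp add: green_eq algebra_simps)
    ultimately show False using t by simp
  qed
  have "harmonic_support unit_interval S (\<lambda>x. ereal (green y x)) = {y}"
    unfolding harmonic_support_def
  proof (intro set_eqI iffI)
    fix x assume x: "x \<in> topspace unit_interval - \<Union>{V. openin unit_interval V \<and> V \<noteq> {} \<and> harmonic_in S (\<lambda>x. ereal (green y x)) V}"
    then have "x \<notin> {0<..<y}" "x \<notin> {y<..<1}"
      using left right by blast+
    then show "x \<in> {y}" using x by auto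
  next
    fix x assume "x \<in> {y}"
    then show "x \<in> topspace unit_interval - \<Union>{V. openin unit_interval V \<and> V \<noteq> {} \<and> harmonic_in S (\<lambda>x. ereal (green y x)) V}"
      using kink y by auto
  qed
  then show ?thesis
    using pot by (simp add: green_potential_def)
qed

text \<open>The potential is affine on each side of the pole. Once its limits at 0 and 1 vanish,
  continuity at \<open>y\<close> leaves one free parameter; the limits vanish because a potential
  has no positive affine minorant.\<close>

lemma green_potentialE:
  assumes v: "green_potential unit_interval S y v" and y: "0 < y" "y < 1"
  obtains k where "0 < k" "\<And>x. 0 < x \<Longrightarrow> x < 1 \<Longrightarrow> v x = ereal (k * green y x)"
proof -
  have pot: "potential unit_interval S v" and supp: "harmonic_support unit_interval S v = {y}"
    using v by (auto simp: green_potential_def)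
  obtain p where p: "concave_unit p" "\<And>x. 0 < x \<Longrightarrow> x < 1 \<Longrightarrow> v x = ereal (p x)"
    "\<And>x. 0 < x \<Longrightarrow> x < 1 \<Longrightarrow> 0 \<le> p x"
    and minorant: "\<forall>c d. (\<forall>x. 0 < x \<and> x < 1 \<longrightarrow> 0 \<le> c + d * x \<and> c + d * x \<le> p x) \<longrightarrow> (\<forall>x. 0 < x \<and> x < 1 \<longrightarrow> c + d * x = 0)"
    by (rule potentialE[OF pot]) blast
  have loc: "\<exists>a b c d. a < x \<and> x < b \<and> (\<forall>z\<in>{a<..<b}. p z = c + d * z)" if x: "0 < x" "x < 1" "x \<noteq> y" for x
  proof -
    have "x \<notin> harmonic_support unit_interval S v" using x supp by simp
    then obtain V where V: "openin unit_interval V" "x \<in> V" "harmonic_in S v V"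
      using x by (auto simp: harmonic_support_def)
    obtain a b where ab: "0 < a" "a < x" "x < b" "b < 1" "{a..b} \<subseteq> V"
      by (rule interval_inside_open[OF V(1,2)])
    obtain u where u: "u \<in> harmonic S V" "\<forall>x\<in>V. v x = ereal (u x)"
      using V(3) by (auto simp: harmonic_in_def)
    have sub: "{a<..<b} \<subseteq> V"
      using ab(5) by (rule subset_trans[rotated]) auto
    then obtain c d where cd: "\<forall>x\<in>{a<..<b}. u x = c + d * x"
      using harmonic_affine[OF V(1) u(1)] by blast
    have "p z = c + d * z" if z: "z \<in> {a<..<b}" for z
    proof -
      have "v z = ereal (u z)" using u(2) sub z by blast
      moreover have "v z = ereal (p z)" using z ab by (intro p(2)) auto
      ultimately show ?thesis using cd z by simp
    qed
    then show ?thesis using ab by blast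
  qed
  obtain c d where l: "\<forall>x\<in>{0<..<y}. p x = c + d * x"
    using locally_affine_on_interval[of 0 y p] loc y by fastforce
  obtain c' d' where r: "\<forall>x\<in>{y<..<1}. p x = c' + d' * x"
    using locally_affine_on_interval[of y 1 p] loc y by fastforce
  have "isCont p y"
    using concave_unit_continuous[OF p(1)] y by (simp add: continuous_on_eq_continuous_at)
  then have tends: "(p \<longlongrightarrow> p y) (at y within A)" for A
    unfolding isCont_def by (rule tendsto_within_subset) simp
  have pyl: "c + d * y = p y"
    by (rule limit_at_interval_end[OF tends subset_refl y(1) disjI2[OF refl] l]) simp
  have pyr: "c' + d' * y = p y"
    by (rule limit_at_interval_end[OF tends subset_refl y(2) disjI1[OF refl] r]) simp
  have "0 \<le> c"
  proof (rule tendsto_lowerbound[of "\<lambda>x. c + d * x" _ "at_right 0"])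
    show "((\<lambda>x. c + d * x) \<longlongrightarrow> c) (at_right 0)"
      by (auto intro!: tendsto_eq_intros)
    have "\<forall>\<^sub>F x in at_right 0. 0 < x \<and> x < y"
      using y by (auto simp: eventually_at_right_field)
    then show "\<forall>\<^sub>F x in at_right 0. 0 \<le> c + d * x"
    proof eventually_elim
      case (elim x)
      then show ?case using l p(3)[of x] y by auto
    qed
  qed simp
  have "0 \<le> c' + d' * 1"
  proof (rule tendsto_lowerbound[of "\<lambda>x. c' + d' * x" _ "at_left 1"])
    show "((\<lambda>x. c' + d' * x) \<longlongrightarrow> c' + d' * 1) (at_left 1)"
      by (intro tendsto_intros)
    have "\<forall>\<^sub>F x in at_left 1. y < x \<and> x < 1"
      using y by (auto simp: eventually_at_left_field)
    then show "\<forall>\<^sub>F x in at_left 1. 0 \<le> c' + d' * x"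
    proof eventually_elim
      case (elim x)
      then show ?case using r p(3)[of x] y by auto
    qed
  qed simp
  \<comment> \<open>Concavity tested across the pole: the right branch lies below the continuation
    of the left one.\<close>
  have slope: "0 \<le> d - d'"
  proof -
    define a b where "a = y / 2" and "b = (y + 1) / 2"
    have ab: "0 < a" "a < y" "y < b" "b < 1" using y by (auto simp: a_def b_def)
    have "wl a b y * p a + wr a b y * p b \<le> p y"
      using ab by (intro concave_unitD[OF p(1)])
    moreover have "p a = c + d * a" and "p b = c' + d' * b"
      using l r ab by auto
    moreover have "c' + d' * b = (c + d * b) - (d - d') * (b - y)"
      using pyl pyr by (simp add: algebra_simps)
    ultimately have "wl a b y * (c + d * a) + wr a b y * ((c + d * b) - (d - d') * (b - y)) \<le> c + d * y"
      using pyl by (simp only:)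
    then have "wl a b y * (c + d * a) + (wr a b y * (c + d * b) - wr a b y * ((d - d') * (b - y))) \<le> c + d * y"
      by (simp only: right_diff_distrib[of "wr a b y" "c + d * b"])
    then have "0 \<le> wr a b y * ((d - d') * (b - y))"
      using weights_affine[of a b y c d] ab by simp
    then show ?thesis
      using weights_nonneg(2)[OF ab(2,3)] ab by (simp add: zero_le_mult_iff)
  qed
  have cc': "c' - c = (d - d') * y"
    using pyl pyr by (simp add: algebra_simps)
  have eqs: "c = 0 \<and> c' + d' = 0"
  proof -
    \<comment> \<open>The line joining the boundary values \<open>c\<close> at 0 and
      \<open>c' + d'\<close> at 1. By the sign of the slope change at \<open>y\<close> it lies below
      \<open>p\<close>, so it must vanish.\<close>
    let ?h = "\<lambda>x. c + (c' + d' - c) * x"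
    have h: "0 \<le> ?h x \<and> ?h x \<le> p x" if x: "0 < x" "x < 1" for x
    proof
      have "?h x = c * (1 - x) + (c' + d') * x" by (simp add: algebra_simps)
      then show "0 \<le> ?h x" using \<open>0 \<le> c\<close> \<open>0 \<le> c' + d' * 1\<close> x by simp
      show "?h x \<le> p x"
      proof (cases "x \<le> y")
        case True
        have "p x = c + d * x"
          using True l pyl x by (cases "x = y") auto
        moreover have "c + d * x - ?h x = (d - d' - (c' - c)) * x"
          by (simp add: algebra_simps)
        moreover have "(d - d' - (c' - c)) * x = (d - d') * (1 - y) * x"
          unfolding cc' by (simp add: algebra_simps)
        moreover have "0 \<le> (d - d') * (1 - y) * x"
          using slope x y by simp
        ultimately show ?thesis by linarith
      next
        case False
        then have "p x = c' + d' * x" using r x by auto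
        moreover have "c' + d' * x - ?h x = (c' - c) * (1 - x)"
          by (simp add: algebra_simps)
        moreover have "0 \<le> (c' - c) * (1 - x)"
          unfolding cc' using slope x y by simp
        ultimately show ?thesis by linarith
      qed
    qed
    have "\<forall>x. 0 < x \<and> x < 1 \<longrightarrow> ?h x = 0"
      by (rule minorant[THEN spec, THEN spec, THEN mp]) (use h in blast)
    from this[THEN spec, of "1/3"] this[THEN spec, of "2/3"]
    have z: "?h (1/3) = 0" "?h (2/3) = 0" by simp_all
    then have "c = 0" by linarith
    moreover from this have "c' + d' = 0" using z(1) by simp
    ultimately show ?thesis ..
  qed
  define k where "k = d / (1 - y)"
  have kd: "k * (1 - y) = d" using y by (simp add: k_def)
  have d': "d' = - c'" using eqs by linarith
  have c'y: "c' * (1 - y) = d * y"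
    using pyl pyr eqs unfolding d' by (simp add: algebra_simps)
  have pk: "p x = k * green y x" if x: "0 < x" "x < 1" for x
  proof (cases "x \<le> y")
    case True
    then have "p x = d * x"
      using l pyl eqs x by (cases "x = y") auto
    then have "p x = k * (1 - y) * x"
      by (simp only: kd)
    then show ?thesis
      using True by (simp add: green_eq mult_ac)
  next
    case False
    then have "p x = c' + d' * x"
      using r x by auto
    then have "p x = c' * (1 - x)"
      unfolding d' by (simp add: algebra_simps)
    moreover have "c' = k * y"
      using c'y y by (simp add: k_def field_simps)
    ultimately show ?thesis
      using False by (simp add: green_eq)
  qed
  have "0 < y * (1 - y)" "0 \<le> k * (y * (1 - y))"
    using pk[OF y] p(3)[OF y] y by (simp_all add: green_eq)
  then have "0 \<le> k"
    by (simp only: zero_le_mult_iff) linarith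
  moreover have "k \<noteq> 0"
  proof
    assume "k = 0"
    then have "harmonic_in S v {0<..<1}"
      using affine_harmonic[of "{0<..<1}" "\<lambda>x. 0 + 0 * x" 0 0] pk p(2)
      by (auto simp: harmonic_in_def openin_unit_interval)
    then have "y \<notin> harmonic_support unit_interval S v"
      using y by (auto simp: harmonic_support_def openin_unit_interval)
    then show False using supp by simp
  qed
  ultimately show ?thesis
    using that[of k] pk p(2) by simp
qed

lemma proportionality_unit_interval: "proportionality unit_interval S"
  unfolding proportionality_def
proof (intro ballI allI impI, elim conjE)
  fix y p q assume y: "y \<in> topspace unit_interval"
    and pq: "green_potential unit_interval S y p" "green_potential unit_interval S y q"
  have y': "0 < y" "y < 1" using y by auto
  obtain k where k: "0 < k" "\<And>x. 0 < x \<Longrightarrow> x < 1 \<Longrightarrow> p x = ereal (k * green y x)"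
    by (rule green_potentialE[OF pq(1) y']) blast
  obtain l where l: "0 < l" "\<And>x. 0 < x \<Longrightarrow> x < 1 \<Longrightarrow> q x = ereal (l * green y x)"
    by (rule green_potentialE[OF pq(2) y']) blast
  show "\<exists>c>0. \<forall>x\<in>topspace unit_interval. q x = ereal c * p x"
    using k l by (intro exI[of _ "l / k"]) auto
qed

lemma green_family_green: "green_family unit_interval S (\<lambda>y x. ereal (green y x))"
proof -
  have "continuous_map (prod_topology unit_interval unit_interval) euclideanreal fst"
    "continuous_map (prod_topology unit_interval unit_interval) euclideanreal snd"
    using continuous_map_fst continuous_map_snd continuous_map_in_subtopology by blast+
  then have "continuous_map (prod_topology unit_interval unit_interval) euclideanreal (\<lambda>z. green (snd z) (fst z))"
    unfolding green_def by (intro continuous_map_real_min continuous_map_real_mult continuous_map_diff) auto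
  moreover have "continuous_map euclideanreal euclidean ereal"
    by (auto intro: continuous_on_ereal)
  ultimately have "continuous_map (prod_topology unit_interval unit_interval) euclidean
      (ereal \<circ> (\<lambda>z. green (snd z) (fst z)))"
    by (rule continuous_map_compose)
  then have "continuous_map (subtopology (prod_topology unit_interval unit_interval) {(x, y). x \<noteq> y}) euclidean
      (\<lambda>(x, y). ereal (green y x))"
    by (simp add: continuous_map_from_subtopology comp_def case_prod_beta)
  then show ?thesis
    using green_potential_green by (simp add: green_family_def)
qed

end

subsection \<open>The standing assumptions\<close>

lemma affine_in_harmonic1:
  assumes "openin unit_interval U" "\<And>x. x \<in> U \<Longrightarrow> u x = c + d * x"
  shows "u \<in> harmonic1 cubic_pairs U"
  unfolding harmonic1_def using assms
  by (intro CollectI cubic_pair_on_imp_cubic_pairs cubic_pair_onI[of _ _ c d 0 0])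
    (auto simp: openin_unit_interval)

lemma harmonic1_affine:
  assumes "u \<in> harmonic1 cubic_pairs U" "{a<..<b} \<subseteq> U"
  shows "\<exists>c d. \<forall>x\<in>{a<..<b}. u x = c + d * x"
  using assms by (intro affine_on_interval cubic_pairs_on_interval) (auto simp: harmonic1_def)

text \<open>Second components of cubic pairs are locally affine. Conversely, integrating an affine
  function twice, with a sign, gives a cubic first component that completes it to a pair.\<close>

lemma harmonic2_cubic_pairs:
  assumes U: "openin unit_interval U"
  shows "harmonic2 unit_interval cubic_pairs U = harmonic1 cubic_pairs U"
proof (intro set_eqI iffI)
  fix u assume u: "u \<in> harmonic2 unit_interval cubic_pairs U"
  have "\<exists>W. open W \<and> x \<in> W \<and> W \<subseteq> U \<and> cubic_pair_on W u (\<lambda>x. 0)" if x: "x \<in> U" for x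
  proof -
    obtain V u1 where V: "x \<in> V" "V \<subseteq> U" "(u1, u) \<in> cubic_pairs V"
      using u x by (auto simp: harmonic2_def)
    then obtain W where W: "open W" "x \<in> W" "W \<subseteq> V" "cubic_pair_on W u1 u"
      by (auto simp: cubic_pairs_def)
    obtain a b c d where "\<forall>y\<in>W. u1 y = a + b * y + c * y^2 + d * y^3"
      and u2: "\<forall>y\<in>W. u y = - (2 * c + 6 * d * y)"
      by (rule cubic_pair_onE[OF W(4)])
    have "cubic_pair_on W u (\<lambda>x. 0)"
      using u2 by (intro cubic_pair_onI[of _ _ "- 2 * c" "- 6 * d" 0 0]) auto
    then show ?thesis using W V by blast
  qed
  then show "u \<in> harmonic1 cubic_pairs U"
    by (simp add: harmonic1_def cubic_pairs_def)
next
  fix u assume u: "u \<in> harmonic1 cubic_pairs U"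
  have "\<exists>V. openin unit_interval V \<and> x \<in> V \<and> V \<subseteq> U \<and> (\<exists>u1. (u1, u) \<in> cubic_pairs V)" if x: "x \<in> U" for x
  proof -
    obtain a b where ab: "0 < a" "a < x" "x < b" "b < 1" "{a..b} \<subseteq> U"
      by (rule interval_inside_open[OF U x])
    have sub: "{a<..<b} \<subseteq> U"
      using ab(5) by (rule subset_trans[rotated]) auto
    obtain c d where cd: "\<forall>x\<in>{a<..<b}. u x = c + d * x"
      using harmonic1_affine[OF u sub] by blast
    have "cubic_pair_on {a<..<b} (\<lambda>x. - c / 2 * x^2 - d / 6 * x^3) u"
      using cd by (intro cubic_pair_onI[of _ _ 0 0 "- c / 2" "- d / 6"]) auto
    then have "(\<lambda>x. - c / 2 * x^2 - d / 6 * x^3, u) \<in> cubic_pairs {a<..<b}"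
      by (intro cubic_pair_on_imp_cubic_pairs) auto
    moreover have "openin unit_interval {a<..<b}"
      using ab by (intro interval_in_unit_interval) auto
    ultimately show ?thesis
      using sub ab by (intro exI[of _ "{a<..<b}"]) auto
  qed
  then show "u \<in> harmonic2 unit_interval cubic_pairs U"
    by (simp add: harmonic2_def)
qed

lemma affine_structure_assoc1: "affine_structure (assoc1 unit_interval cubic_pairs)"
proof
  fix \<omega> x assume "\<omega> \<in> mean_sets (assoc1 unit_interval cubic_pairs)" "x \<in> \<omega>"
  then have "regular_set unit_interval cubic_pairs \<omega>" "x \<in> \<omega>"
    by (auto simp: assoc1_def)
  then show "\<exists>a b. 0 < a \<and> a < x \<and> x < b \<and> b < 1 \<and> {a, b} \<subseteq> unit_interval frontier_of \<omega> \<and>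
      harmonic_measure (assoc1 unit_interval cubic_pairs) \<omega> x = two_point a b (wl a b x) (wr a b x)"
    by (rule riquier_measures_regular) (auto simp: assoc1_def)
qed (auto simp: assoc1_def riquier_measures_interval regular_interval
    intro: affine_in_harmonic1 harmonic1_affine)

lemma affine_structure_assoc2: "affine_structure (assoc2 unit_interval cubic_pairs)"
proof
  fix \<omega> x assume "\<omega> \<in> mean_sets (assoc2 unit_interval cubic_pairs)" "x \<in> \<omega>"
  then have "regular_set unit_interval cubic_pairs \<omega>" "x \<in> \<omega>"
    by (auto simp: assoc2_def)
  then show "\<exists>a b. 0 < a \<and> a < x \<and> x < b \<and> b < 1 \<and> {a, b} \<subseteq> unit_interval frontier_of \<omega> \<and>
      harmonic_measure (assoc2 unit_interval cubic_pairs) \<omega> x = two_point a b (wl a b x) (wr a b x)"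
    by (rule riquier_measures_regular) (auto simp: assoc2_def)
qed (auto simp: assoc2_def riquier_measures_interval regular_interval harmonic2_cubic_pairs
    intro: affine_in_harmonic1 harmonic1_affine)

section \<open>Adjoint harmonic measures and adjoint structures\<close>

text \<open>For fixed \<open>x\<close> outside the open interval, \<open>green y x\<close> is affine
  in the pole \<open>y\<close> between \<open>a\<close> and \<open>b\<close>, so averaging over the
  poles \<open>a\<close> and \<open>b\<close> reproduces it. For \<open>x\<close> inside, the claim
  is a rational identity.\<close>

lemma chord_cut_green:
  assumes ab: "a < b" and y: "a < y" "y < b"
  shows "chord_cut a b (green y) x = wl a b y * green a x + wr a b y * green b x"
proof -
  consider "x \<le> a" | "a < x" "x < b" | "b \<le> x" by linarith
  then show ?thesis
  proof cases
    case 1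
    then have "chord_cut a b (green y) x = x + (- x) * y"
      using y by (simp add: chord_cut_def green_eq algebra_simps)
    also have "\<dots> = wl a b y * (x + (- x) * a) + wr a b y * (x + (- x) * b)"
      by (rule weights_affine[OF ab, symmetric])
    finally show ?thesis
      using 1 ab by (simp add: green_eq algebra_simps)
  next
    case 2
    have "chord_cut a b (green y) x = wl a b x * (a * (1 - y)) + wr a b x * (y * (1 - b))"
      using 2 y by (simp add: chord_cut_def green_eq)
    also have "\<dots> = wl a b y * (a * (1 - x)) + wr a b y * (x * (1 - b))"
      unfolding wl_def wr_def using ab by (simp add: divide_simps) (simp add: algebra_simps)
    finally show ?thesis
      using 2 by (simp add: green_eq)
  next
    case 3
    then have "chord_cut a b (green y) x = 0 + (1 - x) * y"
      using y by (simp add: chord_cut_def green_eq algebra_simps)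
    also have "\<dots> = wl a b y * (0 + (1 - x) * a) + wr a b y * (0 + (1 - x) * b)"
      by (rule weights_affine[OF ab, symmetric])
    finally show ?thesis
      using 3 ab by (simp add: green_eq algebra_simps)
  qed
qed

lemma radon_measure_on_pair:
  assumes \<sigma>: "radon_measure_on unit_interval {a, b} \<sigma>" and ab: "0 < a" "a < b" "b < 1"
  obtains \<alpha> \<beta> where "0 \<le> \<alpha>" "0 \<le> \<beta>" "\<sigma> = two_point a b \<alpha> \<beta>"
proof -
  have s: "sets \<sigma> = sets (borel_of unit_interval)" "emeasure \<sigma> ({0<..<1} - {a, b}) = 0"
    using \<sigma> by (auto simp: radon_measure_on_def radon_measure_def)
  have "emeasure \<sigma> C < \<infinity>" if "compact C" "C \<subseteq> {0<..<1}" for C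
    using \<sigma> that by (simp add: radon_measure_on_def radon_measure_def compactin_unit_interval)
  from this[of "{a}"] this[of "{b}"] have "emeasure \<sigma> {a} < \<infinity>" "emeasure \<sigma> {b} < \<infinity>"
    using ab by auto
  then have "\<sigma> = two_point a b (measure \<sigma> {a}) (measure \<sigma> {b})"
    using ab s by (intro two_point_unique_carrier) (auto simp: emeasure_eq_ennreal_measure less_top[symmetric])
  then show ?thesis
    by (rule that[rotated 2]) simp_all
qed

context affine_structure
begin

text \<open>Sweeping the Green potential with pole \<open>y\<close> splits it into those with poles
  \<open>a\<close> and \<open>b\<close>, with the ordinary harmonic weights. Uniqueness needs only
  the evaluations at \<open>a\<close> and \<open>b\<close>.\<close>

lemma adjoint_measure_green:
  assumes ab: "0 < a" "a < y" "y < b" "b < 1"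
  shows "adjoint_measure unit_interval S (\<lambda>y x. ereal (green y x)) {a<..<b} y = two_point a b (wl a b y) (wr a b y)"
proof -
  have lt: "a < b" and y: "0 < y" "y < 1" using ab by auto
  note w = weights_nonneg(1,2)[OF ab(2,3), THEN less_imp_le]
  note iv = interval_in_unit_interval[OF ab(1) lt ab(4)]
  have "{0<..<1} - {a..b} \<subseteq> {0<..<1} - {a<..<b}" by auto
  then have swept: "swept unit_interval S ({0<..<1} - {a<..<b}) (\<lambda>x. ereal (green y x)) x
      = ereal (wl a b y * green a x + wr a b y * green b x)" if "0 < x" "x < 1" for x
    using swept_concave[OF concave_unit_green green_nonneg[OF y] refl ab(1) lt ab(4) _ subset_refl that]
      chord_cut_green[OF lt ab(2,3)] by simp
  have int: "ext_integral (two_point a b \<alpha> \<beta>) {a, b} (\<lambda>z. ereal (green z x))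
      = ereal (\<alpha> * green a x + \<beta> * green b x)" if "0 \<le> \<alpha>" "0 \<le> \<beta>" "0 < x" "x < 1" for \<alpha> \<beta> x
    using that ab lt green_nonneg[of _ x]
    by (subst ext_integral_two_point') (auto simp: nonneg_on_def)
  show ?thesis
    unfolding adjoint_measure_def iv(4) topspace_euclidean_subtopology
  proof (rule the_equality)
    show "radon_measure_on unit_interval {a, b} (two_point a b (wl a b y) (wr a b y)) \<and>
      (\<forall>x\<in>{0<..<1}. swept unit_interval S ({0<..<1} - {a<..<b}) (\<lambda>x. ereal (green y x)) x =
        ext_integral (two_point a b (wl a b y) (wr a b y)) {a, b} (\<lambda>z. ereal (green z x)))"
      using radon_measure_on_two_point[OF ab(1) lt ab(4) w subset_refl] w by (simp add: swept int)
  next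
    fix \<sigma> assume \<sigma>: "radon_measure_on unit_interval {a, b} \<sigma> \<and>
      (\<forall>x\<in>{0<..<1}. swept unit_interval S ({0<..<1} - {a<..<b}) (\<lambda>x. ereal (green y x)) x =
        ext_integral \<sigma> {a, b} (\<lambda>z. ereal (green z x)))"
    obtain \<alpha> \<beta> where w': "0 \<le> \<alpha>" "0 \<le> \<beta>" and eq: "\<sigma> = two_point a b \<alpha> \<beta>"
      using \<sigma> ab lt by (elim conjE radon_measure_on_pair) auto
    have rep: "wl a b y * green a x + wr a b y * green b x = \<alpha> * green a x + \<beta> * green b x"
      if "0 < x" "x < 1" for x
      using \<sigma> that w' by (simp add: eq swept int)
    \<comment> \<open>After the factors \<open>a\<close> and \<open>1 - b\<close> are cancelled, the
      two evaluations say that the two measures have the same total mass and the same first moment,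
      which determines two masses at distinct points.\<close>
    have "(\<alpha> - wl a b y) * (a * (1 - a)) + (\<beta> - wr a b y) * (a * (1 - b)) = 0"
      using rep[of a] ab lt by (simp add: green_eq algebra_simps)
    then have "a * ((\<alpha> - wl a b y) * (1 - a) + (\<beta> - wr a b y) * (1 - b)) = 0"
      by (simp add: algebra_simps)
    then have 1: "(\<alpha> - wl a b y) * (1 - a) + (\<beta> - wr a b y) * (1 - b) = 0"
      using ab by simp
    have "(\<alpha> - wl a b y) * (a * (1 - b)) + (\<beta> - wr a b y) * (b * (1 - b)) = 0"
      using rep[of b] ab lt by (simp add: green_eq algebra_simps)
    then have "(1 - b) * ((\<alpha> - wl a b y) * a + (\<beta> - wr a b y) * b) = 0"
      by (simp add: algebra_simps)
    then have 2: "(\<alpha> - wl a b y) * a + (\<beta> - wr a b y) * b = 0"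
      using ab by simp
    have 3: "(\<alpha> - wl a b y) + (\<beta> - wr a b y) = 0"
      using 1 2 by (simp add: algebra_simps)
    then have "\<beta> - wr a b y = - (\<alpha> - wl a b y)" by simp
    with 2 have "(\<alpha> - wl a b y) * (a - b) = 0"
      by (simp add: algebra_simps)
    then have "\<alpha> = wl a b y" using lt by simp
    with 3 show "\<sigma> = two_point a b (wl a b y) (wr a b y)"
      by (simp add: eq)
  qed
qed

text \<open>Completely determining domains are intervals, and their adjoint measures equal the
  harmonic ones. Hence the locale can be instantiated again, and proportionality of adjoint Green's
  potentials is its earlier result applied to the adjoint.\<close>

lemma affine_structure_adjoint:
  "affine_structure (adjoint_structure unit_interval S (\<lambda>y x. ereal (green y x)))"
  (is "affine_structure ?A")
proof
  have mean: "(LINT z:unit_interval frontier_of \<omega>|adjoint_measure unit_interval S (\<lambda>y x. ereal (green y x)) \<omega> y. u z)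
      = wl a b y * u a + wr a b y * u b"
    if "0 < a" "a < y" "y < b" "b < 1" "\<omega> = {a<..<b}" for a b y \<omega> and u :: "real \<Rightarrow> real"
  proof -
    have "(LINT z:{a, b}|two_point a b (wl a b y) (wr a b y). u z) = wl a b y * u a + wr a b y * u b"
      using that weights_nonneg[of a y b]
      by (intro set_integral_two_point) (auto intro: continuous_on_finite)
    then show ?thesis
      using that by (simp add: adjoint_measure_green interval_in_unit_interval)
  qed
  {
    fix U and u :: "real \<Rightarrow> real" and c d
    assume U: "openin unit_interval U" and u: "\<And>x. x \<in> U \<Longrightarrow> u x = c + d * x"
    have "continuous_on U (\<lambda>x. c + d * x)"
      by (intro continuous_intros)
    then have "cont_on unit_interval U u"
      using U u by (simp add: cont_on_unit_interval openin_unit_interval cong: continuous_on_cong)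
    moreover have "u y = (LINT z:unit_interval frontier_of \<omega>|adjoint_measure unit_interval S (\<lambda>y x. ereal (green y x)) \<omega> y. u z)"
      if \<omega>: "completely_determining unit_interval S \<omega>" "unit_interval closure_of \<omega> \<subseteq> U" "y \<in> \<omega>" for \<omega> y
    proof -
      obtain a b where ab: "0 < a" "a < y" "y < b" "b < 1" "\<omega> = {a<..<b}"
        by (rule completely_determiningE[OF \<omega>(1,3)])
      have "{a..b} \<subseteq> U"
        using \<omega>(2) ab interval_in_unit_interval[of a b] by simp
      then have "u a = c + d * a" "u b = c + d * b" "u y = c + d * y"
        using ab by (auto intro!: u)
      then show ?thesis
        using mean[OF ab] weights_affine[of a b y c d] ab by simp
    qed
    ultimately show "u \<in> harmonic ?A U"
      by (simp add: adjoint_structure_def)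
  }
  {
    fix U u and a b :: real
    assume U: "openin unit_interval U" and u: "u \<in> harmonic ?A U" and sub: "{a<..<b} \<subseteq> U"
    show "\<exists>c d. \<forall>x\<in>{a<..<b}. u x = c + d * x"
    proof (rule locally_affine_on_interval)
      fix x assume x: "x \<in> {a<..<b}"
      have "openin unit_interval {a<..<b}"
        using U sub by (auto simp: openin_unit_interval)
      then obtain p q where pq: "0 < p" "p < x" "x < q" "q < 1" "{p..q} \<subseteq> {a<..<b}"
        by (rule interval_inside_open[OF _ x])
      have "u y = (q * u p - p * u q) / (q - p) + (u q - u p) / (q - p) * y" if y: "y \<in> {p<..<q}" for y
      proof -
        have "unit_interval closure_of {p<..<q} \<subseteq> U"
          using pq sub interval_in_unit_interval[of p q] by (auto intro: subset_trans)
        then have "u y = (LINT z:unit_interval frontier_of {p<..<q}|adjoint_measure unit_interval S (\<lambda>y x. ereal (green y x)) {p<..<q} y. u z)"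
          using u y pq completely_determining_interval[of p q] by (simp add: adjoint_structure_def)
        also have "\<dots> = wl p q y * u p + wr p q y * u q"
          using y pq by (intro mean) auto
        finally show ?thesis
          by (simp add: wl_def wr_def diff_divide_distrib add_divide_distrib algebra_simps)
      qed
      then show "\<exists>a b c d. a < x \<and> x < b \<and> (\<forall>y\<in>{a<..<b}. u y = c + d * y)"
        using pq by blast
    qed
  }
  {
    fix a b :: real assume "0 < a" "a < b" "b < 1"
    then show "{a<..<b} \<in> mean_sets ?A"
      by (simp add: adjoint_structure_def completely_determining_interval)
  }
  {
    fix a x b :: real assume "0 < a" "a < x" "x < b" "b < 1"
    then show "harmonic_measure ?A {a<..<b} x = two_point a b (wl a b x) (wr a b x)"
      by (simp add: adjoint_structure_def adjoint_measure_green)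
  }
  {
    fix \<omega> x assume "\<omega> \<in> mean_sets ?A" "x \<in> \<omega>"
    then have \<omega>: "completely_determining unit_interval S \<omega>" "x \<in> \<omega>"
      by (simp_all add: adjoint_structure_def)
    obtain a b where ab: "0 < a" "a < x" "x < b" "b < 1" "\<omega> = {a<..<b}"
      by (rule completely_determiningE[OF \<omega>])
    then show "\<exists>a b. 0 < a \<and> a < x \<and> x < b \<and> b < 1 \<and> {a, b} \<subseteq> unit_interval frontier_of \<omega> \<and>
        harmonic_measure ?A \<omega> x = two_point a b (wl a b x) (wr a b x)"
      by (intro exI[of _ a] exI[of _ b]) (simp add: adjoint_structure_def adjoint_measure_green interval_in_unit_interval)
  }
qed

lemma adjoint_proportionality_unit_interval: "adjoint_proportionality unit_interval S"
  unfolding adjoint_proportionality_def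
  using green_family_green affine_structure.proportionality_unit_interval[OF affine_structure_adjoint]
  by blast

end

section \<open>Hyperharmonic pairs on the unit interval and the separation axiom\<close>

lemma nonneg_hyperharmonic_pairI:
  assumes nn: "nonneg_on {0<..<1} v1" "nonneg_on {0<..<1} v2"
    and lsc: "lsc_on unit_interval {0<..<1} v1" "lsc_on unit_interval {0<..<1} v2"
    and c: "\<And>a x b. 0 < a \<Longrightarrow> a < x \<Longrightarrow> x < b \<Longrightarrow> b < 1 \<Longrightarrow>
      (ereal (wl a b x) * v1 a + ereal (wr a b x) * v1 b) + (ereal (nl a b x) * v2 a + ereal (nr a b x) * v2 b) \<le> v1 x"
      "\<And>a x b. 0 < a \<Longrightarrow> a < x \<Longrightarrow> x < b \<Longrightarrow> b < 1 \<Longrightarrow>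
      ereal (wl a b x) * v2 a + ereal (wr a b x) * v2 b \<le> v2 x"
  shows "nonneg_hyperharmonic_pair unit_interval cubic_pairs v1 v2"
proof -
  have "ext_integral (mu_measure unit_interval cubic_pairs \<omega> x) (unit_interval frontier_of \<omega>) v1
      + ext_integral (nu_measure unit_interval cubic_pairs \<omega> x) (unit_interval frontier_of \<omega>) v2 \<le> v1 x \<and>
      ext_integral (lambda_measure unit_interval cubic_pairs \<omega> x) (unit_interval frontier_of \<omega>) v2 \<le> v2 x"
    if \<omega>: "regular_set unit_interval cubic_pairs \<omega>" "x \<in> \<omega>" for \<omega> x
  proof -
    obtain a b where ab: "0 < a" "a < x" "x < b" "b < 1" "{a<..<b} \<subseteq> \<omega>" "{a, b} \<subseteq> unit_interval frontier_of \<omega>"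
      "mu_measure unit_interval cubic_pairs \<omega> x = two_point a b (wl a b x) (wr a b x)"
      "nu_measure unit_interval cubic_pairs \<omega> x = two_point a b (nl a b x) (nr a b x)"
      "lambda_measure unit_interval cubic_pairs \<omega> x = two_point a b (wl a b x) (wr a b x)"
      by (rule riquier_measures_regular[OF \<omega>])
    have lt: "a < b" using ab by simp
    note w = weights_nonneg[OF ab(2,3), THEN less_imp_le]
    note E = ext_integral_two_point'[OF ab(1) lt ab(4) _ _ ab(6) frontier_of_unit_interval_subset]
    show ?thesis
      unfolding ab(7-9) E[OF w(1,2) nn(1)] E[OF w(1,2) nn(2)] E[OF w(3,4) nn(2)]
      using c[OF ab(1-4)] by blast
  qed
  then show ?thesis
    using nn lsc by (simp add: nonneg_hyperharmonic_pair_def hyperharmonic_pair_def)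
qed

lemma nonneg_hyperharmonic_pairD:
  assumes v: "nonneg_hyperharmonic_pair unit_interval cubic_pairs v1 v2"
    and ab: "0 < a" "a < x" "x < b" "b < 1"
  shows "(ereal (wl a b x) * v1 a + ereal (wr a b x) * v1 b) + (ereal (nl a b x) * v2 a + ereal (nr a b x) * v2 b) \<le> v1 x"
proof -
  have lt: "a < b" using ab by simp
  have nn: "nonneg_on {0<..<1} v1" "nonneg_on {0<..<1} v2"
    using v by (auto simp: nonneg_hyperharmonic_pair_def)
  note iv = interval_in_unit_interval[OF ab(1) lt ab(4)]
  note w = weights_nonneg[OF ab(2,3), THEN less_imp_le]
  have sub: "{a, b} \<subseteq> {0<..<1}" using ab by auto
  note E = ext_integral_two_point'[OF ab(1) lt ab(4) _ _ subset_refl sub]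
  have "ext_integral (mu_measure unit_interval cubic_pairs {a<..<b} x) {a, b} v1
      + ext_integral (nu_measure unit_interval cubic_pairs {a<..<b} x) {a, b} v2 \<le> v1 x"
  proof -
    have "\<forall>\<omega> x. regular_set unit_interval cubic_pairs \<omega> \<and> unit_interval closure_of \<omega> \<subseteq> {0<..<1} \<and> x \<in> \<omega> \<longrightarrow>
        ext_integral (mu_measure unit_interval cubic_pairs \<omega> x) (unit_interval frontier_of \<omega>) v1
        + ext_integral (nu_measure unit_interval cubic_pairs \<omega> x) (unit_interval frontier_of \<omega>) v2 \<le> v1 x"
      using v by (simp add: nonneg_hyperharmonic_pair_def hyperharmonic_pair_def)
    from this[THEN spec, THEN spec, of "{a<..<b}" x] show ?thesis
      using regular_interval[OF ab(1) lt ab(4)] ab unfolding iv by auto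
  qed
  then show ?thesis
    using ab by (simp add: riquier_measures_interval E[OF w(1,2) nn(1)] E[OF w(3,4) nn(2)])
qed

lemma nonneg_hyperharmonic_pair_real:
  assumes p: "concave_unit p" "\<And>x. 0 < x \<Longrightarrow> x < 1 \<Longrightarrow> 0 \<le> p x"
  shows "nonneg_hyperharmonic_pair unit_interval cubic_pairs (\<lambda>x. ereal (p x)) (\<lambda>x. 0)"
  using affine_structure.hyperharmonic_concave[OF affine_structure_assoc1 p] p(2)
  by (intro hyperharmonic_assoc1_imp_pair) (auto simp: nonneg_on_def)

lemma nonneg_hyperharmonic_pair_infinity:
  assumes p: "concave_unit p" "\<And>x. 0 < x \<Longrightarrow> x < 1 \<Longrightarrow> 0 \<le> p x"
  shows "nonneg_hyperharmonic_pair unit_interval cubic_pairs (\<lambda>x. \<infinity>) (\<lambda>x. ereal (p x))"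
proof (rule nonneg_hyperharmonic_pairI)
  have "{x::real. 0 < x \<and> x < 1} = {0<..<1}" by auto
  then show "lsc_on unit_interval {0<..<1} (\<lambda>x. \<infinity>)"
    by (simp add: lsc_on_def subtopology_subtopology)
  show "lsc_on unit_interval {0<..<1} (\<lambda>x. ereal (p x))"
    using p by (intro lsc_on_continuous concave_unit_continuous)
qed (use p in \<open>auto simp: nonneg_on_def concave_unitD\<close>)

text \<open>The constants and the identity separate the points linearly; as second components they are
  completed by the first component \<open>\<infinity>\<close>.\<close>

lemma separation_cubic_pairs: "separation_axiom unit_interval cubic_pairs"
  unfolding separation_axiom_def
proof (intro ballI allI impI)
  fix x y a :: real
  assume xy: "x \<in> topspace unit_interval" "y \<in> topspace unit_interval" "x \<noteq> y \<and> 0 \<le> a"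
  define p :: "real \<Rightarrow> real" where "p = (if a = 1 then (\<lambda>x. 0 + 1 * x) else (\<lambda>x. 1 + 0 * x))"
  have p: "concave_unit p"
    unfolding p_def by (auto simp only: concave_unit_affine split: if_split)
  have nn: "0 \<le> p x" if "0 < x" "x < 1" for x
    using that by (simp add: p_def)
  have "ereal (p x) \<noteq> ereal a * ereal (p y)"
    using xy by (simp add: p_def)
  then show "(\<exists>v1 v2. nonneg_hyperharmonic_pair unit_interval cubic_pairs v1 v2 \<and> v1 x \<noteq> ereal a * v1 y) \<and>
      (\<exists>v1 v2. nonneg_hyperharmonic_pair unit_interval cubic_pairs v1 v2 \<and> v2 x \<noteq> ereal a * v2 y)"
    using nonneg_hyperharmonic_pair_real[OF p nn] nonneg_hyperharmonic_pair_infinity[OF p nn] by blast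
qed

lemma biharmonic_space_cubic_pairs: "biharmonic_space unit_interval cubic_pairs"
proof -
  have "Hausdorff_space unit_interval"
    by (intro Hausdorff_space_subtopology) simp
  moreover have "locally_compact_space unit_interval"
    by (intro locally_compact_space_open_subset disjI1) (auto simp: locally_compact_space_euclidean)
  moreover have "connected_space unit_interval"
    by (simp add: connected_space_subtopology)
  moreover have "second_countable (euclidean :: real topology)"
    unfolding second_countable_def
    using ex_countable_basis[where 'a=real] by (meson open_openin topological_basis_def topological_basisE topological_basis_open)
  then have "second_countable unit_interval"
    by (rule second_countable_subtopology)
  ultimately show ?thesis
    by (simp add: biharmonic_space_def presheaf_cubic_pairs sheaf_cubic_pairs base_cubic_pairs
        convergence_cubic_pairs separation_cubic_pairs)
qed

section \<open>The parabola as a continuous potential pair\<close>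

definition parabola :: "real \<Rightarrow> real" where
  "parabola x = x * (1 - x)"

lemma parabola_bounds:
  assumes "0 < x" "x < 1"
  shows "0 < parabola x" "parabola x \<le> x" "parabola x \<le> 1 - x" "parabola x \<le> 1/4"
proof -
  show "0 < parabola x" "parabola x \<le> x" "parabola x \<le> 1 - x"
    using assms by (auto simp: parabola_def mult_left_le mult_left_le_one_le)
  have "1/4 - parabola x = (x - 1/2)^2"
    by (simp add: parabola_def power2_eq_square algebra_simps)
  then show "parabola x \<le> 1/4"
    using zero_le_power2[of "x - 1/2"] by linarith
qed

lemma continuous_on_parabola: "continuous_on A parabola"
  unfolding parabola_def by (intro continuous_intros)

lemma weights_parabola:
  assumes "a < b"
  shows "wl a b x * parabola a + wr a b x * parabola b = parabola x - (x - a) * (b - x)"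
  using assms by (simp add: wl_def wr_def parabola_def divide_simps) (simp add: algebra_simps)

text \<open>The sum \<open>nl + nr\<close> solves - n'' = 1 with zero values at \<open>a\<close> and
  \<open>b\<close>; it is the total mass of the measure \<nu>.\<close>

lemma green_weights_sum: "a < b \<Longrightarrow> nl a b x + nr a b x = (x - a) * (b - x) / 2"
  by (simp add: nl_def nr_def divide_simps) (simp add: algebra_simps)

text \<open>The parabola exceeds its chord by (x - a) (b - x), whereas its \<nu>-integral is at most
  (x - a) (b - x) / 8, because the parabola is bounded by 1/4.\<close>

lemma nonneg_hyperharmonic_pair_parabola:
  "nonneg_hyperharmonic_pair unit_interval cubic_pairs (\<lambda>x. ereal (parabola x)) (\<lambda>x. ereal (parabola x))"
proof (rule nonneg_hyperharmonic_pairI)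
  fix a x b :: real assume ab: "0 < a" "a < x" "x < b" "b < 1"
  have pos: "0 < (x - a) * (b - x)" using ab by simp
  note eq = weights_parabola[of a b x]
  have "nl a b x * parabola a + nr a b x * parabola b \<le> nl a b x * (1/4) + nr a b x * (1/4)"
    using weights_nonneg[OF ab(2,3)] ab by (intro add_mono mult_left_mono parabola_bounds) auto
  also have "\<dots> = (nl a b x + nr a b x) / 4" by simp
  also have "\<dots> \<le> (x - a) * (b - x)"
    using pos ab by (simp add: green_weights_sum)
  finally show "ereal (wl a b x) * ereal (parabola a) + ereal (wr a b x) * ereal (parabola b) +
      (ereal (nl a b x) * ereal (parabola a) + ereal (nr a b x) * ereal (parabola b)) \<le> ereal (parabola x)"
    using eq ab by simp
  show "ereal (wl a b x) * ereal (parabola a) + ereal (wr a b x) * ereal (parabola b) \<le> ereal (parabola x)"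
    using eq pos ab by simp
qed (use parabola_bounds in \<open>auto simp: nonneg_on_def less_imp_le intro!: lsc_on_continuous continuous_on_parabola\<close>)

text \<open>For a biharmonic minorant the second component is affine and below both x and 1 - x,
  hence 0. This makes the first component affine, and the same argument applies to it.\<close>

lemma continuous_potential_pair_parabola:
  "continuous_potential_pair unit_interval cubic_pairs parabola parabola"
proof -
  have "{x \<in> {0<..<1}. ereal (parabola x) \<noteq> \<infinity>} = {0<..<1}" by auto
  then have dense: "{0<..<1} \<subseteq> unit_interval closure_of {x \<in> {0<..<1}. ereal (parabola x) \<noteq> \<infinity>}"
    using closure_of_subset[of "{0<..<1}" unit_interval] by simp
  have zero: "h1 x = 0 \<and> h2 x = 0"
    if h: "(h1, h2) \<in> cubic_pairs {0<..<1}" and x: "0 < x" "x < 1"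
      and b: "\<And>x. 0 < x \<Longrightarrow> x < 1 \<Longrightarrow> 0 \<le> h1 x \<and> h1 x \<le> parabola x \<and> 0 \<le> h2 x \<and> h2 x \<le> parabola x"
    for h1 h2 x
  proof -
    have "cubic_pair_on {0<..<1} h1 h2"
      using h by (rule cubic_pairs_on_interval) simp
    then obtain a b c d where h1: "\<forall>y\<in>{0<..<1}. h1 y = a + b * y + c * y^2 + d * y^3"
      and h2: "\<forall>y\<in>{0<..<1}. h2 y = - (2 * c + 6 * d * y)"
      by (rule cubic_pair_onE)
    have "0 \<le> - 2 * c + - 6 * d * y \<and> - 2 * c + - 6 * d * y \<le> y \<and> - 2 * c + - 6 * d * y \<le> 1 - y"
      if "0 < y" "y < 1" for y
      using b[OF that] parabola_bounds[OF that] h2 that by auto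
    then have "- 2 * c = 0" "- 6 * d = 0"
      by (rule affine_minorant_zero; blast)+
    then have cd: "c = 0" "d = 0" by simp_all
    have "0 \<le> a + b * y \<and> a + b * y \<le> y \<and> a + b * y \<le> 1 - y"
      if "0 < y" "y < 1" for y
      using \<open>\<And>x. 0 < x \<Longrightarrow> x < 1 \<Longrightarrow> 0 \<le> h1 x \<and> h1 x \<le> parabola x \<and> 0 \<le> h2 x \<and> h2 x \<le> parabola x\<close>[OF that]
        parabola_bounds[OF that] h1 cd that by auto
    then have "a = 0" "b = 0"
      by (rule affine_minorant_zero; blast)+
    then show ?thesis
      using h1 h2 cd x by simp
  qed
  show ?thesis
    using nonneg_hyperharmonic_pair_parabola dense zero
    by (auto simp: continuous_potential_pair_def potential_pair_def superharmonic_pair_def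
        nonneg_hyperharmonic_pair_def cont_on_unit_interval continuous_on_parabola)
qed

lemma strong_cubic_pairs: "strong unit_interval cubic_pairs"
proof -
  have "potential_pair unit_interval cubic_pairs (\<lambda>x. ereal (parabola x)) (\<lambda>x. ereal (parabola x))"
    using continuous_potential_pair_parabola by (simp add: continuous_potential_pair_def)
  moreover have "\<forall>x\<in>topspace unit_interval. 0 < ereal (parabola x) \<and> 0 < ereal (parabola x)"
    using parabola_bounds(1) by simp
  ultimately show ?thesis
    unfolding strong_def by blast
qed

lemma standing_assumptions_cubic_pairs: "standing_assumptions unit_interval cubic_pairs"
  using biharmonic_space_cubic_pairs elliptic_cubic_pairs strong_cubic_pairs
    affine_structure.proportionality_unit_interval[OF affine_structure_assoc1]
    affine_structure.proportionality_unit_interval[OF affine_structure_assoc2]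
    affine_structure.adjoint_proportionality_unit_interval[OF affine_structure_assoc1]
    affine_structure.adjoint_proportionality_unit_interval[OF affine_structure_assoc2]
    affine_structure.completely_determining_basis_unit_interval[OF affine_structure_assoc1]
    affine_structure.completely_determining_basis_unit_interval[OF affine_structure_assoc2]
  by (simp add: standing_assumptions_def)

lemma associated_spaces_coincide_cubic_pairs: "associated_spaces_coincide unit_interval cubic_pairs"
  by (simp add: associated_spaces_coincide_def harmonic2_cubic_pairs)

subsection \<open>The counterexample\<close>

text \<open>The set is the union of the open sets on which the infimum of \<open>f\<close> exceeds
  \<open>c\<close>. It makes swept functions Borel measurable, as splitting their integrals
  requires.\<close>

lemma openin_lsc_regularization:
  "openin X {x \<in> topspace X. c < lsc_regularization X f x}"
proof -
  have "{x \<in> topspace X. c < lsc_regularization X f x} = \<Union>{V. openin X V \<and> c < (INF y\<in>V. f y)}"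
    using openin_subset by (fastforce simp: lsc_regularization_def less_SUP_iff)
  then show ?thesis
    by (metis (no_types, lifting) mem_Collect_eq openin_Union)
qed

lemma openin_sets_borel_of: "openin X U \<Longrightarrow> U \<in> sets (borel_of X)"
  unfolding borel_of_def by (rule in_measure_of) (auto dest: openin_subset)

lemma measurable_lsc_regularization:
  "lsc_regularization X f \<in> borel_measurable (borel_of X)"
proof (rule borel_measurableI_greater)
  fix c
  show "{x \<in> space (borel_of X). c < lsc_regularization X f x} \<in> sets (borel_of X)"
    unfolding space_borel_of by (intro openin_sets_borel_of openin_lsc_regularization)
qed

lemma lsc_regularization_le: "lsc_regularization X f x \<le> f x"
  unfolding lsc_regularization_def by (intro SUP_least) (auto intro: INF_lower)

text \<open>Splits off the atoms in \<open>T\<close>, so that the parts of two measures outside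
  \<open>T\<close> can be compared and cancelled.\<close>

lemma nn_integral_split_finite:
  assumes M: "sets M = sets (borel_of unit_interval)" and T: "finite T" "T \<subseteq> {0<..<1}"
    and F: "F \<in> borel_measurable M"
  shows "(\<integral>\<^sup>+x. F x \<partial>M) = (\<integral>\<^sup>+x. F x \<partial>density M (indicator ({0<..<1} - T))) + (\<Sum>t\<in>T. F t * emeasure M {t})"
proof -
  have sp: "space M = {0<..<1}"
    by (rule space_eq_unit_interval[OF M])
  have TM: "T \<in> sets M" "\<And>t. t \<in> T \<Longrightarrow> {t} \<in> sets M" "{0<..<1} - T \<in> sets M"
    using M T by (auto simp: sets_borel_of_unit_interval borel_closed finite_imp_closed)
  have "(\<integral>\<^sup>+x. F x \<partial>M) = (\<integral>\<^sup>+x. indicator ({0<..<1} - T) x * F x + (\<Sum>t\<in>T. F t * indicator {t} x) \<partial>M)"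
  proof (rule nn_integral_cong)
    fix x assume x: "x \<in> space M"
    have "(\<Sum>t\<in>T. F t * indicator {t} x) = (\<Sum>t\<in>T. if x = t then F t else 0)"
      by (intro sum.cong) (auto simp: indicator_def)
    then show "F x = indicator ({0<..<1} - T) x * F x + (\<Sum>t\<in>T. F t * indicator {t} x)"
      using x T sp by (auto simp: indicator_def)
  qed
  also have "\<dots> = (\<integral>\<^sup>+x. indicator ({0<..<1} - T) x * F x \<partial>M) + (\<integral>\<^sup>+x. (\<Sum>t\<in>T. F t * indicator {t} x) \<partial>M)"
    using F TM by (intro nn_integral_add borel_measurable_sum borel_measurable_times borel_measurable_indicator) auto
  also have "(\<integral>\<^sup>+x. indicator ({0<..<1} - T) x * F x \<partial>M) = (\<integral>\<^sup>+x. F x \<partial>density M (indicator ({0<..<1} - T)))"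
    using F TM by (intro nn_integral_density[symmetric] borel_measurable_indicator) auto
  also have "(\<integral>\<^sup>+x. (\<Sum>t\<in>T. F t * indicator {t} x) \<partial>M) = (\<Sum>t\<in>T. F t * emeasure M {t})"
    using TM by (subst nn_integral_sum) (auto intro!: sum.cong simp: nn_integral_cmult_indicator)
  finally show ?thesis .
qed

definition second_difference :: "real set \<Rightarrow> real" where
  "second_difference B = indicator B (1/4) + indicator B (3/4) - 2 * indicator B (1/2)"

lemma signed_measure_second_difference: "signed_measure_on unit_interval {1/4..3/4} second_difference"
  unfolding signed_measure_on_def
proof (intro conjI allI impI ballI)
  fix A :: "nat \<Rightarrow> real set"
  assume "range A \<subseteq> sets (borel_of unit_interval) \<and> disjoint_family A"
  then have disj: "A i \<inter> A j = {}" if "i \<noteq> j" for i j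
    using that by (auto simp: disjoint_family_on_def)
  have "(\<lambda>n. indicator (A n) x :: real) sums indicator (\<Union>n. A n) x" for x
    by (rule indicator_sums[OF disj])
  then show "(\<lambda>n. second_difference (A n)) sums second_difference (\<Union>n. A n)"
    unfolding second_difference_def by (intro sums_diff sums_add sums_mult)
next
  fix B :: "real set" assume "B \<inter> {1/4..3/4} = {}"
  then have "1/4 \<notin> B" "1/2 \<notin> B" "3/4 \<notin> B" by auto
  then show "second_difference B = 0"
    by (simp add: second_difference_def)
qed

lemma nn_integral_two_point:
  assumes "0 < a" "a < b" "b < 1" "0 \<le> \<alpha>" "0 \<le> \<beta>"
  shows "(\<integral>\<^sup>+x. f x \<partial>two_point a b \<alpha> \<beta>) = f a * ennreal \<alpha> + f b * ennreal \<beta>"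
  using assms two_point_values[OF assms]
  by (subst nn_integral_finite_carrier[of _ "{a, b}"]) auto

lemma one_normal_second_difference: "one_normal unit_interval cubic_pairs {1/4..3/4} second_difference"
proof -
  \<comment> \<open>The mass 2 at 1/2 is written as a \<open>two_point\<close> measure with a second
    atom of mass 0 at 3/4.\<close>
  define \<sigma> \<tau> where "\<sigma> = two_point (1/4) (3/4) 1 1" and "\<tau> = two_point (1/2) (3/4) 2 0"
  have "difference_on unit_interval {1/4..3/4} second_difference \<sigma> \<tau>"
    unfolding difference_on_def \<sigma>_def \<tau>_def
    by (auto intro!: radon_measure_on_two_point
        simp: Sigma_Algebra.measure_def emeasure_two_point second_difference_def simp del: ennreal_plus)
  \<comment> \<open>\<sigma> is the swept measure of both: sweeping leaves the values at 1/4 and 3/4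
    unchanged, and at 1/2 it yields their average.\<close>
  moreover have "swept_measure unit_interval (assoc1 unit_interval cubic_pairs) ({0<..<1} - {1/4..3/4}) \<rho> \<sigma>"
    if \<rho>: "\<rho> = \<sigma> \<or> \<rho> = \<tau>" for \<rho>
    unfolding swept_measure_def
  proof (intro conjI allI impI)
    show "radon_measure unit_interval \<sigma>"
      using radon_measure_on_two_point[of "1/4" "3/4" 1 1 UNIV] by (simp add: \<sigma>_def radon_measure_on_def)
    fix p assume "cont_on unit_interval (topspace unit_interval) p \<and>
      potential unit_interval (assoc1 unit_interval cubic_pairs) (\<lambda>x. ereal (p x))"
    then have "potential unit_interval (assoc1 unit_interval cubic_pairs) (\<lambda>x. ereal (p x))"
      by blast
    then obtain q where q: "concave_unit q" "\<And>x. 0 < x \<Longrightarrow> x < 1 \<Longrightarrow> ereal (p x) = ereal (q x)"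
      "\<And>x. 0 < x \<Longrightarrow> x < 1 \<Longrightarrow> 0 \<le> q x"
      by (rule affine_structure.potentialE[OF affine_structure_assoc1]) blast
    let ?P = "swept unit_interval (assoc1 unit_interval cubic_pairs) ({0<..<1} - {1/4..3/4}) (\<lambda>x. ereal (p x))"
    have E: "{0<..<1} - {1/4..3/4} \<subseteq> {0<..<1} - {1/4<..<3/4::real}" by auto
    have P: "?P x = ereal (chord_cut (1/4) (3/4) q x)" if "0 < x" "x < 1" for x
      by (rule affine_structure.swept_concave[OF affine_structure_assoc1 q(1,3,2) _ _ _ subset_refl E that]) auto
    have "?P (1/4) = ereal (q (1/4))" "?P (3/4) = ereal (q (3/4))" "?P (1/2) = ereal ((q (1/4) + q (3/4)) / 2)"
      by (simp_all add: P chord_cut_def wl_def wr_def add_divide_distrib)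
    moreover have "ennreal ((q (1/4) + q (3/4)) / 2) * 2 = ennreal (q (1/4) + q (3/4))"
    proof -
      have "ennreal (s / 2) * 2 = ennreal s" if "0 \<le> s" for s :: real
        using that ennreal_mult[of "s / 2" 2] by simp
      then show ?thesis
        using q(3)[of "1/4"] q(3)[of "3/4"] by (simp del: ennreal_plus)
    qed
    moreover have "p (1/4) = q (1/4)" "p (3/4) = q (3/4)" "0 \<le> q (1/4)" "0 \<le> q (3/4)"
      using q(2,3) by simp_all
    ultimately show "(\<integral>\<^sup>+x. ennreal (p x) \<partial>\<sigma>) = (\<integral>\<^sup>+x. e2ennreal (?P x) \<partial>\<rho>)"
      using \<rho> by (auto simp: \<sigma>_def \<tau>_def nn_integral_two_point simp flip: ennreal_plus ennreal_mult')
  qed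
  ultimately show ?thesis
    unfolding one_normal_def topspace_euclidean_subtopology by blast
qed

section \<open>Bounds for the swept parabola pair and the refutation\<close>

text \<open>The target is a value above 3/16 at 1/2. The chord of the parabola alone stays below
  3/16; the \<nu>-term coming from the second component makes up the difference.\<close>

lemma swept1_parabola:
  fixes P1
  defines "P1 \<equiv> swept1 unit_interval cubic_pairs ({0<..<1} - {1/4..3/4}) (\<lambda>x. ereal (parabola x)) (\<lambda>x. ereal (parabola x))"
  shows "0 < x \<Longrightarrow> x < 1 \<Longrightarrow> P1 x \<le> ereal (parabola x)" and "ereal (47/250) \<le> P1 (1/2)"
proof -
  let ?C = "sweeping_class unit_interval cubic_pairs ({0<..<1} - {1/4..3/4}) (\<lambda>x. ereal (parabola x)) (\<lambda>x. ereal (parabola x))"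
  define F where "F x = (INF (w1, w2)\<in>?C. w1 x)" for x
  have P1: "P1 = lsc_regularization unit_interval F"
    unfolding P1_def swept1_def F_def ..
  have "((\<lambda>x. ereal (parabola x)), (\<lambda>x. ereal (parabola x))) \<in> ?C"
    using nonneg_hyperharmonic_pair_parabola by (simp add: sweeping_class_def)
  then have "F x \<le> ereal (parabola x)" for x
    unfolding F_def by (rule INF_lower2) simp
  then show "P1 x \<le> ereal (parabola x)"
    unfolding P1 by (rule order_trans[OF lsc_regularization_le])
  have "ereal (47/250) \<le> w1 x" if w: "(w1, w2) \<in> ?C" and x: "49/100 < x" "x < 51/100" for w1 w2 x
  proof -
    \<comment> \<open>Points just outside \<open>K\<close>, where \<open>w1\<close> and
      \<open>w2\<close> are known to dominate the parabola, whose value there is 114/625. For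
      \<open>x\<close> near 1/2 both factors of \<open>z\<close> are at least 1/4, and 114/625 * (1
      + 1/32) exceeds 47/250.\<close>
    let ?a = "6/25 :: real" and ?b = "19/25 :: real"
    have hyp: "nonneg_hyperharmonic_pair unit_interval cubic_pairs w1 w2"
      and ge: "\<forall>y\<in>{0<..<1} - {1/4..3/4}. ereal (parabola y) \<le> w1 y \<and> ereal (parabola y) \<le> w2 y"
      using w by (auto simp: sweeping_class_def)
    have ge_ends: "ereal (114/625) \<le> w1 ?a" "ereal (114/625) \<le> w1 ?b" "ereal (114/625) \<le> w2 ?a" "ereal (114/625) \<le> w2 ?b"
      using ge[THEN bspec, of ?a] ge[THEN bspec, of ?b] by (simp_all add: parabola_def)
    have pos: "0 < wl ?a ?b x" "0 < wr ?a ?b x" "0 < nl ?a ?b x" "0 < nr ?a ?b x"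
      using x by (auto intro!: weights_nonneg)
    define z where "z = (x - ?a) * (?b - x)"
    have "1/4 * (1/4) \<le> z"
      unfolding z_def using x by (intro mult_mono) auto
    moreover have sums: "wl ?a ?b x + wr ?a ?b x = 1" "nl ?a ?b x + nr ?a ?b x = z / 2"
      unfolding z_def by (rule weights_sum, simp) (rule green_weights_sum, simp)
    ultimately have "47/250 \<le> (wl ?a ?b x + wr ?a ?b x) * (114/625) + (nl ?a ?b x + nr ?a ?b x) * (114/625)"
      unfolding sums by simp
    then have "ereal (47/250) \<le> (ereal (wl ?a ?b x) * ereal (114/625) + ereal (wr ?a ?b x) * ereal (114/625))
        + (ereal (nl ?a ?b x) * ereal (114/625) + ereal (nr ?a ?b x) * ereal (114/625))"
      by (simp add: algebra_simps)
    also have "\<dots> \<le> (ereal (wl ?a ?b x) * w1 ?a + ereal (wr ?a ?b x) * w1 ?b)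
        + (ereal (nl ?a ?b x) * w2 ?a + ereal (nr ?a ?b x) * w2 ?b)"
      using pos by (intro add_mono ereal_mult_left_mono ge_ends) auto
    also have "\<dots> \<le> w1 x"
      using x by (intro nonneg_hyperharmonic_pairD[OF hyp]) auto
    finally show ?thesis .
  qed
  then have "ereal (47/250) \<le> F x" if "49/100 < x" "x < 51/100" for x
    unfolding F_def using that by (intro INF_greatest) auto
  \<comment> \<open>The regularization at 1/2 needs a bound on a whole neighbourhood, which is why
    \<open>x\<close> ranges over an interval above.\<close>
  then have "ereal (47/250) \<le> (INF y\<in>{49/100<..<51/100}. F y)"
    by (intro INF_greatest) auto
  also have "\<dots> \<le> P1 (1/2)"
    unfolding P1 lsc_regularization_def
    by (rule SUP_upper) (auto simp: openin_unit_interval)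
  finally show "ereal (47/250) \<le> P1 (1/2)" .
qed

text \<open>Inside \<open>K\<close> the first swept component solves \<open>- P1'' = P2 > 0\<close>, so it is not affine and
  \<open>second_difference\<close> does not annihilate it.\<close>

lemma not_pure_binormal_second_difference:
  "\<not> pure_binormal unit_interval cubic_pairs {1/4..3/4} second_difference"
proof
  let ?E = "{0<..<1} - {1/4..3/4::real}"
  let ?N = "null_measure (borel_of unit_interval)"
  assume "pure_binormal unit_interval cubic_pairs {1/4..3/4} second_difference"
  then obtain \<sigma> \<tau> A1 A2 where d: "difference_on unit_interval {1/4..3/4} second_difference \<sigma> \<tau>"
    and sw: "swept_measure_pair unit_interval cubic_pairs ?E \<sigma> ?N A1 A2"
      "swept_measure_pair unit_interval cubic_pairs ?E \<tau> ?N A1 A2"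
    by (auto simp: pure_binormal_def)
  define P1 where "P1 = swept1 unit_interval cubic_pairs ?E (\<lambda>x. ereal (parabola x)) (\<lambda>x. ereal (parabola x))"
  define F where "F x = e2ennreal (P1 x)" for x
  have eq: "(\<integral>\<^sup>+x. F x \<partial>\<sigma>) = (\<integral>\<^sup>+x. F x \<partial>\<tau>)"
    using sw continuous_potential_pair_parabola
    by (simp add: swept_measure_pair_def F_def P1_def)
  have F_le: "F x \<le> ennreal (parabola x)" if "0 < x" "x < 1" for x
    unfolding F_def P1_def using e2ennreal_mono[OF swept1_parabola(1)[OF that]] by simp
  have meas: "F \<in> borel_measurable (borel_of unit_interval)"
    unfolding F_def P1_def swept1_def
    by (intro measurable_compose[OF measurable_lsc_regularization measurable_e2ennreal])
  have radon: "sets M = sets (borel_of unit_interval) \<and> emeasure M {0<..<1} < \<infinity>"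
    if "radon_measure_on unit_interval {1/4..3/4} M" for M
  proof -
    have sM: "sets M = sets (borel_of unit_interval)" and null: "emeasure M ?E = 0"
      using that by (auto simp: radon_measure_on_def radon_measure_def)
    have K: "compactin unit_interval {1/4..3/4}"
      by (auto simp: compactin_unit_interval)
    have "emeasure M {0<..<1} \<le> emeasure M ({1/4..3/4} \<union> ?E)"
      using sM by (intro emeasure_mono) (auto simp: sets_borel_of_unit_interval)
    also have "\<dots> \<le> emeasure M {1/4..3/4} + emeasure M ?E"
      using sM by (intro emeasure_subadditive) (auto simp: sets_borel_of_unit_interval)
    also have "\<dots> < \<infinity>"
      using that K null by (auto simp: radon_measure_on_def radon_measure_def)
    finally show ?thesis using sM by simp
  qed
  have "radon_measure_on unit_interval {1/4..3/4} \<sigma>" "radon_measure_on unit_interval {1/4..3/4} \<tau>"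
    and m: "\<forall>B\<in>sets (borel_of unit_interval). second_difference B = measure \<sigma> B - measure \<tau> B"
    using d by (auto simp: difference_on_def)
  then have \<sigma>: "sets \<sigma> = sets (borel_of unit_interval)" "emeasure \<sigma> {0<..<1} < \<infinity>"
    and \<tau>: "sets \<tau> = sets (borel_of unit_interval)" "emeasure \<tau> {0<..<1} < \<infinity>"
    using radon by blast+
  have emeas: "emeasure \<sigma> B = ennreal (measure \<sigma> B)" "emeasure \<tau> B = ennreal (measure \<tau> B)"
    if "B \<subseteq> {0<..<1}" for B
  proof -
    have "emeasure \<sigma> B \<le> emeasure \<sigma> {0<..<1}" "emeasure \<tau> B \<le> emeasure \<tau> {0<..<1}"
      using \<sigma> \<tau> that by (auto intro!: emeasure_mono simp: sets_borel_of_unit_interval)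
    then show "emeasure \<sigma> B = ennreal (measure \<sigma> B)" "emeasure \<tau> B = ennreal (measure \<tau> B)"
      using \<sigma> \<tau> by (auto intro!: emeasure_eq_ennreal_measure)
  qed
  define T :: "real set" where "T = {1/4, 1/2, 3/4}"
  define R :: "real set" where "R = {0<..<1} - T"
  have T: "finite T" "T \<subseteq> {0<..<1}" and R: "R \<in> sets (borel_of unit_interval)" "R \<subseteq> {0<..<1}"
    by (auto simp: T_def R_def sets_borel_of_unit_interval)
  \<comment> \<open>Nothing is known about \<sigma> and \<tau> separately; but
    \<open>second_difference\<close> vanishes on sets that avoid \<open>T\<close>, so the two
    measures agree there.\<close>
  have dens: "density \<sigma> (indicator R) = density \<tau> (indicator R)"
  proof (rule measure_eqI)
    fix B assume "B \<in> sets (density \<sigma> (indicator R))"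
    then have B: "B \<in> sets (borel_of unit_interval)" using \<sigma> by simp
    have "second_difference (R \<inter> B) = 0"
      by (simp add: second_difference_def R_def T_def)
    then have "measure \<sigma> (R \<inter> B) = measure \<tau> (R \<inter> B)"
      using m R B by auto
    then have "emeasure \<sigma> (R \<inter> B) = emeasure \<tau> (R \<inter> B)"
      using R(2) emeas(1)[of "R \<inter> B"] emeas(2)[of "R \<inter> B"] by (simp add: le_infI1)
    then show "emeasure (density \<sigma> (indicator R)) B = emeasure (density \<tau> (indicator R)) B"
      using \<sigma> \<tau> R B by (simp add: emeasure_restricted)
  qed (use \<sigma> \<tau> in simp)
  have F\<sigma>: "F \<in> borel_measurable \<sigma>" and F\<tau>: "F \<in> borel_measurable \<tau>"
    using meas \<sigma>(1) \<tau>(1) by (simp_all cong: measurable_cong_sets)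
  define c where "c = (\<integral>\<^sup>+x. F x \<partial>density \<tau> (indicator R))"
  \<comment> \<open>Finiteness is what permits cancelling \<open>c\<close> in the extended
    nonnegative reals; it follows from \<open>F\<close> being bounded by 1 and \<tau> being
    finite.\<close>
  have c_fin: "c < \<infinity>"
  proof -
    have "c \<le> (\<integral>\<^sup>+x. F x \<partial>\<tau>)"
      unfolding c_def R_def using nn_integral_split_finite[OF \<tau>(1) T F\<tau>] by simp
    also have "\<dots> \<le> (\<integral>\<^sup>+x. 1 \<partial>\<tau>)"
    proof (rule nn_integral_mono)
      fix x assume "x \<in> space \<tau>"
      then have "0 < x" "x < 1" using space_eq_unit_interval[OF \<tau>(1)] by auto
      then have "F x \<le> ennreal (parabola x)" "parabola x \<le> 1"
        using F_le parabola_bounds(4)[of x] by auto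
      then show "F x \<le> 1"
        using ennreal_leI[of "parabola x" 1] by (auto intro: order_trans)
    qed
    also have "\<dots> < \<infinity>"
      using \<tau> space_eq_unit_interval[OF \<tau>(1)] by simp
    finally show ?thesis .
  qed
  have "c + (\<Sum>t\<in>T. F t * emeasure \<sigma> {t}) = c + (\<Sum>t\<in>T. F t * emeasure \<tau> {t})"
    using eq nn_integral_split_finite[OF \<sigma>(1) T F\<sigma>] nn_integral_split_finite[OF \<tau>(1) T F\<tau>] dens
    by (simp add: c_def R_def)
  then have sums: "(\<Sum>t\<in>T. F t * emeasure \<sigma> {t}) = (\<Sum>t\<in>T. F t * emeasure \<tau> {t})"
    using c_fin by (auto simp: ennreal_add_left_cancel)
  define f where "f t = enn2real (F t)" for t
  have Ff: "F t = ennreal (f t)" "0 \<le> f t" "f t \<le> parabola t" if "0 < t" "t < 1" for t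
  proof -
    have "F t < top" using F_le[OF that] by (simp add: le_less_trans)
    then show "F t = ennreal (f t)" by (simp add: f_def)
    then show "0 \<le> f t" "f t \<le> parabola t"
      using F_le[OF that] parabola_bounds(1)[OF that] by (auto simp: f_def enn2real_leI)
  qed
  have half: "47/250 \<le> f (1/2)"
  proof -
    have "ennreal (47/250) \<le> F (1/2)"
      unfolding F_def P1_def using e2ennreal_mono[OF swept1_parabola(2)] by simp
    then show ?thesis
      using Ff[of "1/2"] by simp
  qed
  have s: "measure \<sigma> {1/4} = measure \<tau> {1/4} + 1" "measure \<sigma> {3/4} = measure \<tau> {3/4} + 1"
    "measure \<tau> {1/2} = measure \<sigma> {1/2} + 2"
    using m[THEN bspec, of "{1/4}"] m[THEN bspec, of "{3/4}"] m[THEN bspec, of "{1/2}"]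
    by (auto simp: second_difference_def singleton_borel_of_unit_interval)
  have "(\<Sum>t\<in>T. F t * emeasure M {t}) = ennreal (\<Sum>t\<in>T. f t * measure M {t})"
    if "\<And>t. t \<in> T \<Longrightarrow> emeasure M {t} = ennreal (measure M {t})" for M
  proof -
    have "(\<Sum>t\<in>T. F t * emeasure M {t}) = (\<Sum>t\<in>T. ennreal (f t * measure M {t}))"
      using T Ff that by (intro sum.cong) (auto simp: ennreal_mult subset_eq)
    also have "\<dots> = ennreal (\<Sum>t\<in>T. f t * measure M {t})"
      using T Ff by (intro sum_ennreal mult_nonneg_nonneg) auto
    finally show ?thesis .
  qed
  then have "ennreal (\<Sum>t\<in>T. f t * measure \<sigma> {t}) = ennreal (\<Sum>t\<in>T. f t * measure \<tau> {t})"
    using sums T emeas by (simp add: subset_eq)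
  then have "(\<Sum>t\<in>T. f t * measure \<sigma> {t}) = (\<Sum>t\<in>T. f t * measure \<tau> {t})"
    using T Ff by (subst (asm) ennreal_inj) (auto intro!: sum_nonneg mult_nonneg_nonneg)
  then have "f (1/4) + f (3/4) = 2 * f (1/2)"
    by (simp add: T_def s algebra_simps)
  \<comment> \<open>The two end values sum to at most 375/1000, while twice the middle value is at
    least 376/1000.\<close>
  moreover have "f (1/4) \<le> 3/16" "f (3/4) \<le> 3/16"
    using Ff(3)[of "1/4"] Ff(3)[of "3/4"] by (simp_all add: parabola_def)
  ultimately show False
    using half by simp
qed

theorem proposition5p4:
  shows "(\<forall>(X :: 'a topology) H K m.
            standing_assumptions X H \<and> compactin X K \<and> signed_measure_on X K m \<and>
            pure_binormal X H K m \<longrightarrow> one_normal X H K m)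
       \<and> (\<exists>(X :: real topology) H K m.
            standing_assumptions X H \<and> associated_spaces_coincide X H \<and>
            compactin X K \<and> signed_measure_on X K m \<and>
            one_normal X H K m \<and> \<not> pure_binormal X H K m)"
proof
  show "\<forall>(X :: 'a topology) H K m.
            standing_assumptions X H \<and> compactin X K \<and> signed_measure_on X K m \<and>
            pure_binormal X H K m \<longrightarrow> one_normal X H K m"
    using pure_binormal_imp_one_normal
    by (auto simp: standing_assumptions_def biharmonic_space_def)
  have "compactin unit_interval {1/4..3/4}"
    by (auto simp: compactin_unit_interval)
  then show "\<exists>(X :: real topology) H K m.
            standing_assumptions X H \<and> associated_spaces_coincide X H \<and>
            compactin X K \<and> signed_measure_on X K m \<and>
            one_normal X H K m \<and> \<not> pure_binormal X H K m"
    using standing_assumptions_cubic_pairs associated_spaces_coincide_cubic_pairs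
      signed_measure_second_difference one_normal_second_difference
      not_pure_binormal_second_difference by blast
qed

end
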